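(* Let $n\ge 3$, $K\ge 1$, $\varepsilon>0$, and let $\Omega\subset\mathbb R^n$ be a bounded domain. Then there exists a weakly $K$-quasiregular mapping $f\in W^{1,1}_{\mathrm{loc}}(\Omega;\mathbb R^n)$ whose singular set $$S_f:=\Big\{x\in\Omega:\ \limsup_{r\to0^+}\frac{1}{|B(x,r)|}\int_{B(x,r)}|f|\,dy=\infty\Big\}$$ has Hausdorff dimension at least $\min\left\{\frac{nK}{K+1},\,n-1\right\}-\varepsilon$. Moreover, for every $p\in(1,n)$ there exist $K_p=K(n,p)\ge1$ and a weakly $K_p$-quasiregular mapping $f\in W^{1,p}_{\mathrm{loc}}(\Omega;\mathbb R^n)$ whose singular set $S_f$ has Hausdorff dimension at least $n-p-\varepsilon$.
   Context: For an open set $\Omega\subset\mathbb R^n$ and $f\in W^{1,p}_{\mathrm{loc}}(\Omega;\mathbb R^n)$ with $p\ge 1$, let $Df$ be the distributional (weak) gradient and $J_f=\det Df$ the Jacobian determinant. The mapping $f$ is called weakly $K$-quasiregular ($K\ge1$) if $f\in W^{1,1}_{\mathrm{loc}}(\Omega;\mathbb R^n)$, either $J_f\ge 0$ a.e. in $\Omega$ or $J_f\le 0$ a.e. in $\Omega$, and $$\max_{\xi\in\mathbb S^{n-1}}|Df(x)\xi|\le K\min_{\xi\in\mathbb S^{n-1}}|Df(x)\xi|\quad\text{for a.e. }x\in\Omega.$$ $B(x,r)$ denotes the open ball of center $x$ and radius $r$, and $|\cdot|$ Lebesgue measure. *)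

theory Defs
  imports "HOL-Analysis.Analysis"
begin

definition partial_deriv :: "'n::finite \<Rightarrow> (real^'n \<Rightarrow> real) \<Rightarrow> real^'n \<Rightarrow> real" where
  "partial_deriv j g x = deriv (\<lambda>t. g (x + t *\<^sub>R axis j 1)) 0"

fun iter_partial :: "'n::finite list \<Rightarrow> (real^'n \<Rightarrow> real) \<Rightarrow> real^'n \<Rightarrow> real" where
  "iter_partial [] g = g"
| "iter_partial (j # js) g = partial_deriv j (iter_partial js g)"

definition smooth_fun :: "(real^'n::finite \<Rightarrow> real) \<Rightarrow> bool" where
  "smooth_fun g \<longleftrightarrow> (\<forall>js. continuous_on UNIV (iter_partial js g) \<and>
      (\<forall>j x. (\<lambda>t. iter_partial js g (x + t *\<^sub>R axis j 1)) differentiable (at 0)))"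

definition test_fun :: "(real^'n::finite) set \<Rightarrow> (real^'n \<Rightarrow> real) \<Rightarrow> bool" where
  "test_fun \<Omega> \<phi> \<longleftrightarrow> smooth_fun \<phi> \<and> (\<exists>C. compact C \<and> C \<subseteq> \<Omega> \<and> (\<forall>x. x \<notin> C \<longrightarrow> \<phi> x = 0))"

definition Lp_loc :: "real \<Rightarrow> 'a::euclidean_space set \<Rightarrow> ('a \<Rightarrow> 'b::real_normed_vector) \<Rightarrow> bool" where
  "Lp_loc p \<Omega> g \<longleftrightarrow> g \<in> borel_measurable (lebesgue_on \<Omega>) \<and>
     (\<forall>C. compact C \<and> C \<subseteq> \<Omega> \<longrightarrow>
        (\<integral>\<^sup>+ x. ennreal (norm (g x) powr p) * indicator C x \<partial>lebesgue) < \<infinity>)"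

definition weak_gradient :: "(real^'n::finite) set \<Rightarrow> (real^'n \<Rightarrow> real^'n) \<Rightarrow> (real^'n \<Rightarrow> real^'n^'n) \<Rightarrow> bool" where
  "weak_gradient \<Omega> f Df \<longleftrightarrow> Lp_loc 1 \<Omega> f \<and> Lp_loc 1 \<Omega> Df \<and>
     (\<forall>\<phi>. test_fun \<Omega> \<phi> \<longrightarrow> (\<forall>i j.
        (LINT x:\<Omega>|lebesgue. f x $ i * partial_deriv j \<phi> x) = - (LINT x:\<Omega>|lebesgue. Df x $ i $ j * \<phi> x)))"

definition sobolev_loc :: "real \<Rightarrow> (real^'n::finite) set \<Rightarrow> (real^'n \<Rightarrow> real^'n) \<Rightarrow> bool" where
  "sobolev_loc p \<Omega> f \<longleftrightarrow> (\<exists>Df. weak_gradient \<Omega> f Df \<and> Lp_loc p \<Omega> f \<and> Lp_loc p \<Omega> Df)"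

definition weakly_qr :: "real \<Rightarrow> (real^'n::finite) set \<Rightarrow> (real^'n \<Rightarrow> real^'n) \<Rightarrow> bool" where
  "weakly_qr K \<Omega> f \<longleftrightarrow> K \<ge> 1 \<and> (\<exists>Df. weak_gradient \<Omega> f Df \<and>
     ((AE x in lebesgue. x \<in> \<Omega> \<longrightarrow> det (Df x) \<ge> 0) \<or> (AE x in lebesgue. x \<in> \<Omega> \<longrightarrow> det (Df x) \<le> 0)) \<and>
     (AE x in lebesgue. x \<in> \<Omega> \<longrightarrow>
        (SUP \<xi>\<in>sphere 0 1. norm (Df x *v \<xi>)) \<le> K * (INF \<xi>\<in>sphere 0 1. norm (Df x *v \<xi>))))"

definition singular_set :: "(real^'n::finite) set \<Rightarrow> (real^'n \<Rightarrow> real^'n) \<Rightarrow> (real^'n) set" where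
  "singular_set \<Omega> f = {x \<in> \<Omega>. Limsup (at_right 0)
      (\<lambda>r. (\<integral>\<^sup>+ y. ennreal (norm (f y)) * indicator (ball x r) y \<partial>lebesgue) / emeasure lebesgue (ball x r)) = \<infinity>}"

definition diam_pow :: "real \<Rightarrow> 'a::metric_space set \<Rightarrow> ennreal" where
  "diam_pow s C = (if C = {} then 0 else if s = 0 then 1 else ennreal (diameter C powr s))"

definition hausdorff_pre :: "real \<Rightarrow> real \<Rightarrow> 'a::metric_space set \<Rightarrow> ennreal" where
  "hausdorff_pre s \<delta> A = (INF C \<in> {C :: nat \<Rightarrow> 'a set. A \<subseteq> (\<Union>i. C i) \<and> (\<forall>i. bounded (C i) \<and> diameter (C i) \<le> \<delta>)}.
      (\<Sum>i. diam_pow s (C i)))"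

definition hausdorff_measure :: "real \<Rightarrow> 'a::metric_space set \<Rightarrow> ennreal" where
  "hausdorff_measure s A = (SUP \<delta>\<in>{0<..}. hausdorff_pre s \<delta> A)"

definition hausdorff_dim :: "'a::metric_space set \<Rightarrow> real" where
  "hausdorff_dim A = Inf {s. s \<ge> 0 \<and> hausdorff_measure s A = 0}"

end

theory Submission
  imports Defs
begin

text \<open>
  The building block is the radial map \<open>x \<mapsto> x / |x|^(1 + a)\<close>: it is orientation reversing,
  has distortion \<open>max a (1/a)\<close>, equals the identity on the unit sphere, and its size grows like
  \<open>|x|^(-a)\<close>. Pack the unit ball by disjoint balls \<open>B(c, s)\<close> covering almost everything. Starting
  from the identity, use a rescaled radial map in each annulus \<open>\<tau> s < |x - c| < s\<close>; it is a
  similarity on the sphere \<open>|x - c| = \<tau> s\<close>, so that the similarity continues it to the inner ball,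
  where the same modification is repeated. The inner balls shrink to a null set, and almost
  everywhere the limit has the gradient of a similarity composed with the radial map. Each
  repetition multiplies the \<open>L^p\<close> norm (to the power \<open>p\<close>) of the gradient on the unfinished part
  by at most \<open>\<tau>^(n - p (1 + a)) < 1\<close>, hence the limit is in \<open>W^(1,p)\<close>.

  If the packing contains a grid of \<open>m^n\<close> balls of radius \<open>r\<close> comparable to \<open>1/m\<close> and \<open>\<tau>\<close> is chosen
  with \<open>r \<tau>^(-a)\<close> equal to a large constant, then the values of the limit grow geometrically along
  nested inner grid balls, so that every point of the Cantor set with \<open>m^n\<close> pieces of ratio \<open>\<tau> r\<close>
  is singular. Its dimension tends to \<open>n a / (1 + a)\<close> as \<open>m\<close> tends to infinity.
\<close>

section \<open>Lower bounds for the Hausdorff dimension\<close>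

text \<open>Obstacle: the limit is unbounded near every point of the Cantor set, so it is never
  differentiated there. It is written as \<open>W + inversion a\<close>, where \<open>W\<close> is
  an L^1-convergent series of rescaled copies of one Lipschitz correction \<open>u\<close> supported
  in the unit ball; integration by parts is proved for \<open>u\<close> and passes to the series.
  Distortion, L^p bounds and growth all come from the functional equation \<open>\<Phi> (c i +
  \<kappa> i *\<^sub>R y) = c i + b i *\<^sub>R \<Phi> y\<close>. Origin of the dimension: r of
  order 1/m and constant r \<tau>^(-a) force \<tau> of order m^(-1/a), so the ratio \<tau> r has
  order m^(-(1+a)/a), and m^n such pieces give n a/(1+a). With p = 1, a = K gives nK/(K+1) until the
  constraint a < n - 1 caps it near n - 1; for general p, a close to n/p - 1 gives n - p. No measure
  on the Cantor set is needed: it is parametrised by the unit cube, with an inverse that is Hoelder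
  of exponent close to a/(1+a), so a cheap cover would pull back to a cover of the cube with volume
  below 1.\<close>

lemma hausdorff_pre_less_iff:
  "hausdorff_pre s \<delta> A < e \<longleftrightarrow>
    (\<exists>C. A \<subseteq> (\<Union>i::nat. C i) \<and> (\<forall>i. bounded (C i) \<and> diameter (C i) \<le> \<delta>) \<and> (\<Sum>i. diam_pow s (C i)) < e)"
  unfolding hausdorff_pre_def INF_less_iff by auto

lemma hausdorff_measure_eq_0_iff:
  "hausdorff_measure s A = 0 \<longleftrightarrow>
    (\<forall>\<delta>>0. \<forall>e>0. \<exists>C. A \<subseteq> (\<Union>i::nat. C i) \<and> (\<forall>i. bounded (C i) \<and> diameter (C i) \<le> \<delta>) \<and>
      (\<Sum>i. diam_pow s (C i)) < e)"
proof -
  have "hausdorff_measure s A = 0 \<longleftrightarrow> (\<forall>\<delta>>0. hausdorff_pre s \<delta> A = 0)"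
  proof
    assume L: "hausdorff_measure s A = 0"
    show "\<forall>\<delta>>0. hausdorff_pre s \<delta> A = 0"
    proof (intro allI impI)
      fix \<delta> :: real assume "\<delta> > 0"
      then have "hausdorff_pre s \<delta> A \<le> hausdorff_measure s A"
        unfolding hausdorff_measure_def by (intro SUP_upper) auto
      then show "hausdorff_pre s \<delta> A = 0" using L by simp
    qed
  next
    assume R: "\<forall>\<delta>>0. hausdorff_pre s \<delta> A = 0"
    have "hausdorff_measure s A \<le> 0"
      unfolding hausdorff_measure_def by (intro SUP_least) (use R in auto)
    then show "hausdorff_measure s A = 0" by simp
  qed
  also have "\<dots> \<longleftrightarrow> (\<forall>\<delta>>0. \<forall>e>0. hausdorff_pre s \<delta> A < e)"
    by (metis not_gr_zero order_less_irrefl)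
  finally show ?thesis unfolding hausdorff_pre_less_iff .
qed

text \<open>Covers of mesh at most 1 suffice, and for diameters at most 1 a larger exponent gives a
  smaller power. Exponent 0 is treated apart because \<open>diam_pow 0\<close> counts a nonempty set
  as 1 whereas \<open>0 powr 0 = 0\<close>.\<close>

lemma hausdorff_measure_eq_0_mono_exponent:
  assumes "hausdorff_measure s A = 0" "0 \<le> s" "s \<le> s'"
  shows "hausdorff_measure s' A = 0"
  unfolding hausdorff_measure_eq_0_iff
proof (intro allI impI)
  fix \<delta> :: real and e :: ennreal assume "\<delta> > 0" "e > 0"
  then have "min \<delta> 1 > 0" by simp
  from assms(1)[unfolded hausdorff_measure_eq_0_iff, rule_format, OF this \<open>e > 0\<close>]
  obtain C where C: "A \<subseteq> (\<Union>i::nat. C i)"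
      "\<And>i. bounded (C i)" "\<And>i. diameter (C i) \<le> min \<delta> 1" "(\<Sum>i. diam_pow s (C i)) < e"
    by auto
  have "diam_pow s' (C i) \<le> diam_pow s (C i)" for i
  proof (cases "s = 0 \<or> C i = {}")
    case True
    have "diameter (C i) powr s' \<le> 1" if "C i \<noteq> {}"
      using C(2,3)[of i] diameter_ge_0[OF C(2)[of i]] assms by (intro powr_le1) auto
    then show ?thesis using True by (auto simp: diam_pow_def)
  next
    case False
    have "diameter (C i) powr s' \<le> diameter (C i) powr s"
    proof (cases "diameter (C i) = 0")
      case False
      then have "0 < diameter (C i)" using diameter_ge_0[OF C(2)[of i]] by simp
      then show ?thesis using C(3)[of i] assms by (intro powr_mono') auto
    qed simp
    then show ?thesis using False assms by (auto simp: diam_pow_def ennreal_leI)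
  qed
  then have "(\<Sum>i. diam_pow s' (C i)) \<le> (\<Sum>i. diam_pow s (C i))"
    by (intro suminf_le) auto
  then show "\<exists>C. A \<subseteq> (\<Union>i::nat. C i) \<and> (\<forall>i. bounded (C i) \<and> diameter (C i) \<le> \<delta>) \<and>
      (\<Sum>i. diam_pow s' (C i)) < e"
    using C by (intro exI[of _ C]) (auto intro: order_le_less_trans)
qed

text \<open>Replaces the mass distribution principle: the preimage of a covering set
  \<open>D i\<close> lies in a ball of radius \<open>C * diameter (D i) powr (s / n)\<close>, whose
  volume is a fixed multiple of the s-th power of the diameter. These balls cover the unit cube, so
  the sum cannot be small.\<close>

lemma hausdorff_measure_nonzero_if_inverse_Hoelder:
  fixes h :: "'a::euclidean_space \<Rightarrow> 'b::metric_space"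
  assumes s: "0 < s" and hA: "h ` box 0 One \<subseteq> A" and Cpos: "0 \<le> C"
    and hoelder: "\<And>t t'. t \<in> box 0 One \<Longrightarrow> t' \<in> box 0 One \<Longrightarrow>
        dist t t' \<le> C * dist (h t) (h t') powr (s / real DIM('a))"
  shows "hausdorff_measure s A \<noteq> 0"
proof
  assume Z: "hausdorff_measure s A = 0"
  define V where "V = unit_ball_vol (real DIM('a)) * C ^ DIM('a)"
  have V0: "0 \<le> V" using Cpos by (simp add: V_def)
  \<comment> \<open>\<open>V\<close> is the factor between \<open>diam_pow s\<close> and volume, so
    a sum below this threshold leaves total volume less than 1; the \<open>+ 1\<close> covers
    \<open>V = 0\<close>.\<close>
  have "ennreal (1 / (2 * (V + 1))) > 0" using V0 by simp
  then obtain D where D: "A \<subseteq> (\<Union>i::nat. D i)" "\<And>i. bounded (D i)"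
      "(\<Sum>i. diam_pow s (D i)) < ennreal (1 / (2 * (V + 1)))"
    using Z unfolding hausdorff_measure_eq_0_iff by (meson zero_less_one)
  define P where "P i = {t \<in> box 0 One. h t \<in> D i}" for i
  define R where "R i = C * diameter (D i) powr (s / real DIM('a))" for i
  have R0: "R i \<ge> 0" for i using Cpos by (simp add: R_def)
  \<comment> \<open>\<open>h\<close> is not assumed measurable, so each preimage is enclosed in a
    Borel set before it is measured.\<close>
  have "\<exists>B. B \<in> sets lborel \<and> P i \<subseteq> B \<and> emeasure lborel B \<le> ennreal V * diam_pow s (D i)" for i
  proof (cases "P i = {}")
    case True
    then show ?thesis by (intro exI[of _ "{}"]) auto
  next
    case False
    then obtain t0 where t0: "t0 \<in> P i" by auto
    then have ne: "D i \<noteq> {}" by (auto simp: P_def)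
    have "P i \<subseteq> cball t0 (R i)"
    proof
      fix t assume t: "t \<in> P i"
      have "dist t0 t \<le> C * dist (h t0) (h t) powr (s / real DIM('a))"
        using t t0 by (intro hoelder) (auto simp: P_def)
      also have "\<dots> \<le> R i"
        unfolding R_def using t t0 s Cpos
        by (intro mult_left_mono powr_mono2 diameter_bounded_bound[OF D(2)]) (auto simp: P_def)
      finally show "t \<in> cball t0 (R i)" by simp
    qed
    moreover have "emeasure lborel (cball t0 (R i)) = ennreal V * diam_pow s (D i)"
    proof -
      have "(diameter (D i) powr (s / real DIM('a))) ^ DIM('a) = diameter (D i) powr s"
        using diameter_ge_0[OF D(2)[of i]]
        by (cases "diameter (D i) = 0") (simp_all add: powr_realpow[symmetric] powr_powr)
      then have "unit_ball_vol (real DIM('a)) * R i ^ DIM('a) = V * diameter (D i) powr s"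
        by (simp add: R_def V_def power_mult_distrib)
      then show ?thesis
        using ne s V0 R0[of i] by (simp add: emeasure_cball diam_pow_def ennreal_mult)
    qed
    ultimately show ?thesis by (intro exI[of _ "cball t0 (R i)"]) auto
  qed
  then obtain B where B: "\<And>i. B i \<in> sets lborel" "\<And>i. P i \<subseteq> B i"
      "\<And>i. emeasure lborel (B i) \<le> ennreal V * diam_pow s (D i)"
    by metis
  have "box 0 One \<subseteq> (\<Union>i. B i)"
  proof
    fix t :: 'a assume t: "t \<in> box 0 One"
    then obtain i where "h t \<in> D i" using hA D(1) by blast
    then show "t \<in> (\<Union>i. B i)" using t B(2)[of i] by (auto simp: P_def)
  qed
  then have "emeasure lborel (box 0 One :: 'a set) \<le> emeasure lborel (\<Union>i. B i)"
    using B(1) by (intro emeasure_mono) auto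
  also have "\<dots> \<le> (\<Sum>i. emeasure lborel (B i))"
    using B(1) by (intro emeasure_subadditive_countably) auto
  also have "\<dots> \<le> (\<Sum>i. ennreal V * diam_pow s (D i))"
    using B(3) by (intro suminf_le) auto
  also have "\<dots> = ennreal V * (\<Sum>i. diam_pow s (D i))" by simp
  also have "\<dots> \<le> ennreal V * ennreal (1 / (2 * (V + 1)))"
    using D(3) by (intro mult_left_mono) auto
  also have "\<dots> = ennreal (V * (1 / (2 * (V + 1))))"
    using V0 by (intro ennreal_mult[symmetric]) auto
  also have "\<dots> < ennreal 1"
    using V0 by (intro ennreal_lessI) (auto simp: field_simps)
  also have "ennreal 1 = emeasure lborel (box 0 One :: 'a set)"
    by (simp add: emeasure_lborel_box_eq)
  finally show False by simp
qed

text \<open>Guarantees that the infimum defining \<open>hausdorff_dim\<close> is taken over a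
  nonempty set. The exponent n + 1 leaves room for crude counting: of order \<open>N ^ n\<close>
  cubes of side \<open>1 / N\<close> contribute at most \<open>K / N\<close> in total.\<close>

lemma hausdorff_measure_bounded_eq_0:
  fixes A :: "(real^'n::finite) set"
  assumes "bounded A"
  shows "hausdorff_measure (real CARD('n) + 1) A = 0"
  unfolding hausdorff_measure_eq_0_iff
proof (intro allI impI)
  fix \<delta> :: real and e :: ennreal assume \<delta>: "\<delta> > 0" and e: "e > 0"
  let ?n = "CARD('n)"
  obtain L0 where L0: "\<And>x. x \<in> A \<Longrightarrow> norm x \<le> L0" using assms by (auto simp: bounded_iff)
  obtain L :: nat where L: "max 1 L0 \<le> real L" using real_arch_simple by blast
  define K where "K = (2 * real L + 3) ^ ?n * real ?n powr (real ?n + 1)"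
  obtain e' where e': "e' > 0" "ennreal e' \<le> e"
  proof (cases e)
    case (real r)
    then show ?thesis using e that[of r] by (auto simp: ennreal_less_zero_iff)
  next
    case top
    then show ?thesis using that[of 1] by simp
  qed
  have K0: "K \<ge> 0" by (simp add: K_def)
  \<comment> \<open>The second bound makes the mesh at most \<open>\<delta>\<close>, the third makes
    the total \<open>K / N\<close> smaller than \<open>e'\<close>, a finite substitute for a
    possibly infinite \<open>e\<close>.\<close>
  obtain N :: nat where N: "max 1 (max (real ?n / \<delta>) ((K + 1) / e')) < real N"
    using reals_Archimedean2 by blast
  then have N0: "N > 0" by simp
  define cell where "cell z = {x::real^'n. \<forall>i. \<lfloor>x $ i * real N\<rfloor> = z i}" for z
  define Z where "Z = PiE (UNIV::'n set) (\<lambda>_. {- int (L * N) - 1 .. int (L * N) + 1})"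
  have fZ: "finite Z" unfolding Z_def by (intro finite_PiE) auto
  have cZ: "real (card Z) = (2 * real L * real N + 3) ^ ?n"
    unfolding Z_def by (subst card_PiE) (auto simp: prod_constant algebra_simps)
  have AZ: "A \<subseteq> (\<Union>z\<in>Z. cell z)"
  proof
    fix x assume "x \<in> A"
    define z where "z i = \<lfloor>x $ i * real N\<rfloor>" for i
    have "- int (L * N) - 1 \<le> z i \<and> z i \<le> int (L * N) + 1" for i
    proof -
      have "\<bar>x $ i\<bar> \<le> real L" using component_le_norm_cart[of x i] L0[OF \<open>x \<in> A\<close>] L by linarith
      then have "\<bar>x $ i * real N\<bar> \<le> real L * real N" by (simp add: abs_mult mult_right_mono)
      then have "\<bar>x $ i * real N\<bar> \<le> of_int (int (L * N))" by simp
      then show ?thesis unfolding z_def by linarith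
    qed
    then have "z \<in> Z" by (auto simp: Z_def)
    moreover have "x \<in> cell z" by (simp add: cell_def z_def)
    ultimately show "x \<in> (\<Union>z\<in>Z. cell z)" by blast
  qed
  have dist_cell: "dist x y \<le> real ?n / real N" if "x \<in> cell z" "y \<in> cell z" for x y z
  proof -
    have "norm (x - y) \<le> (\<Sum>i\<in>UNIV. \<bar>(x - y) $ i\<bar>)" by (rule norm_le_l1_cart)
    also have "\<dots> \<le> (\<Sum>i\<in>(UNIV::'n set). 1 / real N)"
    proof (rule sum_mono)
      fix i :: 'n
      have "\<lfloor>x $ i * real N\<rfloor> = \<lfloor>y $ i * real N\<rfloor>" using that by (simp add: cell_def)
      then have "\<bar>x $ i * real N - y $ i * real N\<bar> \<le> 1" by linarith
      then have "\<bar>x $ i - y $ i\<bar> * real N \<le> 1" by (simp add: abs_mult flip: left_diff_distrib)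
      then show "\<bar>(x - y) $ i\<bar> \<le> 1 / real N" using N0 by (simp add: field_simps)
    qed
    finally show ?thesis by (simp add: dist_norm)
  qed
  have bcell: "bounded (cell z)" for z
    using dist_cell[of _ z] by (meson bounded_any_center bounded_def)
  have dcell: "diameter (cell z) \<le> real ?n / real N" for z
    using dist_cell by (intro diameter_le) (auto simp: dist_norm)
  obtain g where g: "bij_betw g {0..<card Z} Z" using ex_bij_betw_nat_finite[OF fZ] by blast
  define C where "C i = (if i < card Z then cell (g i) else {})" for i
  have cov: "A \<subseteq> (\<Union>i. C i)"
  proof
    fix x assume "x \<in> A"
    then obtain z where z: "z \<in> Z" "x \<in> cell z" using AZ by blast
    then obtain i where "i < card Z" "g i = z" using bij_betw_imp_surj_on[OF g]
      by (metis imageE atLeastLessThan_iff)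
    then show "x \<in> (\<Union>i. C i)" using z by (auto simp: C_def intro!: exI[of _ i])
  qed
  have nd: "real ?n / real N \<le> \<delta>" using N N0 \<delta> by (simp add: field_simps)
  have dC: "bounded (C i) \<and> diameter (C i) \<le> \<delta>" for i
    using bcell[of "g i"] dcell[of "g i"] nd \<delta> by (auto simp: C_def)
  have "diam_pow (real ?n + 1) (C i) \<le> (if i < card Z then ennreal ((real ?n / real N) powr (real ?n + 1)) else 0)" for i
    using dcell[of "g i"] diameter_ge_0[OF bcell[of "g i"]]
    by (auto simp: C_def diam_pow_def intro!: ennreal_leI powr_mono2)
  then have "(\<Sum>i. diam_pow (real ?n + 1) (C i)) \<le> (\<Sum>i. if i < card Z then ennreal ((real ?n / real N) powr (real ?n + 1)) else 0)"
    by (intro suminf_le) auto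
  also have "\<dots> = (\<Sum>i<card Z. ennreal ((real ?n / real N) powr (real ?n + 1)))"
    by (subst suminf_finite[of "{..<card Z}"]) auto
  also have "\<dots> = ennreal (real (card Z) * (real ?n / real N) powr (real ?n + 1))"
    by (simp add: ennreal_mult flip: ennreal_of_nat_eq_real_of_nat)
  also have "\<dots> \<le> ennreal (K / real N)"
  proof (rule ennreal_leI)
    have "2 * real L * real N + 3 \<le> (2 * real L + 3) * real N" using N0 by (simp add: algebra_simps)
    then have "real (card Z) \<le> ((2 * real L + 3) * real N) ^ ?n"
      unfolding cZ by (intro power_mono) auto
    then have "real (card Z) * (real ?n / real N) powr (real ?n + 1)
        \<le> ((2 * real L + 3) * real N) ^ ?n * (real ?n / real N) powr (real ?n + 1)"
      by (intro mult_right_mono) auto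
    also have "\<dots> = (2 * real L + 3) ^ ?n * real N ^ ?n * (real ?n powr (real ?n + 1) / (real N ^ ?n * real N))"
      using N0 by (simp add: power_mult_distrib powr_divide powr_add powr_realpow)
    also have "\<dots> = K / real N" using N0 by (simp add: K_def)
    finally show "real (card Z) * (real ?n / real N) powr (real ?n + 1) \<le> K / real N" .
  qed
  also have "\<dots> < ennreal e'"
  proof (rule ennreal_lessI)
    have "(K + 1) / e' < real N" using N by simp
    then have "K + 1 < real N * e'" using e' by (simp add: field_simps)
    then show "K / real N < e'" using N0 by (simp add: field_simps)
  qed (use e' in auto)
  finally have "(\<Sum>i. diam_pow (real ?n + 1) (C i)) < e" using e' by simp
  then show "\<exists>C. A \<subseteq> (\<Union>i::nat. C i) \<and> (\<forall>i. bounded (C i) \<and> diameter (C i) \<le> \<delta>) \<and>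
      (\<Sum>i. diam_pow (real ?n + 1) (C i)) < e"
    using cov dC by blast
qed

text \<open>If some exponent below \<open>s\<close> had measure zero, then so would
  \<open>s\<close>, contradicting the covering argument.\<close>

lemma hausdorff_dim_ge_if_inverse_Hoelder:
  fixes A :: "(real^'n::finite) set" and h :: "real^'n \<Rightarrow> real^'n"
  assumes "bounded A" "0 < s" "h ` box 0 One \<subseteq> A" "0 \<le> C"
    and "\<And>t t'. t \<in> box 0 One \<Longrightarrow> t' \<in> box 0 One \<Longrightarrow>
        dist t t' \<le> C * dist (h t) (h t') powr (s / real CARD('n))"
  shows "s \<le> hausdorff_dim A"
  unfolding hausdorff_dim_def
proof (rule cInf_greatest)
  show "{s. 0 \<le> s \<and> hausdorff_measure s A = 0} \<noteq> {}"
    using hausdorff_measure_bounded_eq_0[OF assms(1)] by (auto intro!: exI[of _ "real CARD('n) + 1"])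
next
  fix s' assume s': "s' \<in> {s. 0 \<le> s \<and> hausdorff_measure s A = 0}"
  show "s \<le> s'"
  proof (rule ccontr)
    assume "\<not> s \<le> s'"
    then have "hausdorff_measure s A = 0"
      using s' hausdorff_measure_eq_0_mono_exponent[of s' A s] by simp
    moreover have "hausdorff_measure s A \<noteq> 0"
      using assms by (intro hausdorff_measure_nonzero_if_inverse_Hoelder[of s h A C]) auto
    ultimately show False by simp
  qed
qed

section \<open>Weak gradients\<close>

definition zoom :: "'a::real_vector \<Rightarrow> real \<Rightarrow> 'a \<Rightarrow> 'a" where
  "zoom c k x = (1 / k) *\<^sub>R (x - c)"

lemma zoom_measurable [measurable]: "zoom (c::'a::euclidean_space) k \<in> borel_measurable borel"
  unfolding zoom_def by measurable

lemma zoom_affine [simp]: "k \<noteq> 0 \<Longrightarrow> zoom c k (c + k *\<^sub>R y) = y"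
  by (simp add: zoom_def)

lemma affine_zoom [simp]: "k \<noteq> 0 \<Longrightarrow> c + k *\<^sub>R zoom c k x = x"
  by (simp add: zoom_def)

lemma norm_zoom: "k > 0 \<Longrightarrow> norm (zoom c k x) = dist x c / k"
  by (simp add: zoom_def dist_norm)

lemma nn_integral_zoom:
  fixes c :: "'a::euclidean_space"
  assumes k: "k > 0" and f [measurable]: "f \<in> borel_measurable borel"
  shows "(\<integral>\<^sup>+x. f (zoom c k x) \<partial>lborel) = ennreal (k ^ DIM('a)) * (\<integral>\<^sup>+x. f x \<partial>lborel)"
proof -
  have "(\<integral>\<^sup>+x. f (zoom c k x) \<partial>lborel)
      = (\<integral>\<^sup>+x. f (zoom c k x) \<partial>density (distr lborel borel (\<lambda>x. c + k *\<^sub>R x)) (\<lambda>_. ennreal (\<bar>k\<bar> ^ DIM('a))))"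
    using k by (subst lborel_affine[of k c]) auto
  also have "\<dots> = (\<integral>\<^sup>+x. ennreal (k ^ DIM('a)) * f x \<partial>lborel)"
    using k by (subst nn_integral_density; simp add: nn_integral_distr)
  finally show ?thesis by (simp add: nn_integral_cmult)
qed

lemma
  fixes c :: "'a::euclidean_space" and f :: "'a \<Rightarrow> 'b::{banach, second_countable_topology}"
  assumes k: "k > 0" and f: "integrable lborel f"
  shows integrable_zoom: "integrable lborel (\<lambda>x. f (zoom c k x))"
    and integral_zoom: "(\<integral>x. f (zoom c k x) \<partial>lborel) = (k ^ DIM('a)) *\<^sub>R (\<integral>x. f x \<partial>lborel)"
proof -
  have [measurable]: "f \<in> borel_measurable borel" using f by auto
  show "integrable lborel (\<lambda>x. f (zoom c k x))"
    using f k unfolding integrable_iff_bounded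
    by (subst nn_integral_zoom) (auto simp: ennreal_mult_less_top)
  show "(\<integral>x. f (zoom c k x) \<partial>lborel) = (k ^ DIM('a)) *\<^sub>R (\<integral>x. f x \<partial>lborel)"
  proof -
    have "(\<integral>x. f (zoom c k x) \<partial>lborel)
        = (\<integral>x. f (zoom c k x) \<partial>density (distr lborel borel (\<lambda>x. c + k *\<^sub>R x)) (\<lambda>_. ennreal (\<bar>k\<bar> ^ DIM('a))))"
      using k by (subst lborel_affine[of k c]) auto
    also have "\<dots> = (\<integral>x. (k ^ DIM('a)) *\<^sub>R f x \<partial>lborel)"
      using k by (subst integral_density; simp add: integral_distr)
    finally show ?thesis by simp
  qed
qed

lemma AE_zoom:
  fixes c :: "'a::euclidean_space"
  assumes k: "k > 0" and P: "AE x in lborel. P x"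
  shows "AE x in lborel. P (zoom c k x)"
proof -
  obtain N where N: "N \<in> null_sets lborel" "\<And>x. \<not> P x \<Longrightarrow> x \<in> N"
    using P unfolding eventually_ae_filter by auto
  then have [measurable]: "N \<in> sets borel" by auto
  have "(\<integral>\<^sup>+x. indicator N (zoom c k x) \<partial>lborel) = 0"
    using N(1) by (subst nn_integral_zoom[OF k]) auto
  then have "AE x in lborel. indicator N (zoom c k x) = (0::ennreal)"
    by (subst (asm) nn_integral_0_iff_AE) auto
  then show ?thesis
    by eventually_elim (use N(2) in \<open>auto simp: indicator_def split: if_splits\<close>)
qed

lemma AE_summable_norm:
  fixes f :: "nat \<Rightarrow> 'a \<Rightarrow> 'b::{banach, second_countable_topology}"
  assumes f [measurable]: "\<And>i. integrable M (f i)"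
    and s: "summable (\<lambda>i. \<integral>x. norm (f i x) \<partial>M)"
  shows "AE x in M. summable (\<lambda>i. norm (f i x))"
proof -
  have "(\<integral>\<^sup>+x. (\<Sum>i. ennreal (norm (f i x))) \<partial>M) = (\<Sum>i. \<integral>\<^sup>+x. ennreal (norm (f i x)) \<partial>M)"
    using f by (intro nn_integral_suminf) auto
  also have "\<dots> = (\<Sum>i. ennreal (\<integral>x. norm (f i x) \<partial>M))"
    using f by (intro suminf_cong nn_integral_eq_integral) auto
  also have "\<dots> = ennreal (\<Sum>i. \<integral>x. norm (f i x) \<partial>M)"
    using s by (intro suminf_ennreal2) auto
  finally have "(\<integral>\<^sup>+x. (\<Sum>i. ennreal (norm (f i x))) \<partial>M) \<noteq> \<infinity>" by simp
  then have "AE x in M. (\<Sum>i. ennreal (norm (f i x))) \<noteq> \<infinity>"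
    using f by (intro nn_integral_PInf_AE) auto
  then show ?thesis
    by eventually_elim (auto intro: summable_suminf_not_top)
qed

lemma integral_norm_suminf_le:
  fixes f :: "nat \<Rightarrow> 'a \<Rightarrow> 'b::{banach, second_countable_topology}"
  assumes f: "\<And>i. integrable M (f i)"
    and s: "summable (\<lambda>i. \<integral>x. norm (f i x) \<partial>M)"
  shows "(\<integral>x. norm (\<Sum>i. f i x) \<partial>M) \<le> (\<Sum>i. \<integral>x. norm (f i x) \<partial>M)"
proof -
  note ae = AE_summable_norm[OF f s]
  have "(\<integral>x. norm (\<Sum>i. f i x) \<partial>M) \<le> (\<integral>x. (\<Sum>i. norm (f i x)) \<partial>M)"
  proof (rule integral_mono_AE)
    show "integrable M (\<lambda>x. norm (\<Sum>i. f i x))"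
      using integrable_suminf[OF f ae s] by simp
    show "integrable M (\<lambda>x. \<Sum>i. norm (f i x))"
      using f s ae by (intro integrable_suminf) auto
    show "AE x in M. norm (\<Sum>i. f i x) \<le> (\<Sum>i. norm (f i x))"
      using ae by eventually_elim (rule summable_norm)
  qed
  also have "\<dots> = (\<Sum>i. \<integral>x. norm (f i x) \<partial>M)"
    using f s ae by (intro integral_suminf) auto
  finally show ?thesis .
qed

text \<open>A class of test functions that is wider than \<open>test_fun\<close>: one directional
  derivative, boundedness instead of compact support. It is stable under affine substitutions, which
  is what transporting weak gradients to small balls requires.\<close>

definition C1_along :: "'a::euclidean_space \<Rightarrow> ('a \<Rightarrow> real) \<Rightarrow> ('a \<Rightarrow> real) \<Rightarrow> bool" where
  "C1_along e \<phi> \<phi>' \<longleftrightarrow> continuous_on UNIV \<phi> \<and> continuous_on UNIV \<phi>' \<and>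
     bounded (range \<phi>) \<and> bounded (range \<phi>') \<and>
     (\<forall>x. ((\<lambda>t. \<phi> (x + t *\<^sub>R e)) has_real_derivative \<phi>' x) (at 0))"

lemma C1_along_measurable:
  assumes "C1_along e \<phi> \<phi>'"
  shows "\<phi> \<in> borel_measurable borel" "\<phi>' \<in> borel_measurable borel"
  using assms by (auto simp: C1_along_def intro: borel_measurable_continuous_onI)

lemma C1_along_bounds:
  assumes "C1_along e \<phi> \<phi>'"
  obtains B where "0 \<le> B" "\<And>x. \<bar>\<phi> x\<bar> \<le> B" "\<And>x. \<bar>\<phi>' x\<bar> \<le> B"
proof -
  from assms obtain B1 B2 where "\<And>x. \<bar>\<phi> x\<bar> \<le> B1" "\<And>x. \<bar>\<phi>' x\<bar> \<le> B2"
    unfolding C1_along_def bounded_iff by (metis UNIV_I imageI real_norm_def)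
  then show ?thesis
    using that[of "max 0 (max B1 B2)"] by (metis max.cobounded1 max.coboundedI2 order_trans max.cobounded2)
qed

lemma C1_along_lipschitz:
  assumes C: "C1_along e \<phi> \<phi>'" and B: "\<And>x. \<bar>\<phi>' x\<bar> \<le> B"
  shows "\<bar>\<phi> (x + t *\<^sub>R e) - \<phi> x\<bar> \<le> B * \<bar>t\<bar>"
proof -
  have "((\<lambda>t. \<phi> (x + t *\<^sub>R e)) has_real_derivative \<phi>' (x + s *\<^sub>R e)) (at s)" for s
  proof -
    have "((\<lambda>t. \<phi> ((x + s *\<^sub>R e) + t *\<^sub>R e)) has_real_derivative \<phi>' (x + s *\<^sub>R e)) (at (s - s))"
      using C by (auto simp: C1_along_def)
    then have "((\<lambda>t. \<phi> ((x + s *\<^sub>R e) + (t - s) *\<^sub>R e)) has_real_derivative \<phi>' (x + s *\<^sub>R e) * (1 - 0)) (at s)"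
      by (rule DERIV_chain2) (auto intro!: derivative_eq_intros)
    then show ?thesis by (simp add: algebra_simps)
  qed
  then have "norm (\<phi> (x + t *\<^sub>R e) - \<phi> (x + 0 *\<^sub>R e)) \<le> B * norm (t - 0)"
    using B by (intro field_differentiable_bound[of UNIV "\<lambda>t. \<phi> (x + t *\<^sub>R e)" "\<lambda>s. \<phi>' (x + s *\<^sub>R e)"])
       auto
  then show ?thesis by simp
qed

lemma C1_along_affine:
  assumes C: "C1_along e \<phi> \<phi>'"
  shows "C1_along e (\<lambda>y. \<phi> (c + k *\<^sub>R y)) (\<lambda>y. k * \<phi>' (c + k *\<^sub>R y))"
  unfolding C1_along_def
proof (intro conjI allI)
  show "continuous_on UNIV (\<lambda>y. \<phi> (c + k *\<^sub>R y))" "continuous_on UNIV (\<lambda>y. k * \<phi>' (c + k *\<^sub>R y))"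
    using C by (auto simp: C1_along_def intro!: continuous_intros elim!: continuous_on_compose2)
  obtain B where B: "0 \<le> B" "\<And>x. \<bar>\<phi> x\<bar> \<le> B" "\<And>x. \<bar>\<phi>' x\<bar> \<le> B"
    using C1_along_bounds[OF C] by blast
  show "bounded (range (\<lambda>y. \<phi> (c + k *\<^sub>R y)))" using B by (auto simp: bounded_iff)
  show "bounded (range (\<lambda>y. k * \<phi>' (c + k *\<^sub>R y)))"
    using B by (auto simp: bounded_iff abs_mult intro!: exI[of _ "\<bar>k\<bar> * B"] mult_left_mono)
  fix x
  have "((\<lambda>t. \<phi> ((c + k *\<^sub>R x) + t *\<^sub>R e)) has_real_derivative \<phi>' (c + k *\<^sub>R x)) (at (k * 0))"
    using C by (auto simp: C1_along_def)
  then have "((\<lambda>t. \<phi> ((c + k *\<^sub>R x) + (k * t) *\<^sub>R e)) has_real_derivative \<phi>' (c + k *\<^sub>R x) * k) (at 0)"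
    by (rule DERIV_chain2) (auto intro!: derivative_eq_intros)
  then show "((\<lambda>t. \<phi> (c + k *\<^sub>R (x + t *\<^sub>R e))) has_real_derivative k * \<phi>' (c + k *\<^sub>R x)) (at 0)"
    by (simp add: algebra_simps)
qed

text \<open>Translation invariance makes the integral of every difference quotient vanish.\<close>

lemma integral_directional_derivative_eq_0:
  fixes h h' :: "'a::euclidean_space \<Rightarrow> 'b::euclidean_space"
  assumes h: "integrable lborel h" and h' [measurable]: "h' \<in> borel_measurable borel"
    and S: "bounded S" "\<And>x. x \<notin> S \<Longrightarrow> h x = 0"
    and lip: "\<And>x t. norm (h (x + t *\<^sub>R e) - h x) \<le> L * \<bar>t\<bar>"
    and der: "AE x in lborel. ((\<lambda>t. h (x + t *\<^sub>R e)) has_vector_derivative h' x) (at 0)"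
  shows "integrable lborel h'" and "(\<integral>x. h' x \<partial>lborel) = 0"
proof -
  have [measurable]: "h \<in> borel_measurable borel" using h by auto
  obtain R where R: "\<And>x. x \<in> S \<Longrightarrow> norm x \<le> R" using S(1) by (auto simp: bounded_iff)
  define s where "s k x = real (Suc k) *\<^sub>R (h (x + (1 / real (Suc k)) *\<^sub>R e) - h x)" for k x
  \<comment> \<open>Dominating function: \<open>h\<close> and its translates by at most
    \<open>norm e\<close> vanish outside this ball, and the Lipschitz hypothesis bounds every
    difference quotient by \<open>L\<close>.\<close>
  define w where "w x = indicator (cball 0 (R + norm e)) x * L" for x :: 'a
  have L0: "L \<ge> 0" using order_trans[OF norm_ge_zero lip[of 0 1]] by simp
  have w: "integrable lborel w" unfolding w_def
    by (intro integrable_mult_left integrable_real_indicator) (auto simp: emeasure_bounded_finite[unfolded infinity_ennreal_def])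
  have s_meas [measurable]: "s k \<in> borel_measurable borel" for k unfolding s_def by measurable
  have lim: "AE x in lborel. (\<lambda>k. s k x) \<longlonglongrightarrow> h' x"
    using der
  proof eventually_elim
    case (elim x)
    then have "((\<lambda>t. (1 / t) *\<^sub>R (h (x + t *\<^sub>R e) - h x)) \<longlongrightarrow> h' x) (at 0)"
    proof -
      have "((\<lambda>t. norm (h (x + t *\<^sub>R e) - h x - t *\<^sub>R h' x) / norm t) \<longlongrightarrow> 0) (at 0)"
        using elim by (simp add: has_vector_derivative_def has_derivative_iff_norm)
      then have "((\<lambda>t. norm ((1 / t) *\<^sub>R (h (x + t *\<^sub>R e) - h x) - h' x)) \<longlongrightarrow> 0) (at 0)"
      proof (rule Lim_transform_eventually)
        have "norm (a - t *\<^sub>R d) / norm t = norm ((1 / t) *\<^sub>R a - d)" if "t \<noteq> 0" for t and a d :: 'b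
        proof -
          have "(1 / t) *\<^sub>R a - d = (1 / t) *\<^sub>R (a - t *\<^sub>R d)" using that by (simp add: algebra_simps)
          then show ?thesis by (simp add: divide_inverse)
        qed
        then show "\<forall>\<^sub>F t in at 0. norm (h (x + t *\<^sub>R e) - h x - t *\<^sub>R h' x) / norm t
            = norm ((1 / t) *\<^sub>R (h (x + t *\<^sub>R e) - h x) - h' x)"
          unfolding eventually_at by (intro exI[of _ 1]) auto
      qed
      then show ?thesis using tendsto_norm_zero_iff LIM_zero_cancel by blast
    qed
    then have "(\<lambda>k. (1 / (1 / real (Suc k))) *\<^sub>R (h (x + (1 / real (Suc k)) *\<^sub>R e) - h x)) \<longlonglongrightarrow> h' x"
    proof (rule filterlim_compose)
      show "filterlim (\<lambda>k. 1 / real (Suc k)) (at 0) sequentially"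
        using LIMSEQ_Suc[OF lim_1_over_n] by (auto simp: filterlim_at simp del: of_nat_Suc)
    qed
    then show ?case by (simp add: s_def)
  qed
  have bound: "AE x in lborel. norm (s k x) \<le> w x" for k
  proof (intro AE_I2)
    fix x
    show "norm (s k x) \<le> w x"
    proof (cases "norm x \<le> R + norm e")
      case True
      have "norm (s k x) \<le> real (Suc k) * (L * \<bar>1 / real (Suc k)\<bar>)"
        unfolding s_def norm_scaleR abs_of_nat by (intro mult_left_mono lip) simp
      then show ?thesis using True by (simp add: w_def field_simps del: of_nat_Suc)
    next
      case False
      have "norm ((1 / real (Suc k)) *\<^sub>R e) \<le> norm e"
        by (simp add: divide_le_eq mult_le_cancel_left1)
      then have "norm (x + (1 / real (Suc k)) *\<^sub>R e) > R"
        using False norm_triangle_ineq2[of x "- ((1 / real (Suc k)) *\<^sub>R e)"] by simp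
      then have "x + (1 / real (Suc k)) *\<^sub>R e \<notin> S" using R by force
      moreover have "x \<notin> S" using R[of x] False norm_ge_zero[of e] by linarith
      ultimately show ?thesis using S L0 by (simp add: s_def w_def)
    qed
  qed
  have s_int: "(\<integral>x. s k x \<partial>lborel) = 0" for k
  proof -
    have "h (x + (1 / real (Suc k)) *\<^sub>R e) = h (zoom (- ((1 / real (Suc k)) *\<^sub>R e)) 1 x)" for x
      by (simp add: zoom_def)
    then show ?thesis unfolding s_def
      using h integrable_zoom[OF zero_less_one h] integral_zoom[OF zero_less_one h] by simp
  qed
  show "integrable lborel h'"
    by (rule integrable_dominated_convergence[OF _ _ w lim bound]) auto
  have "(\<lambda>k. \<integral>x. s k x \<partial>lborel) \<longlonglongrightarrow> (\<integral>x. h' x \<partial>lborel)"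
    by (rule integral_dominated_convergence[OF _ _ w lim bound]) auto
  then show "(\<integral>x. h' x \<partial>lborel) = 0" by (simp add: s_int LIMSEQ_const_iff)
qed

lemma integrable_bounded_support:
  fixes f :: "'a::euclidean_space \<Rightarrow> 'b::{banach, second_countable_topology}"
  assumes [measurable]: "f \<in> borel_measurable borel" and S: "bounded S" "\<And>x. x \<notin> S \<Longrightarrow> f x = 0"
    and B: "\<And>x. norm (f x) \<le> B"
  shows "integrable lborel f"
proof -
  obtain R where R: "S \<subseteq> cball 0 R" using S(1) by (metis bounded_iff mem_cball_0 subsetI)
  have "integrable lborel (\<lambda>x::'a. indicator (cball 0 R) x * B)"
    by (intro integrable_mult_left integrable_real_indicator) (auto simp: emeasure_bounded_finite[unfolded infinity_ennreal_def])
  then show ?thesis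
  proof (rule Bochner_Integration.integrable_bound)
    show "AE x in lborel. norm (f x) \<le> norm (indicat_real (cball 0 R) x * B)"
    proof (intro AE_I2)
      fix x show "norm (f x) \<le> norm (indicat_real (cball 0 R) x * B)"
        using B[of x] S(2)[of x] R by (cases "x \<in> S") auto
    qed
  qed simp
qed

lemma bounded_linear_matrix_vector_left:
  "bounded_linear (\<lambda>M::real^'n::finite^'m::finite. M *v e)"
  unfolding linear_conv_bounded_linear[symmetric]
  by (intro linearI) (simp_all add: matrix_vector_mult_add_rdistrib scaleR_matrix_vector_assoc)

text \<open>The product of \<open>\<phi>\<close> and \<open>g\<close> is Lipschitz along
  \<open>e\<close>, so its derivative has integral zero. The support hypotheses concern the products
  because the support comes once from \<open>g\<close> (the correction \<open>u\<close>) and once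
  from \<open>\<phi>\<close> (when \<open>g\<close> is the radial map on the whole space).\<close>

lemma integration_by_parts_lipschitz:
  fixes g :: "real^'n::finite \<Rightarrow> real^'n" and G :: "real^'n \<Rightarrow> real^'n^'n"
  assumes lip: "\<And>x y. norm (g x - g y) \<le> L * norm (x - y)"
    and bd: "\<And>x. norm (g x) \<le> B"
    and [measurable]: "g \<in> borel_measurable borel" "G \<in> borel_measurable borel"
    and der: "AE x in lborel. ((\<lambda>t. g (x + t *\<^sub>R e)) has_vector_derivative (G x *v e)) (at 0)"
    and C: "C1_along e \<phi> \<phi>'"
    and S: "bounded S" "\<And>x. x \<notin> S \<Longrightarrow> \<phi> x *\<^sub>R g x = 0" "\<And>x. x \<notin> S \<Longrightarrow> \<phi>' x *\<^sub>R g x = 0"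
  shows "(\<integral>x. \<phi>' x *\<^sub>R g x \<partial>lborel) = - (\<integral>x. \<phi> x *\<^sub>R (G x *v e) \<partial>lborel)"
proof -
  note [measurable] = C1_along_measurable[OF C]
  have Ge [measurable]: "(\<lambda>x. G x *v e) \<in> borel_measurable borel"
    by (intro borel_measurable_continuous_on[where f="\<lambda>M. M *v e"] linear_continuous_on
        bounded_linear_matrix_vector_left) auto
  obtain D where D: "0 \<le> D" "\<And>x. \<bar>\<phi> x\<bar> \<le> D" "\<And>x. \<bar>\<phi>' x\<bar> \<le> D"
    using C1_along_bounds[OF C] by blast
  have B0: "0 \<le> B" using bd[of 0] norm_ge_zero order_trans by blast
  have i1: "integrable lborel (\<lambda>x. \<phi> x *\<^sub>R g x)"
    using D bd B0 by (intro integrable_bounded_support[OF _ S(1,2), where B="D * B"]) (auto intro!: mult_mono)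
  have i2: "integrable lborel (\<lambda>x. \<phi>' x *\<^sub>R g x)"
    using D bd B0 by (intro integrable_bounded_support[OF _ S(1,3), where B="D * B"]) (auto intro!: mult_mono)
  have L0: "0 \<le> L * norm e" using lip[of e 0] norm_ge_zero order_trans by (metis diff_zero)
  have l: "norm (\<phi> (x + t *\<^sub>R e) *\<^sub>R g (x + t *\<^sub>R e) - \<phi> x *\<^sub>R g x) \<le> (D * (L * norm e) + D * B) * \<bar>t\<bar>" for x t
  proof -
    have "\<phi> (x + t *\<^sub>R e) *\<^sub>R g (x + t *\<^sub>R e) - \<phi> x *\<^sub>R g x
        = \<phi> (x + t *\<^sub>R e) *\<^sub>R (g (x + t *\<^sub>R e) - g x) + (\<phi> (x + t *\<^sub>R e) - \<phi> x) *\<^sub>R g x"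
      by (simp add: algebra_simps)
    also have "norm \<dots> \<le> \<bar>\<phi> (x + t *\<^sub>R e)\<bar> * norm (g (x + t *\<^sub>R e) - g x) + \<bar>\<phi> (x + t *\<^sub>R e) - \<phi> x\<bar> * norm (g x)"
      by (metis norm_triangle_ineq norm_scaleR)
    also have "\<dots> \<le> D * (L * norm e * \<bar>t\<bar>) + (D * \<bar>t\<bar>) * B"
      using lip[of "x + t *\<^sub>R e" x] D bd[of x] C1_along_lipschitz[OF C D(3), of x t]
      by (intro add_mono mult_mono) (auto simp: mult_ac)
    finally show ?thesis by (simp add: algebra_simps)
  qed
  have d: "AE x in lborel. ((\<lambda>t. \<phi> (x + t *\<^sub>R e) *\<^sub>R g (x + t *\<^sub>R e)) has_vector_derivative
      (\<phi> x *\<^sub>R (G x *v e) + \<phi>' x *\<^sub>R g x)) (at 0)"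
    using der
  proof eventually_elim
    case (elim x)
    have "((\<lambda>t. \<phi> (x + t *\<^sub>R e)) has_real_derivative \<phi>' x) (at 0)"
      using C by (auto simp: C1_along_def)
    from has_vector_derivative_scaleR[OF this elim] show ?case by simp
  qed
  note * = integral_directional_derivative_eq_0[OF i1 _ S(1,2) l d]
  have i3: "integrable lborel (\<lambda>x. \<phi> x *\<^sub>R (G x *v e) + \<phi>' x *\<^sub>R g x)"
    by (rule *(1)) auto
  then have i4: "integrable lborel (\<lambda>x. \<phi> x *\<^sub>R (G x *v e))"
    using Bochner_Integration.integrable_diff[OF i3 i2] by simp
  have "(\<integral>x. \<phi> x *\<^sub>R (G x *v e) + \<phi>' x *\<^sub>R g x \<partial>lborel) = 0"
    by (rule *(2)) auto
  then show ?thesis using i2 i4 by (simp add: add_eq_0_iff)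
qed

text \<open>A global weak gradient: integrability of the pair takes over the task of compactly
  supported test functions. This makes the class closed under rescaling and under L^1-convergent
  sums.\<close>

definition wgrad :: "(real^'n::finite \<Rightarrow> real^'n) \<Rightarrow> (real^'n \<Rightarrow> real^'n^'n) \<Rightarrow> bool" where
  "wgrad u Y \<longleftrightarrow> integrable lborel u \<and> integrable lborel Y \<and>
     (\<forall>e \<phi> \<phi>'. C1_along e \<phi> \<phi>' \<longrightarrow>
        (\<integral>x. \<phi>' x *\<^sub>R u x \<partial>lborel) = - (\<integral>x. \<phi> x *\<^sub>R (Y x *v e) \<partial>lborel))"

lemma integrable_scaleR_bounded:
  fixes u :: "'a::euclidean_space \<Rightarrow> 'b::{banach, second_countable_topology}"
  assumes [measurable]: "\<phi> \<in> borel_measurable borel" and B: "\<And>x. \<bar>\<phi> x\<bar> \<le> B" and u: "integrable lborel u"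
  shows "integrable lborel (\<lambda>x. \<phi> x *\<^sub>R u x)"
proof (rule Bochner_Integration.integrable_bound)
  show "integrable lborel (\<lambda>x. B *\<^sub>R norm (u x))" using u by simp
  have [measurable]: "u \<in> borel_measurable borel" using u by auto
  show "(\<lambda>x. \<phi> x *\<^sub>R u x) \<in> borel_measurable lborel" by simp
  show "AE x in lborel. norm (\<phi> x *\<^sub>R u x) \<le> norm (B *\<^sub>R norm (u x))"
    using B by (auto simp: abs_mult intro!: AE_I2 mult_right_mono) (meson abs_ge_self order_trans)
qed

lemma integrable_matrix_vector:
  fixes Y :: "'a::euclidean_space \<Rightarrow> real^'n::finite^'m::finite"
  assumes "integrable lborel Y"
  shows "integrable lborel (\<lambda>x. Y x *v e)"
  using bounded_linear_matrix_vector_left assms by (rule integrable_bounded_linear)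

text \<open>The rescaling is moved onto the test function; its chain-rule factor \<open>k\<close>
  accounts for the weight \<open>b / k\<close> of the gradient.\<close>

lemma wgrad_zoom:
  fixes u :: "real^'n::finite \<Rightarrow> real^'n"
  assumes u: "wgrad u Y" and k: "k > 0"
  shows "wgrad (\<lambda>x. b *\<^sub>R u (zoom c k x)) (\<lambda>x. (b / k) *\<^sub>R Y (zoom c k x))"
  unfolding wgrad_def
proof (intro conjI allI impI)
  have iu: "integrable lborel u" and iY: "integrable lborel Y" using u by (auto simp: wgrad_def)
  show "integrable lborel (\<lambda>x. b *\<^sub>R u (zoom c k x))" "integrable lborel (\<lambda>x. (b / k) *\<^sub>R Y (zoom c k x))"
    using iu iY k by (auto intro!: integrable_zoom)
  fix e :: "real^'n" and \<phi> \<phi>' assume C: "C1_along e \<phi> \<phi>'"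
  let ?f = "\<lambda>y. \<phi> (c + k *\<^sub>R y)" and ?f' = "\<lambda>y. k * \<phi>' (c + k *\<^sub>R y)"
  have C': "C1_along e ?f ?f'" by (rule C1_along_affine[OF C])
  obtain B where B: "0 \<le> B" "\<And>x. \<bar>?f x\<bar> \<le> B" "\<And>x. \<bar>?f' x\<bar> \<le> B"
    using C1_along_bounds[OF C'] by blast
  note m = C1_along_measurable[OF C']
  have i1: "integrable lborel (\<lambda>y. ?f' y *\<^sub>R u y)" by (rule integrable_scaleR_bounded[OF m(2) B(3) iu])
  have i2: "integrable lborel (\<lambda>y. ?f y *\<^sub>R (Y y *v e))"
    by (rule integrable_scaleR_bounded[OF m(1) B(2) integrable_matrix_vector[OF iY]])
  have "(\<integral>x. \<phi>' x *\<^sub>R (b *\<^sub>R u (zoom c k x)) \<partial>lborel)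
      = (b / k) *\<^sub>R (\<integral>x. (\<lambda>y. ?f' y *\<^sub>R u y) (zoom c k x) \<partial>lborel)"
    using k by (simp add: mult.commute flip: integral_scaleR_right)
  also have "\<dots> = (b / k * k ^ CARD('n)) *\<^sub>R (\<integral>y. ?f' y *\<^sub>R u y \<partial>lborel)"
    by (subst integral_zoom[OF k i1]) simp
  also have "\<dots> = - ((b / k * k ^ CARD('n)) *\<^sub>R (\<integral>y. ?f y *\<^sub>R (Y y *v e) \<partial>lborel))"
    using u C' by (simp add: wgrad_def)
  also have "\<dots> = - ((b / k) *\<^sub>R (\<integral>x. (\<lambda>y. ?f y *\<^sub>R (Y y *v e)) (zoom c k x) \<partial>lborel))"
    by (subst integral_zoom[OF k i2]) simp
  also have "\<dots> = - (\<integral>x. \<phi> x *\<^sub>R (((b / k) *\<^sub>R Y (zoom c k x)) *v e) \<partial>lborel)"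
    using k by (simp add: mult.commute scaleR_matrix_vector_assoc[symmetric] flip: integral_scaleR_right)
  finally show "(\<integral>x. \<phi>' x *\<^sub>R (b *\<^sub>R u (zoom c k x)) \<partial>lborel)
      = - (\<integral>x. \<phi> x *\<^sub>R (((b / k) *\<^sub>R Y (zoom c k x)) *v e) \<partial>lborel)" .
qed

text \<open>Test functions and their derivatives are bounded, so L^1 summability of both series
  justifies exchanging sum and integral on either side.\<close>

lemma wgrad_suminf:
  fixes u :: "nat \<Rightarrow> real^'n::finite \<Rightarrow> real^'n"
  assumes w: "\<And>i. wgrad (u i) (Y i)"
    and su: "summable (\<lambda>i. \<integral>x. norm (u i x) \<partial>lborel)" and sY: "summable (\<lambda>i. \<integral>x. norm (Y i x) \<partial>lborel)"
  shows "wgrad (\<lambda>x. \<Sum>i. u i x) (\<lambda>x. \<Sum>i. Y i x)"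
  unfolding wgrad_def
proof (intro conjI allI impI)
  have iu: "\<And>i. integrable lborel (u i)" and iY: "\<And>i. integrable lborel (Y i)" using w by (auto simp: wgrad_def)
  note au = AE_summable_norm[OF iu su] and aY = AE_summable_norm[OF iY sY]
  show "integrable lborel (\<lambda>x. \<Sum>i. u i x)" by (rule integrable_suminf[OF iu au su])
  show "integrable lborel (\<lambda>x. \<Sum>i. Y i x)" by (rule integrable_suminf[OF iY aY sY])
  have mu [measurable]: "\<And>i. u i \<in> borel_measurable borel" and mY [measurable]: "\<And>i. Y i \<in> borel_measurable borel"
    using iu iY by auto
  fix e :: "real^'n" and \<phi> \<phi>' assume C: "C1_along e \<phi> \<phi>'"
  obtain B where B: "0 \<le> B" "\<And>x. \<bar>\<phi> x\<bar> \<le> B" "\<And>x. \<bar>\<phi>' x\<bar> \<le> B"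
    using C1_along_bounds[OF C] by blast
  note m [measurable] = C1_along_measurable[OF C]
  have gen: "(\<integral>x. f x *\<^sub>R (\<Sum>i. z i x) \<partial>lborel) = (\<Sum>i. \<integral>x. f x *\<^sub>R z i x \<partial>lborel)"
    if [measurable]: "f \<in> borel_measurable borel" and fB: "\<And>x. \<bar>f x\<bar> \<le> B" and iz: "\<And>i. integrable lborel (z i)"
      and sz: "summable (\<lambda>i. \<integral>x. norm (z i x) \<partial>lborel)"
    for f and z :: "nat \<Rightarrow> real^'n \<Rightarrow> real^'n"
  proof -
    note az = AE_summable_norm[OF iz sz]
    have mz [measurable]: "\<And>i. z i \<in> borel_measurable borel" using iz by auto
    have "(\<integral>x. f x *\<^sub>R (\<Sum>i. z i x) \<partial>lborel) = (\<integral>x. (\<Sum>i. f x *\<^sub>R z i x) \<partial>lborel)"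
    proof (rule integral_cong_AE)
      show "AE x in lborel. f x *\<^sub>R (\<Sum>i. z i x) = (\<Sum>i. f x *\<^sub>R z i x)"
        using az by eventually_elim (auto dest!: summable_norm_cancel intro: suminf_scaleR_right)
    qed auto
    also have "\<dots> = (\<Sum>i. \<integral>x. f x *\<^sub>R z i x \<partial>lborel)"
    proof (rule integral_suminf)
      show i: "integrable lborel (\<lambda>x. f x *\<^sub>R z i x)" for i by (rule integrable_scaleR_bounded[OF _ fB iz]) simp
      show "AE x in lborel. summable (\<lambda>i. norm (f x *\<^sub>R z i x))"
        using az by eventually_elim (auto intro: summable_mult)
      show "summable (\<lambda>i. \<integral>x. norm (f x *\<^sub>R z i x) \<partial>lborel)"
      proof (rule summable_comparison_test')
        show "summable (\<lambda>i. B * (\<integral>x. norm (z i x) \<partial>lborel))" using sz by (rule summable_mult)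
        fix i
        have "(\<integral>x. norm (f x *\<^sub>R z i x) \<partial>lborel) \<le> (\<integral>x. B * norm (z i x) \<partial>lborel)"
          using i[of i] iz[of i] fB by (intro integral_mono) (auto intro!: mult_right_mono integrable_norm[where f="\<lambda>x. f x *\<^sub>R z i x", simplified])
        then show "norm (\<integral>x. norm (f x *\<^sub>R z i x) \<partial>lborel) \<le> B * (\<integral>x. norm (z i x) \<partial>lborel)" by simp
      qed
    qed
    finally show ?thesis .
  qed
  have sYe: "summable (\<lambda>i. \<integral>x. norm (Y i x *v e) \<partial>lborel)"
  proof -
    obtain K where K: "\<And>M::real^'n^'n. norm (M *v e) \<le> norm M * K"
      using bounded_linear.bounded[OF bounded_linear_matrix_vector_left[where e=e]] by blast
    show ?thesis
    proof (rule summable_comparison_test')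
      show "summable (\<lambda>i. (\<integral>x. norm (Y i x) \<partial>lborel) * K)" using sY by (rule summable_mult2)
      fix i
      have "(\<integral>x. norm (Y i x *v e) \<partial>lborel) \<le> (\<integral>x. norm (Y i x) * K \<partial>lborel)"
        using iY[of i] K by (intro integral_mono) (auto intro!: integrable_norm integrable_matrix_vector)
      then show "norm (\<integral>x. norm (Y i x *v e) \<partial>lborel) \<le> (\<integral>x. norm (Y i x) \<partial>lborel) * K" by simp
    qed
  qed
  have "(\<integral>x. \<phi>' x *\<^sub>R (\<Sum>i. u i x) \<partial>lborel) = (\<Sum>i. \<integral>x. \<phi>' x *\<^sub>R u i x \<partial>lborel)"
    by (rule gen[OF m(2) B(3) iu su])
  also have "\<dots> = (\<Sum>i. - (\<integral>x. \<phi> x *\<^sub>R (Y i x *v e) \<partial>lborel))"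
    using w C by (simp add: wgrad_def)
  also have "\<dots> = (\<Sum>i. \<integral>x. (- \<phi> x) *\<^sub>R (Y i x *v e) \<partial>lborel)" by simp
  also have "\<dots> = (\<integral>x. (- \<phi> x) *\<^sub>R (\<Sum>i. Y i x *v e) \<partial>lborel)"
    using B(2) by (intro gen[symmetric] integrable_matrix_vector iY sYe) auto
  also have "\<dots> = - (\<integral>x. \<phi> x *\<^sub>R (\<Sum>i. Y i x *v e) \<partial>lborel)" by simp
  also have "(\<integral>x. \<phi> x *\<^sub>R (\<Sum>i. Y i x *v e) \<partial>lborel) = (\<integral>x. \<phi> x *\<^sub>R ((\<Sum>i. Y i x) *v e) \<partial>lborel)"
  proof (rule integral_cong_AE)
    have [measurable]: "(\<lambda>x. M x *v e) \<in> borel_measurable borel" if [measurable]: "M \<in> borel_measurable borel" for M :: "real^'n \<Rightarrow> real^'n^'n"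
      by (intro borel_measurable_continuous_on[where f="\<lambda>M. M *v e"] linear_continuous_on
        bounded_linear_matrix_vector_left that)
    show "(\<lambda>x. \<phi> x *\<^sub>R (\<Sum>i. Y i x *v e)) \<in> borel_measurable lborel"
      "(\<lambda>x. \<phi> x *\<^sub>R ((\<Sum>i. Y i x) *v e)) \<in> borel_measurable lborel" by measurable
    show "AE x in lborel. \<phi> x *\<^sub>R (\<Sum>i. Y i x *v e) = \<phi> x *\<^sub>R ((\<Sum>i. Y i x) *v e)"
      using aY by eventually_elim
        (auto dest!: summable_norm_cancel simp: bounded_linear.suminf[OF bounded_linear_matrix_vector_left])
  qed
  finally show "(\<integral>x. \<phi>' x *\<^sub>R (\<Sum>i. u i x) \<partial>lborel) = - (\<integral>x. \<phi> x *\<^sub>R ((\<Sum>i. Y i x) *v e) \<partial>lborel)" .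
qed

section \<open>The radial map\<close>

definition outer :: "real^'n::finite \<Rightarrow> real^'n^'n" where
  "outer w = (\<chi> i j. w $ i * w $ j)"

lemma outer_mult_vec: "outer w *v x = (w \<bullet> x) *\<^sub>R w"
proof -
  have "(outer w *v x) $ i = ((w \<bullet> x) *\<^sub>R w) $ i" for i
    by (simp add: outer_def matrix_vector_mult_def inner_vec_def sum_distrib_left mult_ac)
  then show ?thesis by (simp add: vec_eq_iff)
qed

text \<open>A positive multiple of the map that is \<open>- a\<close> along the unit vector
  \<open>w\<close> and the identity on its orthogonal complement. Tracking this shape, which
  survives positive scaling, yields both the sign of the determinant and the distortion at the
  end.\<close>

definition qr_matrix :: "real \<Rightarrow> real^'n::finite^'n \<Rightarrow> bool" where
  "qr_matrix a M \<longleftrightarrow> (\<exists>t w. t > 0 \<and> norm w = 1 \<and> M = t *\<^sub>R (mat 1 - (1 + a) *\<^sub>R outer w))"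

lemma qr_matrix_scaleR: 
  assumes "qr_matrix a M" "s > 0" shows "qr_matrix a (s *\<^sub>R M)"
proof -
  obtain t w where t: "t > 0" "norm w = 1" "M = t *\<^sub>R (mat 1 - (1 + a) *\<^sub>R outer w)"
    using assms(1) by (auto simp: qr_matrix_def)
  have "s * t > 0" "s *\<^sub>R M = (s * t) *\<^sub>R (mat 1 - (1 + a) *\<^sub>R outer w)"
    using t assms(2) by auto
  then show ?thesis using t(2) unfolding qr_matrix_def by blast
qed

lemma mult_vec_rank_one_update:
  "(t *\<^sub>R (mat 1 - (1 + a) *\<^sub>R outer w)) *v x = t *\<^sub>R (x - ((1 + a) * (w \<bullet> x)) *\<^sub>R w)"
  by (simp add: scaleR_matrix_vector_assoc[symmetric] matrix_vector_mult_diff_rdistrib outer_mult_vec)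

text \<open>Conjugation by an orthogonal matrix taking a basis vector to \<open>w\<close> makes
  \<open>M\<close> diagonal, with one entry \<open>- a * t\<close> and all others \<open>t\<close>;
  the conjugation contributes \<open>det A\<close> squared.\<close>

lemma det_qr_matrix:
  fixes M :: "real^'n::finite^'n"
  assumes "qr_matrix a M" "a > 0"
  shows "det M \<le> 0"
proof -
  obtain t w where t: "t > 0" and w: "norm w = 1" and M: "M = t *\<^sub>R (mat 1 - (1 + a) *\<^sub>R outer w)"
    using assms by (auto simp: qr_matrix_def)
  obtain k :: 'n and A where A: "orthogonal_matrix A" "A *v axis k 1 = w"
    using orthogonal_matrix_exists_basis[OF w] by blast
  define D :: "real^'n^'n" where "D = t *\<^sub>R (mat 1 - (1 + a) *\<^sub>R outer (axis k 1))"
  have AAT: "A ** transpose A = mat 1" using A by (simp add: orthogonal_matrix_def)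
  have "M = A ** D ** transpose A"
    unfolding matrix_eq
  proof
    fix x
    have "(A ** D ** transpose A) *v x = A *v (D *v (transpose A *v x))"
      by (simp only: matrix_vector_mul_assoc matrix_mul_assoc)
    also have "\<dots> = A *v (t *\<^sub>R ((transpose A *v x) - ((1 + a) * (axis k 1 \<bullet> (transpose A *v x))) *\<^sub>R axis k 1))"
      unfolding D_def mult_vec_rank_one_update ..
    also have "axis k 1 \<bullet> (transpose A *v x) = (A *v axis k 1) \<bullet> x"
      by (metis dot_lmul_matrix inner_commute transpose_matrix_vector)
    also have "A *v (t *\<^sub>R ((transpose A *v x) - ((1 + a) * ((A *v axis k 1) \<bullet> x)) *\<^sub>R axis k 1))
        = t *\<^sub>R ((A ** transpose A) *v x - ((1 + a) * (w \<bullet> x)) *\<^sub>R w)"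
      by (simp add: matrix_vector_mult_scaleR matrix_vector_mult_diff_distrib matrix_vector_mul_assoc A(2)
          del: transpose_matrix_vector)
    also have "\<dots> = M *v x" unfolding AAT M mult_vec_rank_one_update by simp
    finally show "M *v x = (A ** D ** transpose A) *v x" by simp
  qed
  then have "det M = det A * det A * det D" by (simp add: det_mul)
  moreover have "det D \<le> 0"
  proof -
    have "det D = prod (\<lambda>i. D $ i $ i) UNIV"
      by (rule det_diagonal) (auto simp: D_def outer_def mat_def axis_def)
    also have "\<dots> = D $ k $ k * prod (\<lambda>i. D $ i $ i) (UNIV - {k})"
      by (rule prod.remove) auto
    also have "D $ k $ k = - a * t" by (simp add: D_def outer_def mat_def axis_def)
    also have "prod (\<lambda>i. D $ i $ i) (UNIV - {k}) = prod (\<lambda>i. t) (UNIV - {k})"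
      by (intro prod.cong) (auto simp: D_def outer_def mat_def axis_def)
    finally show ?thesis using t assms(2) by (simp add: mult_nonpos_nonneg)
  qed
  ultimately show ?thesis by (simp add: mult_nonneg_nonpos)
qed

text \<open>On unit vectors, the square of \<open>norm (M *v x) / t\<close> is a convex combination
  of 1 and \<open>a\<^sup>2\<close>, with weight \<open>(w \<bullet> x)\<^sup>2\<close> on the
  latter. The bounds on \<open>K\<close> give \<open>max 1 a \<le> K * min 1 a\<close>.\<close>

lemma distortion_qr_matrix:
  fixes M :: "real^'n::finite^'n"
  assumes "qr_matrix a M" and a: "a > 0" and K: "a \<le> K" "1 \<le> K" "1 \<le> K * a"
  shows "(SUP \<xi>\<in>sphere 0 1. norm (M *v \<xi>)) \<le> K * (INF \<xi>\<in>sphere 0 1. norm (M *v \<xi>))"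
proof -
  obtain t w where t: "t > 0" and w: "norm w = 1" and M: "M = t *\<^sub>R (mat 1 - (1 + a) *\<^sub>R outer w)"
    using assms by (auto simp: qr_matrix_def)
  have nonempty: "sphere (0::real^'n) 1 \<noteq> {}"
    by simp
  have b: "t * min 1 a \<le> norm (M *v x) \<and> norm (M *v x) \<le> t * max 1 a" if "norm x = 1" for x
  proof -
    define z where "z = (w \<bullet> x)\<^sup>2"
    have z: "0 \<le> z" "z \<le> 1"
      using Cauchy_Schwarz_ineq[of w x] w that by (auto simp: z_def dot_square_norm)
    have "(norm (M *v x))\<^sup>2 = t\<^sup>2 * (norm (x - ((1 + a) * (w \<bullet> x)) *\<^sub>R w))\<^sup>2"
      unfolding M mult_vec_rank_one_update by (simp add: power_mult_distrib)
    also have "(norm (x - ((1 + a) * (w \<bullet> x)) *\<^sub>R w))\<^sup>2 = 1 + (a\<^sup>2 - 1) * z"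
    proof -
      have "x \<bullet> x = 1" "w \<bullet> w = 1" using that w by (auto simp: dot_square_norm)
      then show ?thesis
        unfolding power2_norm_eq_inner z_def unfolding power2_eq_square inner_simps
        by (simp add: inner_commute[of x w]) (simp add: algebra_simps)
    qed
    finally have sq: "(norm (M *v x))\<^sup>2 = t\<^sup>2 * (1 + (a\<^sup>2 - 1) * z)" .
    have cvx: "1 + (a\<^sup>2 - 1) * z = (1 - z) * 1 + z * a\<^sup>2" by (simp add: algebra_simps)
    have "(min 1 a)\<^sup>2 \<le> 1" "(min 1 a)\<^sup>2 \<le> a\<^sup>2" "1 \<le> (max 1 a)\<^sup>2" "a\<^sup>2 \<le> (max 1 a)\<^sup>2"
      using a by (auto intro!: power_mono power_le_one one_le_power)
    then have "(1 - z) * (min 1 a)\<^sup>2 + z * (min 1 a)\<^sup>2 \<le> 1 + (a\<^sup>2 - 1) * z"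
      "1 + (a\<^sup>2 - 1) * z \<le> (1 - z) * (max 1 a)\<^sup>2 + z * (max 1 a)\<^sup>2"
      unfolding cvx using z by (intro add_mono mult_left_mono; simp)+
    then have *: "(min 1 a)\<^sup>2 \<le> 1 + (a\<^sup>2 - 1) * z" "1 + (a\<^sup>2 - 1) * z \<le> (max 1 a)\<^sup>2"
      by (auto simp: algebra_simps)
    show ?thesis
    proof
      show "t * min 1 a \<le> norm (M *v x)"
        by (rule power2_le_imp_le) (use * t in \<open>auto simp: sq power_mult_distrib\<close>)
      show "norm (M *v x) \<le> t * max 1 a"
        by (rule power2_le_imp_le) (use * t a in \<open>auto simp: sq power_mult_distrib\<close>)
    qed
  qed
  have "(SUP \<xi>\<in>sphere 0 1. norm (M *v \<xi>)) \<le> t * max 1 a"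
    using b by (intro cSUP_least nonempty) auto
  also have "\<dots> \<le> t * (K * min 1 a)"
    using K a t by (intro mult_left_mono) (auto simp: min_def max_def)
  also have "\<dots> = K * (t * min 1 a)" by simp
  also have "\<dots> \<le> K * (INF \<xi>\<in>sphere 0 1. norm (M *v \<xi>))"
    using b K by (intro mult_left_mono cINF_greatest nonempty) auto
  finally show ?thesis .
qed

text \<open>The factor \<open>max 1 (norm y)\<close> glues the identity on the unit ball to the
  radial map outside; for \<open>a = 1\<close> the outer part is the inversion in the unit
  sphere.\<close>

definition inversion :: "real \<Rightarrow> real^'n::finite \<Rightarrow> real^'n" where
  "inversion a y = (max 1 (norm y) powr (- 1 - a)) *\<^sub>R y"

text \<open>On the unit sphere, where the two pieces meet with different derivatives in general, the
  outer formula is used; hence \<open>qr_matrix\<close> holds for every \<open>y\<close> with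
  \<open>norm y \<ge> 1\<close>.\<close>

definition inversion_grad :: "real \<Rightarrow> real^'n::finite \<Rightarrow> real^'n^'n" where
  "inversion_grad a y = (if norm y < 1 then mat 1
     else (norm y powr (- 1 - a)) *\<^sub>R (mat 1 - (1 + a) *\<^sub>R outer (sgn y)))"

lemma inversion_eq_self: "norm y \<le> 1 \<Longrightarrow> inversion a y = y"
  by (simp add: inversion_def max_def)

lemma inversion_eq_outside: "norm y \<ge> 1 \<Longrightarrow> inversion a y = (norm y powr (- 1 - a)) *\<^sub>R y"
  by (simp add: inversion_def max_def)

lemma inversion_measurable [measurable]: "inversion a \<in> borel_measurable borel"
  unfolding inversion_def by measurable

lemma borel_measurable_matrix:
  fixes f :: "'a \<Rightarrow> real^'n::finite^'m::finite"
  assumes "\<And>i j. (\<lambda>x. f x $ i $ j) \<in> borel_measurable M"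
  shows "f \<in> borel_measurable M"
proof -
  have "(\<lambda>x. f x \<bullet> b) \<in> borel_measurable M" if "b \<in> Basis" for b
    using assms that by (auto simp: Basis_vec_def inner_axis)
  then show ?thesis unfolding borel_measurable_euclidean_space[of f] by blast
qed

lemma borel_measurable_vec_nth' [measurable (raw)]:
  fixes f :: "'a \<Rightarrow> real^'n::finite"
  assumes "f \<in> borel_measurable M"
  shows "(\<lambda>x. f x $ i) \<in> borel_measurable M"
proof -
  have "f \<in> M \<rightarrow>\<^sub>M borel" using assms . 
  then show ?thesis by (rule borel_measurable_continuous_on[rotated]) (intro continuous_intros)
qed

lemma outer_measurable [measurable]: "outer \<in> borel_measurable borel"
proof (rule borel_measurable_matrix)
  show "(\<lambda>x. outer x $ i $ j) \<in> borel_measurable borel" for i j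
   by (simp add: outer_def)
qed

lemma inversion_grad_measurable [measurable]: "inversion_grad a \<in> borel_measurable borel"
  unfolding inversion_grad_def by measurable

lemma norm_inversion_le:
  assumes "a \<ge> 0"
  shows "norm (inversion a y) \<le> 1"
proof (cases "norm y \<le> 1")
  case False
  then have "norm (inversion a y) = norm y powr (- 1 - a) * norm y powr 1"
    by (simp add: inversion_eq_outside)
  also have "\<dots> = norm y powr (- a)" by (subst powr_add[symmetric]) simp
  also have "\<dots> \<le> 1" using False assms by (simp add: powr_minus inverse_le_1_iff ge_one_powr_ge_zero)
  finally show ?thesis .
qed (simp add: inversion_eq_self)

lemma norm_matrix_le_sum: "norm (M::real^'n::finite^'m::finite) \<le> (\<Sum>i\<in>UNIV. \<Sum>j\<in>UNIV. \<bar>M $ i $ j\<bar>)"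
proof -
  have "norm M \<le> (\<Sum>i\<in>UNIV. norm (M $ i))" unfolding norm_vec_def by (intro L2_set_le_sum) auto
  also have "\<dots> \<le> (\<Sum>i\<in>UNIV. \<Sum>j\<in>UNIV. \<bar>M $ i $ j\<bar>)" by (intro sum_mono norm_le_l1_cart)
  finally show ?thesis .
qed

lemma norm_inversion_grad_le:
  fixes y :: "real^'n::finite"
  assumes "a \<ge> 0"
  shows "norm (inversion_grad a y) \<le> real CARD('n) * real CARD('n) * (2 + a)"
proof -
  have e: "\<bar>inversion_grad a y $ i $ j\<bar> \<le> 2 + a" for i j
  proof (cases "norm y < 1")
    case True
    then show ?thesis using assms by (simp add: inversion_grad_def mat_def)
  next
    case False
    have s: "\<bar>sgn y $ l\<bar> \<le> 1" for l
      using component_le_norm_cart[of "sgn y" l] by (auto simp: norm_sgn split: if_splits)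
    have s2: "\<bar>sgn y $ i * sgn y $ j\<bar> \<le> 1" using s[of i] s[of j] by (simp add: abs_mult mult_le_one)
    have "\<bar>inversion_grad a y $ i $ j\<bar>
        = norm y powr (- 1 - a) * \<bar>(if i = j then 1 else 0) - (1 + a) * (sgn y $ i * sgn y $ j)\<bar>"
      using False by (simp add: inversion_grad_def mat_def outer_def abs_mult)
    also have "\<dots> \<le> 1 * (2 + a)"
    proof (intro mult_mono)
      have "norm y powr (- 1 - a) = inverse (norm y powr (1 + a))"
        by (simp flip: powr_minus)
      then show "norm y powr (- 1 - a) \<le> 1" using False assms by (simp add: inverse_le_1_iff ge_one_powr_ge_zero)
      have "\<bar>(1 + a) * (sgn y $ i * sgn y $ j)\<bar> \<le> (1 + a) * 1"
        unfolding abs_mult[of "1 + a"] using assms s2 by (intro mult_mono) auto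
      moreover have "\<bar>b - c\<bar> \<le> 2 + a" if "b = 0 \<or> b = 1" "\<bar>c\<bar> \<le> (1 + a) * 1" for b c
        using that assms by auto
      ultimately show "\<bar>(if i = j then 1 else 0) - (1 + a) * (sgn y $ i * sgn y $ j)\<bar> \<le> 2 + a"
        by (metis (full_types))
    qed (use assms in auto)
    finally show ?thesis by simp
  qed
  have "norm (inversion_grad a y) \<le> (\<Sum>i\<in>(UNIV::'n set). \<Sum>j\<in>(UNIV::'n set). 2 + a)"
    by (rule order_trans[OF norm_matrix_le_sum]) (intro sum_mono e)
  then show ?thesis by (simp add: mult_ac)
qed

text \<open>Mean value theorem with the factor \<open>x\<close> absorbed: at the intermediate point
  \<open>z > x\<close>, the product of \<open>z powr (- 2 - a)\<close> and \<open>x\<close> is at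
  most \<open>z powr (- 1 - a)\<close>, hence at most 1. This keeps the Lipschitz constant of the
  radial map independent of the size of its argument.\<close>

lemma powr_diff_le:
  fixes x y :: real
  assumes "1 \<le> x" "x \<le> y" "a \<ge> 0"
  shows "(x powr (- 1 - a) - y powr (- 1 - a)) * x \<le> (1 + a) * (y - x)"
proof (cases "x = y")
  case False
  then have xy: "x < y" using assms by simp
  have "\<exists>z>x. z < y \<and> y powr (- 1 - a) - x powr (- 1 - a) = (y - x) * ((- 1 - a) * z powr (- 1 - a - 1))"
    using xy assms by (intro MVT2) (auto intro!: derivative_eq_intros)
  then obtain z where z: "x < z" "z < y"
    "y powr (- 1 - a) - x powr (- 1 - a) = (y - x) * ((- 1 - a) * z powr (- 1 - a - 1))" by auto
  have "z powr (- 1 - a - 1) * x \<le> z powr (- 1 - a - 1) * z powr 1"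
    using z assms by (intro mult_left_mono) auto
  also have "\<dots> = inverse (z powr (1 + a))" by (subst powr_add[symmetric]) (simp flip: powr_minus)
  also have "\<dots> \<le> 1" using z assms by (simp add: inverse_le_1_iff ge_one_powr_ge_zero)
  finally have *: "z powr (- 1 - a - 1) * x \<le> 1" .
  have "(x powr (- 1 - a) - y powr (- 1 - a)) * x = ((1 + a) * (y - x)) * (z powr (- 1 - a - 1) * x)"
  proof -
    have "x powr (- 1 - a) - y powr (- 1 - a) = (1 + a) * (y - x) * z powr (- 1 - a - 1)"
      using z(3) by (simp add: algebra_simps)
    then show ?thesis by (simp only: mult.assoc)
  qed
  also have "\<dots> \<le> ((1 + a) * (y - x)) * 1"
    using * assms by (intro mult_left_mono) auto
  finally show ?thesis by simp
qed simp

text \<open>With \<open>norm x \<le> norm y\<close>, the difference splits into the smaller radial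
  factor times \<open>x - y\<close> (constant 1) and the difference of the radial factors times
  \<open>x\<close> (constant 1 + a).\<close>

lemma inversion_lipschitz:
  assumes a: "a \<ge> 0"
  shows "norm (inversion a x - inversion a y) \<le> (2 + a) * norm (x - y)"
proof -
  have *: "norm (inversion a x - inversion a y) \<le> (2 + a) * norm (x - y)" if "norm x \<le> norm y" for x y :: "real^'n"
  proof -
    define p where "p = max 1 (norm x)"
    define q where "q = max 1 (norm y)"
    have pq: "1 \<le> p" "p \<le> q" "norm x \<le> p" "q - p \<le> norm (x - y)"
      using that norm_triangle_ineq3[of x y] by (auto simp: p_def q_def)
    have q1: "q powr (- 1 - a) \<le> 1"
    proof -
      have "q powr (- 1 - a) = inverse (q powr (1 + a))" by (simp flip: powr_minus)
      then show ?thesis using pq a by (simp add: inverse_le_1_iff ge_one_powr_ge_zero)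
    qed
    have mono: "q powr (- 1 - a) \<le> p powr (- 1 - a)"
      using pq a by (intro powr_mono2') auto
    have "inversion a x - inversion a y = (q powr (- 1 - a)) *\<^sub>R (x - y) + (p powr (- 1 - a) - q powr (- 1 - a)) *\<^sub>R x"
      by (simp add: inversion_def p_def q_def algebra_simps)
    also have "norm \<dots> \<le> q powr (- 1 - a) * norm (x - y) + (p powr (- 1 - a) - q powr (- 1 - a)) * norm x"
      using mono by (intro order_trans[OF norm_triangle_ineq]) simp
    also have "\<dots> \<le> 1 * norm (x - y) + (p powr (- 1 - a) - q powr (- 1 - a)) * p"
      using q1 mono pq by (intro add_mono mult_mono) auto
    also have "\<dots> \<le> 1 * norm (x - y) + (1 + a) * (q - p)"
      using powr_diff_le[OF pq(1,2) a] by simp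
    also have "\<dots> \<le> 1 * norm (x - y) + (1 + a) * norm (x - y)"
      using pq a by (intro add_left_mono mult_left_mono) auto
    finally show ?thesis by (simp add: algebra_simps)
  qed
  show ?thesis using *[of x y] *[of y x] by (cases "norm x \<le> norm y") (auto simp: norm_minus_commute)
qed

lemma inversion_has_derivative:
  fixes y :: "real^'n::finite"
  assumes y: "norm y \<noteq> 1"
  shows "(inversion a has_derivative (\<lambda>h. inversion_grad a y *v h)) (at y)"
proof (cases "norm y < 1")
  case True
  have "((\<lambda>y. y) has_derivative (\<lambda>h. inversion_grad a y *v h)) (at y)"
    using True by (simp add: inversion_grad_def)
  then show ?thesis
    by (rule has_derivative_transform_within_open[where s="ball 0 1"])
       (use True in \<open>auto simp: inversion_eq_self\<close>)
next
  case False
  then have y1: "norm y > 1" using y by simp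
  then have y0: "y \<noteq> 0" by auto
  have sgn: "y = norm y *\<^sub>R sgn y" using y0 by (simp add: sgn_div_norm)
  have "((\<lambda>y. (norm y powr (- 1 - a)) *\<^sub>R y) has_derivative (\<lambda>h. inversion_grad a y *v h)) (at y)"
  proof -
    have n: "(norm has_derivative (\<lambda>h. h \<bullet> sgn y)) (at y)" using y0 by (rule has_derivative_norm)
    have "((\<lambda>r. r powr (- 1 - a)) has_real_derivative (- 1 - a) * norm y powr (- 1 - a - 1)) (at (norm y))"
      using y0 by (auto intro!: derivative_eq_intros)
    then have "((\<lambda>r. r powr (- 1 - a)) has_derivative (\<lambda>h. ((- 1 - a) * norm y powr (- 1 - a - 1)) * h)) (at (norm y))"
      by (simp add: has_field_derivative_def)
    from has_derivative_compose[OF n this]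
    have "((\<lambda>y. norm y powr (- 1 - a)) has_derivative (\<lambda>h. ((- 1 - a) * norm y powr (- 1 - a - 1)) * (h \<bullet> sgn y))) (at y)" .
    from has_derivative_scaleR[OF this has_derivative_ident]
    have "((\<lambda>y. (norm y powr (- 1 - a)) *\<^sub>R y) has_derivative
       (\<lambda>h. (norm y powr (- 1 - a)) *\<^sub>R h + (((- 1 - a) * norm y powr (- 1 - a - 1)) * (h \<bullet> sgn y)) *\<^sub>R y)) (at y)" .
    moreover have "(norm y powr (- 1 - a)) *\<^sub>R h + (((- 1 - a) * norm y powr (- 1 - a - 1)) * (h \<bullet> sgn y)) *\<^sub>R y
        = inversion_grad a y *v h" for h
    proof -
      have "norm y powr (- 1 - a - 1) * norm y = norm y powr (- 1 - a - 1) * norm y powr 1" using y0 by simp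
      also have "\<dots> = norm y powr (- 1 - a)" by (subst powr_add[symmetric]) simp
      finally have p: "norm y powr (- 1 - a - 1) * norm y = norm y powr (- 1 - a)" .
      have "(((- 1 - a) * norm y powr (- 1 - a - 1)) * (h \<bullet> sgn y)) *\<^sub>R y
          = (((- 1 - a) * norm y powr (- 1 - a - 1)) * (h \<bullet> sgn y)) *\<^sub>R (norm y *\<^sub>R sgn y)"
        using sgn by simp
      also have "\<dots> = ((- 1 - a) * (norm y powr (- 1 - a - 1) * norm y) * (h \<bullet> sgn y)) *\<^sub>R sgn y"
        by simp
      also have "\<dots> = - (norm y powr (- 1 - a)) *\<^sub>R (((1 + a) * (sgn y \<bullet> h)) *\<^sub>R sgn y)"
        unfolding p by (simp add: inner_commute algebra_simps)
      finally have q: "(((- 1 - a) * norm y powr (- 1 - a - 1)) * (h \<bullet> sgn y)) *\<^sub>R y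
          = - (norm y powr (- 1 - a)) *\<^sub>R (((1 + a) * (sgn y \<bullet> h)) *\<^sub>R sgn y)" .
      have "inversion_grad a y *v h
          = (norm y powr (- 1 - a)) *\<^sub>R (h - ((1 + a) * (sgn y \<bullet> h)) *\<^sub>R sgn y)"
        using False unfolding inversion_grad_def by (simp only: if_False mult_vec_rank_one_update)
      then show ?thesis unfolding q by (simp add: scaleR_diff_right)
    qed
    ultimately show ?thesis by simp
  qed
  then show ?thesis
    by (rule has_derivative_transform_within_open[where s="- cball 0 1"])
       (use y1 in \<open>auto simp: inversion_eq_outside\<close>)
qed

lemma qr_matrix_inversion_grad: "norm y \<ge> 1 \<Longrightarrow> qr_matrix a (inversion_grad a y)"
  unfolding qr_matrix_def inversion_grad_def
  by (intro exI[of _ "norm y powr (- 1 - a)"] exI[of _ "sgn y"]) (auto simp: norm_sgn)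

lemma has_vector_derivative_line:
  assumes "(f has_derivative f') (at x)"
  shows "((\<lambda>t. f (x + t *\<^sub>R e)) has_vector_derivative f' e) (at 0)"
proof -
  have l: "((\<lambda>t::real. x + t *\<^sub>R e) has_derivative (\<lambda>t. t *\<^sub>R e)) (at 0)"
    by (auto intro!: derivative_eq_intros)
  have "(f has_derivative f') (at (x + 0 *\<^sub>R e))" using assms by simp
  from has_derivative_compose[OF l this] linear_simps(5)[OF has_derivative_bounded_linear[OF assms]]
  show ?thesis by (simp add: has_vector_derivative_def)
qed

lemma AE_dist_neq: "k > 0 \<Longrightarrow> AE x::'a::euclidean_space in lborel. dist x c \<noteq> k"
proof -
  have "sphere c k \<in> null_sets lborel"
    using negligible_sphere[of c k] by (simp add: negligible_iff_null_sets null_sets_completion_iff)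
  then show ?thesis
    by (rule AE_I') (auto simp: dist_commute)
qed

section \<open>Self-similar mappings over a ball packing\<close>

text \<open>Transplants one function into all balls of a family at once. The free weights let the
  same operator act on values (weights \<open>b i\<close>) and on gradients (weights
  \<open>b i / k i\<close>).\<close>

definition ball_op :: "(nat \<Rightarrow> real^'n::finite) \<Rightarrow> (nat \<Rightarrow> real) \<Rightarrow> (nat \<Rightarrow> real) \<Rightarrow>
    (real^'n \<Rightarrow> 'b::real_normed_vector) \<Rightarrow> real^'n \<Rightarrow> 'b" where
  "ball_op c k b f x = (\<Sum>i. b i *\<^sub>R f (zoom (c i) (k i) x))"

lemma integral_norm_ball_term:
  fixes c :: "real^'n::finite" and f :: "real^'n \<Rightarrow> 'b::{banach, second_countable_topology}"
  assumes "integrable lborel f" "0 < k" "0 \<le> b"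
  shows "integrable lborel (\<lambda>x. b *\<^sub>R f (zoom c k x))"
    and "(\<integral>x. norm (b *\<^sub>R f (zoom c k x)) \<partial>lborel) = b * k ^ CARD('n) * (\<integral>x. norm (f x) \<partial>lborel)"
  using assms integrable_zoom[OF assms(2,1)] integral_zoom[OF assms(2) integrable_norm[OF assms(1)]] by auto

lemma
  fixes c :: "nat \<Rightarrow> real^'n::finite" and f :: "real^'n \<Rightarrow> 'b::{banach, second_countable_topology}"
  assumes f: "integrable lborel f" and k: "\<And>i. 0 < k i" and b: "\<And>i. 0 \<le> b i"
    and s: "summable (\<lambda>i. b i * k i ^ CARD('n))"
  shows integrable_ball_op: "integrable lborel (ball_op c k b f)"
    and integral_norm_ball_op_le: "(\<integral>x. norm (ball_op c k b f x) \<partial>lborel)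
        \<le> (\<Sum>i. b i * k i ^ CARD('n)) * (\<integral>x. norm (f x) \<partial>lborel)"
proof -
  note t = integral_norm_ball_term[OF f k b]
  have sm: "summable (\<lambda>i. \<integral>x. norm (b i *\<^sub>R f (zoom (c i) (k i) x)) \<partial>lborel)"
    unfolding t(2) using s by (rule summable_mult2)
  show "integrable lborel (ball_op c k b f)"
    unfolding ball_op_def[abs_def] by (rule integrable_suminf[OF t(1) AE_summable_norm[OF t(1) sm] sm])
  show "(\<integral>x. norm (ball_op c k b f x) \<partial>lborel)
        \<le> (\<Sum>i. b i * k i ^ CARD('n)) * (\<integral>x. norm (f x) \<partial>lborel)"
    using integral_norm_suminf_le[OF t(1) sm] unfolding t(2) ball_op_def suminf_mult2[OF s] .
qed

lemma wgrad_ball_op: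
  fixes c :: "nat \<Rightarrow> real^'n::finite"
  assumes u: "wgrad u Y" and k: "\<And>i. 0 < k i" and b: "\<And>i. 0 \<le> b i" and b': "\<And>i. b' i = b i / k i"
    and s: "summable (\<lambda>i. b i * k i ^ CARD('n))" "summable (\<lambda>i. b' i * k i ^ CARD('n))"
  shows "wgrad (ball_op c k b u) (ball_op c k b' Y)"
proof -
  have iu: "integrable lborel u" and iY: "integrable lborel Y" using u by (auto simp: wgrad_def)
  have b0: "0 \<le> b' i" for i using b[of i] k[of i] by (simp add: b')
  show ?thesis unfolding ball_op_def[abs_def]
  proof (rule wgrad_suminf)
    show "wgrad (\<lambda>x. b i *\<^sub>R u (zoom (c i) (k i) x)) (\<lambda>x. b' i *\<^sub>R Y (zoom (c i) (k i) x))" for i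
      unfolding b' by (rule wgrad_zoom[OF u k])
    show "summable (\<lambda>i. \<integral>x. norm (b i *\<^sub>R u (zoom (c i) (k i) x)) \<partial>lborel)"
      unfolding integral_norm_ball_term(2)[OF iu k b] using s(1) by (rule summable_mult2)
    show "summable (\<lambda>i. \<integral>x. norm (b' i *\<^sub>R Y (zoom (c i) (k i) x)) \<partial>lborel)"
      unfolding integral_norm_ball_term(2)[OF iY k b0] using s(2) by (rule summable_mult2)
  qed
qed

lemma ball_op_eq_single:
  assumes "\<And>j. j \<noteq> i \<Longrightarrow> f (zoom (c j) (k j) x) = 0"
  shows "ball_op c k b f x = b i *\<^sub>R f (zoom (c i) (k i) x)"
proof -
  have "ball_op c k b f x = (\<Sum>j\<in>{i}. b j *\<^sub>R f (zoom (c j) (k j) x))"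
    unfolding ball_op_def using assms by (intro suminf_finite) auto
  then show ?thesis by simp
qed

lemma ball_op_measurable [measurable]:
  fixes f :: "real^'n::finite \<Rightarrow> 'b::{banach, second_countable_topology}"
  assumes [measurable]: "f \<in> borel_measurable borel"
  shows "ball_op c k b f \<in> borel_measurable borel"
  unfolding ball_op_def[abs_def] by measurable

text \<open>\<open>full\<close> makes almost-everywhere statements reach the whole unit ball, and
  \<open>exponent\<close> is the condition \<open>p * (1 + a) < n\<close> at p = 1, needed for the
  gradient series to converge in L^1.\<close>

locale packing =
  fixes c :: "nat \<Rightarrow> real^'n::finite" and s :: "nat \<Rightarrow> real" and a \<tau> :: real
  assumes s_pos: "0 < s i"
    and cball_sub: "cball (c i) (s i) \<subseteq> ball 0 1"
    and disj: "i \<noteq> j \<Longrightarrow> cball (c i) (s i) \<inter> cball (c j) (s j) = {}"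
    and full: "negligible (ball 0 1 - (\<Union>i. cball (c i) (s i)))"
    and a_pos: "0 < a" and \<tau>_pos: "0 < \<tau>" and \<tau>_less: "\<tau> < 1"
    and exponent: "1 + a < real CARD('n)"
begin

text \<open>\<open>\<kappa> i\<close> is the radius of the inner ball in which the modification is
  repeated, \<open>b i\<close> is the magnification of values there, and \<open>q\<close> is the
  resulting gradient factor \<open>b i / \<kappa> i\<close>, the same for all balls.\<close>

definition "q = \<tau> powr (- 1 - a)"

definition "\<kappa> i = \<tau> * s i"

definition "b i = s i * \<tau> powr (- a)"

lemma \<kappa>_pos: "0 < \<kappa> i" and \<kappa>_less: "\<kappa> i < s i" and b_pos: "0 < b i" and q_pos: "0 < q"
  using s_pos[of i] \<tau>_pos \<tau>_less by (auto simp: \<kappa>_def b_def q_def)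

lemma q_mult_\<tau>: "q * \<tau> = \<tau> powr (- a)"
proof -
  have "q * \<tau> = \<tau> powr (- 1 - a) * \<tau> powr 1" using \<tau>_pos by (simp add: q_def)
  also have "\<dots> = \<tau> powr (- a)" by (subst powr_add[symmetric]) simp
  finally show ?thesis .
qed

lemma b_div_\<kappa>: "b i / \<kappa> i = q"
  using s_pos[of i] \<tau>_pos q_mult_\<tau> by (simp add: b_def \<kappa>_def field_simps)

lemma suminf_s_le: "(\<Sum>i. ennreal (s i ^ CARD('n))) \<le> 1"
proof -
  define V where "V = unit_ball_vol (real CARD('n))"
  have V: "V > 0" by (simp add: V_def)
  have "(\<Sum>i. ennreal V * ennreal (s i ^ CARD('n))) = (\<Sum>i. emeasure lborel (cball (c i) (s i)))"
    using s_pos V by (intro suminf_cong) (simp add: emeasure_cball less_imp_le V_def ennreal_mult)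
  also have "\<dots> = emeasure lborel (\<Union>i. cball (c i) (s i))"
    using disj by (intro suminf_emeasure) (auto simp: disjoint_family_on_def)
  also have "\<dots> \<le> emeasure lborel (cball (0::real^'n) 1)"
    using cball_sub by (intro emeasure_mono) (auto simp: subset_iff less_imp_le)
  also have "\<dots> = ennreal V * 1" by (simp add: emeasure_cball V_def)
  finally have "ennreal V * (\<Sum>i. ennreal (s i ^ CARD('n))) \<le> ennreal V * 1" by simp
  then show ?thesis using V by (subst (asm) ennreal_mult_le_mult_iff) auto
qed

lemma summable_s: "summable (\<lambda>i. s i ^ CARD('n))" and suminf_s: "(\<Sum>i. s i ^ CARD('n)) \<le> 1"
proof -
  show *: "summable (\<lambda>i. s i ^ CARD('n))"
    using suminf_s_le s_pos by (intro summable_suminf_not_top) (auto simp: less_imp_le top_unique)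
  have "ennreal (\<Sum>i. s i ^ CARD('n)) \<le> 1"
    using suminf_s_le s_pos * by (subst suminf_ennreal2[symmetric]) (auto simp: less_imp_le)
  then show "(\<Sum>i. s i ^ CARD('n)) \<le> 1" by simp
qed

lemma s_le_1: "s i \<le> 1"
proof (rule ccontr)
  assume "\<not> s i \<le> 1"
  then have "1 < s i ^ CARD('n)" by (intro one_less_power) auto
  also have "s i ^ CARD('n) = sum (\<lambda>i. s i ^ CARD('n)) {i}" by simp
  also have "\<dots> \<le> (\<Sum>i. s i ^ CARD('n))"
    using s_pos by (intro sum_le_suminf summable_s) (auto simp: less_imp_le)
  finally show False using suminf_s by simp
qed

lemma norm_c_less: "norm (c i) < 1"
proof -
  have "c i \<in> cball (c i) (s i)" using s_pos[of i] by simp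
  then have "c i \<in> ball 0 1" using cball_sub[of i] by blast
  then show ?thesis by simp
qed

text \<open>Consequence of disjointness that leaves only one active term in every sum over
  balls.\<close>

lemma zoom_outside:
  assumes "dist x (c i) \<le> s i" "j \<noteq> i" "0 < k" "k \<le> s j"
  shows "1 < norm (zoom (c j) k x)"
proof -
  have "x \<in> cball (c i) (s i)" using assms(1) by (simp add: dist_commute)
  then have "x \<notin> cball (c j) (s j)" using disj[OF assms(2)] by blast
  then have "k < dist x (c j)" using assms by (simp add: dist_commute)
  then show ?thesis using assms by (simp add: norm_zoom)
qed

text \<open>The correction made in one normalised ball: the new map minus the old one. In the unit
  ball the old map is the identity; subtracting \<open>inversion a\<close> instead makes the
  difference vanish outside, where the radial map is homogeneous of degree \<open>- a\<close> and
  both terms agree.\<close>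

definition "u y = \<tau> powr (- a) *\<^sub>R inversion a (zoom 0 \<tau> y) - inversion a (y::real^'n)"

definition "U y = q *\<^sub>R inversion_grad a (zoom 0 \<tau> y) - inversion_grad a (y::real^'n)"

lemma zoom_0: "zoom 0 \<tau> y = (1 / \<tau>) *\<^sub>R (y::real^'n)" by (simp add: zoom_def)

lemma norm_zoom_0: "norm (zoom 0 \<tau> y) = norm (y::real^'n) / \<tau>"
  using \<tau>_pos by (simp add: norm_zoom)

lemma powr_zoom_0: "norm (zoom 0 \<tau> y) powr (- 1 - a) = norm (y::real^'n) powr (- 1 - a) / q"
  using \<tau>_pos by (simp add: norm_zoom_0 powr_divide q_def)

lemma u_eq_0: assumes "1 \<le> norm y" shows "u y = 0"
proof -
  have "1 \<le> norm (zoom 0 \<tau> y)"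
    using assms \<tau>_pos \<tau>_less by (simp add: norm_zoom_0)
  then have "\<tau> powr (- a) *\<^sub>R inversion a (zoom 0 \<tau> y) = (q * \<tau>) *\<^sub>R ((norm y powr (- 1 - a) / q) *\<^sub>R zoom 0 \<tau> y)"
    unfolding q_mult_\<tau> by (simp only: inversion_eq_outside powr_zoom_0)
  also have "\<dots> = (norm y powr (- 1 - a)) *\<^sub>R y"
    using q_pos \<tau>_pos by (simp add: zoom_0)
  finally show ?thesis using assms by (simp add: u_def inversion_eq_outside)
qed

lemma U_eq_0: assumes "1 \<le> norm y" shows "U y = 0"
proof -
  have 1: "\<not> norm (zoom 0 \<tau> y) < 1"
    using assms \<tau>_pos \<tau>_less by (simp add: norm_zoom_0)
  have "sgn (zoom 0 \<tau> y) = sgn y" using \<tau>_pos by (simp add: zoom_0 sgn_scaleR)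
  then have "q *\<^sub>R inversion_grad a (zoom 0 \<tau> y) = inversion_grad a y"
    using 1 assms q_pos unfolding inversion_grad_def powr_zoom_0 by simp
  then show ?thesis by (simp add: U_def)
qed

lemma u_measurable [measurable]: "u \<in> borel_measurable borel"
  unfolding u_def[abs_def] by measurable

lemma U_measurable [measurable]: "U \<in> borel_measurable borel"
  unfolding U_def[abs_def] by measurable

text \<open>\<open>u\<close> is Lipschitz, supported in the unit ball and differentiable off the
  spheres of radii \<open>\<tau>\<close> and 1, so integration by parts holds for test functions of
  arbitrary support.\<close>

lemma wgrad_u: "wgrad u U"
proof -
  define C where "C = real CARD('n) * real CARD('n) * (2 + a)"
  have a0: "a \<ge> 0" using a_pos by simp
  have nu: "norm (u x) \<le> \<tau> powr (- a) + 1" for x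
    unfolding u_def using norm_inversion_le[OF a0, of "zoom 0 \<tau> x"] norm_inversion_le[OF a0, of x]
    by (intro order_trans[OF norm_triangle_ineq4] add_mono) (auto intro: mult_left_le)
  have nU: "norm (U x) \<le> q * C + C" for x
    unfolding U_def using norm_inversion_grad_le[OF a0, where 'n='n, folded C_def] q_pos
    by (intro order_trans[OF norm_triangle_ineq4] add_mono) (auto intro!: mult_left_mono)
  have iu: "integrable lborel u"
    by (rule integrable_bounded_support[of _ "ball 0 1", OF _ _ _ nu]) (auto simp: u_eq_0)
  have iU: "integrable lborel U"
    by (rule integrable_bounded_support[of _ "ball 0 1", OF _ _ _ nU]) (auto simp: U_eq_0)
  have lip: "norm (u x - u y) \<le> (\<tau> powr (- a) * ((2 + a) / \<tau>) + (2 + a)) * norm (x - y)" for x y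
  proof -
    have "u x - u y = \<tau> powr (- a) *\<^sub>R (inversion a (zoom 0 \<tau> x) - inversion a (zoom 0 \<tau> y)) - (inversion a x - inversion a y)"
      by (simp add: u_def algebra_simps)
    also have "norm \<dots> \<le> \<tau> powr (- a) * norm (inversion a (zoom 0 \<tau> x) - inversion a (zoom 0 \<tau> y)) + norm (inversion a x - inversion a y)"
      by (intro order_trans[OF norm_triangle_ineq4]) simp
    also have "\<dots> \<le> \<tau> powr (- a) * ((2 + a) * norm (zoom 0 \<tau> x - zoom 0 \<tau> y)) + (2 + a) * norm (x - y)"
      using inversion_lipschitz[OF a0] by (intro add_mono mult_left_mono) auto
    also have "norm (zoom 0 \<tau> x - zoom 0 \<tau> y) = norm (x - y) / \<tau>"
      using \<tau>_pos by (simp add: zoom_0 divide_inverse mult.commute flip: scaleR_diff_right)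
    finally show ?thesis by (simp add: algebra_simps)
  qed
  have der: "AE x in lborel. ((\<lambda>t. u (x + t *\<^sub>R e)) has_vector_derivative (U x *v e)) (at 0)" for e
  proof -
    have "AE x in lborel. dist x 0 \<noteq> \<tau>" "AE x::real^'n in lborel. dist x 0 \<noteq> 1"
      using \<tau>_pos by (intro AE_dist_neq; simp)+
    then show ?thesis
    proof eventually_elim
      case (elim x)
      have 1: "(inversion a has_derivative (\<lambda>h. inversion_grad a x *v h)) (at x)"
        using elim by (intro inversion_has_derivative) simp
      have "norm (zoom 0 \<tau> x) \<noteq> 1" using elim \<tau>_pos by (simp add: norm_zoom_0)
      then have 2: "(inversion a has_derivative (\<lambda>h. inversion_grad a (zoom 0 \<tau> x) *v h)) (at (zoom 0 \<tau> x))"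
        by (rule inversion_has_derivative)
      have 3: "(zoom 0 \<tau> has_derivative (\<lambda>h. (1 / \<tau>) *\<^sub>R h)) (at x)"
        unfolding zoom_def[abs_def] by (auto intro!: derivative_eq_intros)
      have "(u has_derivative (\<lambda>h. \<tau> powr (- a) *\<^sub>R (inversion_grad a (zoom 0 \<tau> x) *v ((1 / \<tau>) *\<^sub>R h)) - inversion_grad a x *v h)) (at x)"
        unfolding u_def[abs_def]
        by (intro has_derivative_diff has_derivative_scaleR_right 1 has_derivative_compose[OF 3 2])
      moreover have "\<tau> powr (- a) *\<^sub>R (inversion_grad a (zoom 0 \<tau> x) *v ((1 / \<tau>) *\<^sub>R h)) - inversion_grad a x *v h = U x *v h" for h
        using \<tau>_pos unfolding q_mult_\<tau>[symmetric]
        by (simp add: U_def matrix_vector_mult_diff_rdistrib matrix_vector_mult_scaleR scaleR_matrix_vector_assoc[symmetric])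
      ultimately have "(u has_derivative (\<lambda>h. U x *v h)) (at x)" by simp
      then show ?case by (rule has_vector_derivative_line)
    qed
  qed
  show ?thesis
    unfolding wgrad_def
  proof (intro conjI allI impI iu iU)
    fix e :: "real^'n" and \<phi> \<phi>' assume C: "C1_along e \<phi> \<phi>'"
    show "(\<integral>x. \<phi>' x *\<^sub>R u x \<partial>lborel) = - (\<integral>x. \<phi> x *\<^sub>R (U x *v e) \<partial>lborel)"
      by (rule integration_by_parts_lipschitz[OF lip nu _ _ der C, of "ball 0 1"]) (auto simp: u_eq_0)
  qed
qed

text \<open>The first round of corrections, in the balls of radii \<open>s i\<close>. Scaling a map
  by \<open>s i\<close> in both domain and range leaves gradients unchanged, hence the weights 1 in
  \<open>V\<close>.\<close>

definition "v = ball_op c s s u"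

definition "V = ball_op c s (\<lambda>_. 1) U"

lemma wgrad_v: "wgrad v V"
  unfolding v_def V_def
proof (rule wgrad_ball_op[OF wgrad_u s_pos])
  show "0 \<le> s i" "1 = s i / s i" for i using s_pos[of i] by auto
  show "summable (\<lambda>i. 1 * s i ^ CARD('n))" using summable_s by simp
  show "summable (\<lambda>i. s i * s i ^ CARD('n))"
    using s_pos s_le_1 by (intro summable_comparison_test'[OF summable_s]) (auto simp: less_imp_le mult_left_le_one_le)
qed

lemma
  assumes "dist x (c i) \<le> s i"
  shows v_eq: "v x = s i *\<^sub>R u (zoom (c i) (s i) x)" and V_eq: "V x = U (zoom (c i) (s i) x)"
proof -
  have o: "1 \<le> norm (zoom (c j) (s j) x)" if "j \<noteq> i" for j
    using zoom_outside[OF assms that s_pos[of j]] by simp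
  show "v x = s i *\<^sub>R u (zoom (c i) (s i) x)"
    unfolding v_def by (intro ball_op_eq_single u_eq_0 o)
  show "V x = U (zoom (c i) (s i) x)"
    unfolding V_def by (subst ball_op_eq_single[where i=i]) (simp_all add: U_eq_0 o)
qed

lemma in_ball_if_zoom:
  assumes "norm (zoom (c i) (s i) x) < 1"
  shows "norm x < 1"
proof -
  have "x \<in> cball (c i) (s i)" using assms s_pos[of i] by (simp add: norm_zoom dist_commute)
  then have "x \<in> ball 0 1" using cball_sub[of i] by blast
  then show ?thesis by simp
qed

lemma v_eq_0: "1 \<le> norm x \<Longrightarrow> v x = 0" and V_eq_0: "1 \<le> norm x \<Longrightarrow> V x = 0"
proof -
  assume "1 \<le> norm x"
  then have "1 \<le> norm (zoom (c i) (s i) x)" for i using in_ball_if_zoom[of i x] by linarith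
  then show "v x = 0" "V x = 0" unfolding v_def V_def ball_op_def by (simp_all add: u_eq_0 U_eq_0)
qed

section \<open>The unfinished sets and their measure\<close>

lemma zoom_vimage_sets: "A \<in> sets borel \<Longrightarrow> zoom (x::real^'n) k -` A \<in> sets borel"
  using measurable_sets_borel[OF zoom_measurable] .

text \<open>\<open>E k\<close> is the union of the inner balls of generation k, the part of the unit
  ball still unfinished after k rounds.\<close>

fun E :: "nat \<Rightarrow> (real^'n) set" where
  "E 0 = ball 0 1"
| "E (Suc k) = {x. \<exists>i. zoom (c i) (\<kappa> i) x \<in> E k}"

lemma E_sets [measurable]: "E k \<in> sets borel"
proof (induction k)
  case (Suc k)
  have "E (Suc k) = (\<Union>i. zoom (c i) (\<kappa> i) -` E k)" by auto
  also have "\<dots> \<in> sets borel" using Suc by (intro sets.countable_UN') (auto intro!: zoom_vimage_sets)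
  finally show ?case .
qed simp

lemma norm_zoom_\<kappa>_less_1_iff: "norm (zoom (c i) (\<kappa> i) x) < 1 \<longleftrightarrow> dist x (c i) < \<kappa> i"
  by (simp add: norm_zoom \<kappa>_pos)

lemma E_decseq: "E (Suc k) \<subseteq> E k"
proof (induction k)
  case 0
  show ?case
  proof
    fix x assume "x \<in> E (Suc 0)"
    then obtain i where "norm (zoom (c i) (\<kappa> i) x) < 1" by auto
    then have "dist x (c i) < s i" using \<kappa>_less[of i] by (simp only: norm_zoom_\<kappa>_less_1_iff)
    then have "norm (zoom (c i) (s i) x) < 1" by (simp add: norm_zoom s_pos)
    then show "x \<in> E 0" using in_ball_if_zoom by auto
  qed
next
  case (Suc k)
  then show ?case unfolding E.simps(2)[of "Suc k"] E.simps(2)[of k] by blast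
qed

lemma E_antimono: "k \<le> m \<Longrightarrow> E m \<subseteq> E k"
  using E_decseq by (rule lift_Suc_antimono_le)

lemma E_sub_ball: "E k \<subseteq> ball 0 1"
  using E_antimono[of 0 k] by simp

text \<open>One generation scales measure by the sum of \<open>\<kappa> i ^ n\<close>, which is
  \<open>\<tau> ^ n\<close> times the sum of \<open>s i ^ n\<close>, and the latter is at most
  1.\<close>

lemma emeasure_E_le: "emeasure lborel (E k) \<le> ennreal ((\<tau> ^ CARD('n)) ^ k) * emeasure lborel (ball (0::real^'n) 1)"
proof (induction k)
  case (Suc k)
  have "E (Suc k) = (\<Union>i. zoom (c i) (\<kappa> i) -` E k)" by auto
  also have "emeasure lborel \<dots> \<le> (\<Sum>i. emeasure lborel (zoom (c i) (\<kappa> i) -` E k))"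
    by (intro emeasure_subadditive_countably) (auto intro!: zoom_vimage_sets)
  also have "\<dots> = (\<Sum>i. ennreal (s i ^ CARD('n)) * (ennreal (\<tau> ^ CARD('n)) * emeasure lborel (E k)))"
  proof (intro suminf_cong)
    fix i
    have "emeasure lborel (zoom (c i) (\<kappa> i) -` E k) = (\<integral>\<^sup>+x. indicator (E k) (zoom (c i) (\<kappa> i) x) \<partial>lborel)"
      by (subst nn_integral_indicator[symmetric]) (auto intro!: zoom_vimage_sets nn_integral_cong simp: indicator_def)
    also have "\<dots> = ennreal (\<kappa> i ^ CARD('n)) * emeasure lborel (E k)"
      by (subst nn_integral_zoom[OF \<kappa>_pos]) auto
    also have "\<dots> = ennreal (s i ^ CARD('n)) * (ennreal (\<tau> ^ CARD('n)) * emeasure lborel (E k))"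
      using \<tau>_pos s_pos[of i] by (simp add: \<kappa>_def power_mult_distrib ennreal_mult mult_ac)
    finally show "emeasure lborel (zoom (c i) (\<kappa> i) -` E k) = ennreal (s i ^ CARD('n)) * (ennreal (\<tau> ^ CARD('n)) * emeasure lborel (E k))" .
  qed
  also have "\<dots> = (\<Sum>i. ennreal (s i ^ CARD('n))) * (ennreal (\<tau> ^ CARD('n)) * emeasure lborel (E k))" by simp
  also have "\<dots> \<le> 1 * (ennreal (\<tau> ^ CARD('n)) * (ennreal ((\<tau> ^ CARD('n)) ^ k) * emeasure lborel (ball (0::real^'n) 1)))"
    using suminf_s_le Suc by (intro mult_mono) auto
  also have "\<dots> = ennreal ((\<tau> ^ CARD('n)) ^ Suc k) * emeasure lborel (ball (0::real^'n) 1)"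
    using \<tau>_pos by (simp add: ennreal_mult mult.assoc)
  finally show ?case .
qed simp

lemma AE_not_E: "AE x in lborel. \<exists>k. x \<notin> E k"
proof -
  have "emeasure lborel (\<Inter>k. E k) \<le> 0"
  proof (rule LIMSEQ_le_const)
    have "\<tau> ^ CARD('n) < 1" using \<tau>_pos \<tau>_less by (intro power_less_one_iff[THEN iffD2]) auto
    then have "(\<lambda>k. (\<tau> ^ CARD('n)) ^ k) \<longlonglongrightarrow> 0" using \<tau>_pos by (intro LIMSEQ_power_zero) auto
    then have "(\<lambda>k. ennreal ((\<tau> ^ CARD('n)) ^ k)) \<longlonglongrightarrow> ennreal 0" by (rule tendsto_ennrealI)
    then show "(\<lambda>k. ennreal ((\<tau> ^ CARD('n)) ^ k) * emeasure lborel (ball (0::real^'n) 1)) \<longlonglongrightarrow> 0"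
      using emeasure_bounded_finite[of "ball (0::real^'n) 1"]
        tendsto_mult_ennreal[of "\<lambda>k. ennreal ((\<tau> ^ CARD('n)) ^ k)" 0 sequentially "\<lambda>_. emeasure lborel (ball (0::real^'n) 1)" "emeasure lborel (ball (0::real^'n) 1)"]
      by simp
    show "\<exists>K. \<forall>k\<ge>K. emeasure lborel (\<Inter>k. E k) \<le> ennreal ((\<tau> ^ CARD('n)) ^ k) * emeasure lborel (ball (0::real^'n) 1)"
    proof (intro exI allI impI)
      fix k
      have "emeasure lborel (\<Inter>k. E k) \<le> emeasure lborel (E k)" by (intro emeasure_mono) auto
      then show "emeasure lborel (\<Inter>k. E k) \<le> ennreal ((\<tau> ^ CARD('n)) ^ k) * emeasure lborel (ball (0::real^'n) 1)"
        using emeasure_E_le[of k] by (rule order_trans)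
    qed
  qed
  then have "(\<Inter>k. E k) \<in> null_sets lborel" by (auto simp: null_sets_def)
  then show ?thesis by (rule AE_I') auto
qed

text \<open>\<open>itr B Z k\<close> is the correction of round k: \<open>Z\<close> transplanted
  into every inner ball of generation k. The pair \<open>b\<close>, \<open>v\<close> gives values,
  the pair \<open>q\<close>, \<open>V\<close> gives gradients.\<close>

fun itr :: "(nat \<Rightarrow> real) \<Rightarrow> (real^'n \<Rightarrow> 'b::real_normed_vector) \<Rightarrow> nat \<Rightarrow> real^'n \<Rightarrow> 'b" where
  "itr B Z 0 = Z"
| "itr B Z (Suc k) = ball_op c \<kappa> B (itr B Z k)"

text \<open>At points lying in every \<open>E m\<close> the series may diverge and its value is
  meaningless; statements about values therefore carry a hypothesis \<open>x \<notin> E m\<close>,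
  under which the sum is finite.\<close>

definition ser :: "(nat \<Rightarrow> real) \<Rightarrow> (real^'n \<Rightarrow> 'b::real_normed_vector) \<Rightarrow> real^'n \<Rightarrow> 'b" where
  "ser B Z x = (\<Sum>k. itr B Z k x)"

lemma itr_eq_0:
  assumes Z: "\<And>x. 1 \<le> norm x \<Longrightarrow> Z x = 0"
  shows "x \<notin> E k \<Longrightarrow> itr B Z k x = 0"
proof (induction k arbitrary: x)
  case 0
  then show ?case using Z by simp
next
  case (Suc k)
  then have "itr B Z k (zoom (c i) (\<kappa> i) x) = 0" for i by simp
  then show ?case by (simp add: ball_op_def)
qed

lemma ser_eq_sum:
  assumes Z: "\<And>x. 1 \<le> norm x \<Longrightarrow> Z x = 0" and "x \<notin> E m"
  shows "ser B Z x = (\<Sum>k<m. itr B Z k x)"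
  unfolding ser_def
proof (rule suminf_finite)
  show "itr B Z k x = 0" if "k \<notin> {..<m}" for k
    using that assms(2) E_antimono[of m k] by (intro itr_eq_0 Z) auto
qed simp

lemma ser_eq_0:
  assumes Z: "\<And>x. 1 \<le> norm x \<Longrightarrow> Z x = 0" and "1 \<le> norm x"
  shows "ser B Z x = 0"
proof -
  have "x \<notin> E 0" using assms(2) by simp
  from ser_eq_sum[where Z=Z, OF Z this] show ?thesis by simp
qed

lemma zoom_in_E_unique:
  assumes "dist x (c i) \<le> s i" "j \<noteq> i"
  shows "zoom (c j) (\<kappa> j) x \<notin> E k"
proof -
  have "1 < norm (zoom (c j) (\<kappa> j) x)"
    using \<kappa>_less[of j] by (intro zoom_outside[OF assms \<kappa>_pos]) simp
  then have "zoom (c j) (\<kappa> j) x \<notin> ball 0 1" by simp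
  then show ?thesis using E_sub_ball by blast
qed

lemma not_in_E_Suc:
  assumes "dist x (c i) \<le> s i" "zoom (c i) (\<kappa> i) x \<notin> E k"
  shows "x \<notin> E (Suc k)"
proof
  assume "x \<in> E (Suc k)"
  then obtain j where "zoom (c j) (\<kappa> j) x \<in> E k" by auto
  then show False using assms zoom_in_E_unique[OF assms(1), of j k] by (cases "j = i") auto
qed

text \<open>Inside the i-th packed ball only the branch through that ball is active, so an index
  shift turns the series into this recursion. It is the source of the self-similarity of the
  limit.\<close>

lemma ser_step:
  assumes Z: "\<And>x. 1 \<le> norm x \<Longrightarrow> Z x = 0"
    and x: "dist x (c i) \<le> s i" and m: "zoom (c i) (\<kappa> i) x \<notin> E m"
  shows "ser B Z x = Z x + B i *\<^sub>R ser B Z (zoom (c i) (\<kappa> i) x)"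
proof -
  have "itr B Z (Suc k) x = B i *\<^sub>R itr B Z k (zoom (c i) (\<kappa> i) x)" for k
    unfolding itr.simps
    by (rule ball_op_eq_single) (intro itr_eq_0[OF Z] zoom_in_E_unique[OF x])
  then have "(\<Sum>k<Suc m. itr B Z k x) = Z x + (\<Sum>k<m. B i *\<^sub>R itr B Z k (zoom (c i) (\<kappa> i) x))"
    by (subst sum.lessThan_Suc_shift) simp
  then show ?thesis
    using ser_eq_sum[where Z=Z and B=B, OF Z not_in_E_Suc[OF x m]] ser_eq_sum[where Z=Z and B=B, OF Z m]
    by (simp only: scaleR_sum_right)
qed

definition "\<rho> = \<tau> powr (real CARD('n) - 1 - a)"

lemma \<rho>: "0 < \<rho>" "\<rho> < 1"
proof -
  show "0 < \<rho>" using \<tau>_pos by (simp add: \<rho>_def)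
  have "\<tau> powr (real CARD('n) - 1 - a) < \<tau> powr 0"
    using \<tau>_pos \<tau>_less exponent by (intro powr_less_mono') auto
  then show "\<rho> < 1" using \<tau>_pos by (simp add: \<rho>_def)
qed

lemma q_\<tau>_power: "q * \<tau> ^ CARD('n) = \<rho>"
proof -
  have "q * \<tau> ^ CARD('n) = \<tau> powr (- 1 - a) * \<tau> powr real CARD('n)"
    using \<tau>_pos by (simp add: q_def powr_realpow)
  also have "\<dots> = \<tau> powr ((- 1 - a) + real CARD('n))" by (rule powr_add[symmetric])
  also have "(- 1 - a) + real CARD('n) = real CARD('n) - 1 - a" by simp
  finally show ?thesis unfolding \<rho>_def .
qed

text \<open>\<open>b i\<close> is at most \<open>q\<close> because \<open>\<kappa> i\<close> is at
  most 1; hence the ratio \<open>\<rho>\<close> of the gradient series also controls the series of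
  values.\<close>

lemma weights_le:
  "q * \<kappa> i ^ CARD('n) = \<rho> * s i ^ CARD('n)" "b i * \<kappa> i ^ CARD('n) \<le> \<rho> * s i ^ CARD('n)"
proof -
  show *: "q * \<kappa> i ^ CARD('n) = \<rho> * s i ^ CARD('n)"
    by (simp add: \<kappa>_def power_mult_distrib flip: q_\<tau>_power)
  have "b i = q * \<kappa> i" using b_div_\<kappa>[of i] \<kappa>_pos[of i] by (simp add: field_simps)
  also have "\<dots> \<le> q * 1"
    using q_pos \<kappa>_less[of i] s_le_1[of i] by (intro mult_left_mono) auto
  finally have "b i \<le> q" by simp
  then have "b i * \<kappa> i ^ CARD('n) \<le> q * \<kappa> i ^ CARD('n)"
    using \<kappa>_pos[of i] by (intro mult_right_mono) auto
  then show "b i * \<kappa> i ^ CARD('n) \<le> \<rho> * s i ^ CARD('n)" unfolding * .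
qed

lemma summable_weights:
  "summable (\<lambda>i. q * \<kappa> i ^ CARD('n))" "(\<Sum>i. q * \<kappa> i ^ CARD('n)) \<le> \<rho>"
  "summable (\<lambda>i. b i * \<kappa> i ^ CARD('n))" "(\<Sum>i. b i * \<kappa> i ^ CARD('n)) \<le> \<rho>"
proof -
  have s: "summable (\<lambda>i. \<rho> * s i ^ CARD('n))" using summable_s by (rule summable_mult)
  have le: "(\<Sum>i. \<rho> * s i ^ CARD('n)) \<le> \<rho>"
    unfolding suminf_mult[OF summable_s] using suminf_s \<rho> by (simp add: mult_left_le)
  show "summable (\<lambda>i. q * \<kappa> i ^ CARD('n))" "(\<Sum>i. q * \<kappa> i ^ CARD('n)) \<le> \<rho>"
    unfolding weights_le(1) by (fact s le)+
  have nn: "norm (b i * \<kappa> i ^ CARD('n)) \<le> \<rho> * s i ^ CARD('n)" for i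
    using weights_le(2)[of i] b_pos[of i] \<kappa>_pos[of i] by (simp add: abs_mult)
  show sb: "summable (\<lambda>i. b i * \<kappa> i ^ CARD('n))"
    by (rule summable_comparison_test'[OF s nn])
  show "(\<Sum>i. b i * \<kappa> i ^ CARD('n)) \<le> \<rho>"
    using suminf_le[OF weights_le(2) sb s] le by linarith
qed

lemma itr_integrable:
  fixes Z :: "real^'n \<Rightarrow> 'b::{banach, second_countable_topology}"
  assumes Z: "integrable lborel Z" and B: "\<And>i. 0 \<le> B i" "summable (\<lambda>i. B i * \<kappa> i ^ CARD('n))"
    "(\<Sum>i. B i * \<kappa> i ^ CARD('n)) \<le> \<rho>"
  shows "integrable lborel (itr B Z k) \<and> (\<integral>x. norm (itr B Z k x) \<partial>lborel) \<le> \<rho> ^ k * (\<integral>x. norm (Z x) \<partial>lborel)"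
proof (induction k)
  case (Suc k)
  then have i: "integrable lborel (itr B Z k)" by simp
  have "(\<integral>x. norm (itr B Z (Suc k) x) \<partial>lborel) \<le> (\<Sum>i. B i * \<kappa> i ^ CARD('n)) * (\<integral>x. norm (itr B Z k x) \<partial>lborel)"
    unfolding itr.simps by (rule integral_norm_ball_op_le[OF i \<kappa>_pos B(1,2)])
  also have "\<dots> \<le> \<rho> * (\<rho> ^ k * (\<integral>x. norm (Z x) \<partial>lborel))"
    using Suc B(3) \<rho> by (intro mult_mono) auto
  finally show ?case using integrable_ball_op[OF i \<kappa>_pos B(1,2)] by (simp add: mult.assoc)
qed (use Z in auto)

lemma summable_itr:
  fixes Z :: "real^'n \<Rightarrow> 'b::{banach, second_countable_topology}"
  assumes Z: "integrable lborel Z" and B: "\<And>i. 0 \<le> B i" "summable (\<lambda>i. B i * \<kappa> i ^ CARD('n))"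
    "(\<Sum>i. B i * \<kappa> i ^ CARD('n)) \<le> \<rho>"
  shows "summable (\<lambda>k. \<integral>x. norm (itr B Z k x) \<partial>lborel)"
proof (rule summable_comparison_test')
  show "summable (\<lambda>k. \<rho> ^ k * (\<integral>x. norm (Z x) \<partial>lborel))"
    using \<rho> by (intro summable_mult2 summable_geometric) auto
  show "norm (\<integral>x. norm (itr B Z k x) \<partial>lborel) \<le> \<rho> ^ k * (\<integral>x. norm (Z x) \<partial>lborel)" if "0 \<le> k" for k
    using itr_integrable[OF Z B] by simp
qed

definition "W = ser b v"

definition "DW = ser (\<lambda>_. q) V"

text \<open>Every round is a weak-gradient pair because \<open>b i / \<kappa> i = q\<close>, and
  both series are dominated in L^1 by geometric series of ratio \<open>\<rho>\<close>.\<close>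

lemma wgrad_W: "wgrad W DW"
proof -
  have w: "wgrad (itr b v k) (itr (\<lambda>_. q) V k)" for k
  proof (induction k)
    case (Suc k)
    then show ?case unfolding itr.simps
      using b_pos b_div_\<kappa> summable_weights by (intro wgrad_ball_op \<kappa>_pos) (auto simp: less_imp_le)
  qed (simp add: wgrad_v)
  have i: "integrable lborel v" "integrable lborel V" using wgrad_v by (auto simp: wgrad_def)
  show ?thesis unfolding W_def DW_def ser_def[abs_def]
    using b_pos q_pos i summable_weights
    by (intro wgrad_suminf w summable_itr) (auto simp: less_imp_le)
qed

text \<open>The limit map. The radial map decays only like |y|^(-a) with a < n and is not integrable
  on the whole space, so it is kept apart from \<open>W\<close>, which vanishes outside the unit
  ball.\<close>

definition "\<Phi> y = W y + inversion a y"

definition "D\<Phi> y = DW y + inversion_grad a y"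

lemma \<Phi>_measurable [measurable]: "\<Phi> \<in> borel_measurable borel"
  and D\<Phi>_measurable [measurable]: "D\<Phi> \<in> borel_measurable borel"
proof -
  have [measurable]: "W \<in> borel_measurable borel" "DW \<in> borel_measurable borel"
    using wgrad_W by (auto simp: wgrad_def)
  show "\<Phi> \<in> borel_measurable borel" "D\<Phi> \<in> borel_measurable borel"
    unfolding \<Phi>_def[abs_def] D\<Phi>_def[abs_def] by measurable
qed

lemma
  assumes "1 \<le> norm y"
  shows W_eq_0: "W y = 0" and DW_eq_0: "DW y = 0"
proof -
  show "W y = 0" unfolding W_def using v_eq_0 assms by (rule ser_eq_0)
  show "DW y = 0" unfolding DW_def using V_eq_0 assms by (rule ser_eq_0)
qed

lemma affine_dist:
  assumes "norm y < 1 / \<tau>"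
  shows "dist (c i + \<kappa> i *\<^sub>R y) (c i) < s i"
proof -
  have "dist (c i + \<kappa> i *\<^sub>R y) (c i) = \<kappa> i * norm y" using \<kappa>_pos[of i] by (simp add: dist_norm)
  also have "\<dots> < \<kappa> i * (1 / \<tau>)" using assms \<kappa>_pos[of i] by (intro mult_strict_left_mono) auto
  also have "\<dots> = s i" using \<tau>_pos by (simp add: \<kappa>_def)
  finally show ?thesis .
qed

lemma affine_in_ball:
  assumes "norm y < 1 / \<tau>"
  shows "norm (c i + \<kappa> i *\<^sub>R y) < 1"
proof -
  have "dist (c i + \<kappa> i *\<^sub>R y) (c i) / s i < 1"
    using affine_dist[OF assms, of i] s_pos[of i] by (simp only: divide_less_eq_1) simp
  then show ?thesis using in_ball_if_zoom[of i] by (simp only: norm_zoom[OF s_pos])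
qed

text \<open>The identities hold beyond the unit ball, up to radius \<open>1 / \<tau>\<close>, because there the modification
  in the packed ball and \<open>inversion a\<close> are the same radial map up to scaling.\<close>

lemma
  assumes y: "norm y < 1 / \<tau>" and m: "y \<notin> E m"
  shows \<Phi>_affine: "\<Phi> (c i + \<kappa> i *\<^sub>R y) = c i + b i *\<^sub>R \<Phi> y"
    and D\<Phi>_affine: "D\<Phi> (c i + \<kappa> i *\<^sub>R y) = q *\<^sub>R D\<Phi> y"
proof -
  let ?x = "c i + \<kappa> i *\<^sub>R y"
  have zx: "zoom (c i) (\<kappa> i) ?x = y" using \<kappa>_pos[of i] by simp
  have zs: "zoom (c i) (s i) ?x = \<tau> *\<^sub>R y" using s_pos[of i] by (simp add: zoom_def \<kappa>_def)
  have z0: "zoom 0 \<tau> (\<tau> *\<^sub>R y) = y" using \<tau>_pos by (simp add: zoom_def)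
  have d: "dist ?x (c i) \<le> s i" using affine_dist[OF y] by (simp add: less_imp_le)
  have n: "norm (\<tau> *\<^sub>R y) < 1" using y \<tau>_pos by (simp add: field_simps)
  have x1: "norm ?x < 1" by (rule affine_in_ball[OF y])
  have "W ?x = v ?x + b i *\<^sub>R W y"
    unfolding W_def using ser_step[where Z=v and B=b, OF v_eq_0 d, unfolded zx, OF _ m] by simp
  \<comment> \<open>The subtracted term \<open>s i * \<tau>\<close> times \<open>y\<close> is
    \<open>\<kappa> i *\<^sub>R y\<close>. It cancels the linear part of
    \<open>inversion a ?x = c i + \<kappa> i *\<^sub>R y\<close>, leaving only the centre
    \<open>c i\<close>.\<close>
  also have "v ?x = s i *\<^sub>R (\<tau> powr (- a) *\<^sub>R inversion a y - \<tau> *\<^sub>R y)"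
    using n unfolding v_eq[OF d] zs u_def z0 by (simp add: inversion_eq_self)
  finally show "\<Phi> ?x = c i + b i *\<^sub>R \<Phi> y"
    using x1 by (simp add: \<Phi>_def inversion_eq_self b_def \<kappa>_def algebra_simps)
  have "DW ?x = V ?x + q *\<^sub>R DW y"
    unfolding DW_def using ser_step[where Z=V and B="\<lambda>_. q", OF V_eq_0 d, unfolded zx, OF _ m] by simp
  also have "V ?x = q *\<^sub>R inversion_grad a y - mat 1"
    using n unfolding V_eq[OF d] zs U_def z0 by (simp add: inversion_grad_def)
  finally show "D\<Phi> ?x = q *\<^sub>R D\<Phi> y"
    using x1 by (simp add: D\<Phi>_def inversion_grad_def[of a ?x] algebra_simps)
qed

text \<open>The boundary spheres form a null set, so the strict inequality required by the affine
  identities costs nothing.\<close>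

lemma AE_packed: "AE x in lborel. norm x < 1 \<longrightarrow> (\<exists>i y. x = c i + \<kappa> i *\<^sub>R y \<and> norm y < 1 / \<tau>)"
proof -
  have "AE x in lebesgue. x \<notin> ball 0 1 - (\<Union>i. cball (c i) (s i))"
    using full by (intro AE_not_in) (simp add: negligible_iff_null_sets)
  then have 1: "AE x in lborel. x \<notin> ball 0 1 - (\<Union>i. cball (c i) (s i))"
    by (simp add: AE_completion_iff)
  have "AE x in lborel. \<forall>i. dist x (c i) \<noteq> s i"
    unfolding AE_all_countable using AE_dist_neq[OF s_pos] by blast
  with 1 show ?thesis
  proof eventually_elim
    case (elim x)
    show ?case
    proof
      assume "norm x < 1"
      then obtain i where i: "dist x (c i) \<le> s i" using elim(1) by (auto simp: dist_commute)
      then have "dist x (c i) < s i" using elim(2) by (simp add: order_less_le)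
      then have "norm (zoom (c i) (\<kappa> i) x) < 1 / \<tau>"
        using s_pos[of i] \<tau>_pos by (simp add: norm_zoom \<kappa>_pos) (simp add: \<kappa>_def field_simps)
      then show "\<exists>i y. x = c i + \<kappa> i *\<^sub>R y \<and> norm y < 1 / \<tau>"
        using \<kappa>_pos[of i] by (intro exI[of _ i] exI[of _ "zoom (c i) (\<kappa> i) x"]) simp
    qed
  qed
qed

text \<open>Induction on the generation: outside the unit ball the gradient is explicit, and off
  \<open>E (Suc k)\<close> it is \<open>q\<close> times the gradient at a point off
  \<open>E k\<close>. The exceptional sets are countably many rescaled null sets.\<close>

lemma AE_qr_matrix_D\<Phi>: "AE x in lborel. qr_matrix a (D\<Phi> x)"
proof -
  have *: "AE x in lborel. x \<notin> E k \<longrightarrow> qr_matrix a (D\<Phi> x)" for k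
  proof (induction k)
    case 0
    show ?case by (intro AE_I2) (auto simp: D\<Phi>_def DW_eq_0 qr_matrix_inversion_grad)
  next
    case (Suc k)
    have "AE x in lborel. \<forall>i. zoom (c i) (\<kappa> i) x \<notin> E k \<longrightarrow> qr_matrix a (D\<Phi> (zoom (c i) (\<kappa> i) x))"
      unfolding AE_all_countable using AE_zoom[OF \<kappa>_pos Suc] by blast
    with AE_packed show ?case
    proof eventually_elim
      case (elim x)
      show ?case
      proof (cases "norm x < 1")
        case True
        show ?thesis
        proof
          assume x: "x \<notin> E (Suc k)"
          obtain i y where y: "x = c i + \<kappa> i *\<^sub>R y" "norm y < 1 / \<tau>" using elim True by blast
          have z: "zoom (c i) (\<kappa> i) x = y" using \<kappa>_pos[of i] by (simp add: y)
          have "y \<notin> E k" using x z by auto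
          then have "D\<Phi> x = q *\<^sub>R D\<Phi> y" "qr_matrix a (D\<Phi> y)"
            using D\<Phi>_affine[OF y(2)] elim(2)[rule_format, of i] z by (auto simp: y(1))
          then show "qr_matrix a (D\<Phi> x)" using qr_matrix_scaleR q_pos by simp
        qed
      qed (simp add: D\<Phi>_def DW_eq_0 qr_matrix_inversion_grad)
    qed
  qed
  have "AE x in lborel. \<forall>k. x \<notin> E k \<longrightarrow> qr_matrix a (D\<Phi> x)"
    unfolding AE_all_countable using * by blast
  with AE_not_E show ?thesis by eventually_elim blast
qed

text \<open>The step inequality formally bounds the integral by a constant plus
  \<open>Q * \<tau> ^ n\<close> times itself. Since the integral might be infinite, the bound is
  first proved by induction for the truncations off \<open>E k\<close>, then passed on by monotone
  convergence.\<close>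

lemma nn_integral_ball_finite:
  fixes h :: "real^'n \<Rightarrow> ennreal"
  assumes h [measurable]: "h \<in> borel_measurable borel"
    and A: "0 \<le> A" and Q: "0 \<le> Q" "Q * \<tau> ^ CARD('n) < 1"
    and out: "\<And>y. 1 \<le> norm y \<Longrightarrow> h y \<le> ennreal A"
    and step: "\<And>i y m. norm y < 1 / \<tau> \<Longrightarrow> y \<notin> E m \<Longrightarrow> h (c i + \<kappa> i *\<^sub>R y) \<le> ennreal A + ennreal Q * h y"
  shows "(\<integral>\<^sup>+x. h x * indicator (ball 0 1) x \<partial>lborel) < \<infinity>"
proof -
  define g where "g k x = h x * indicator (ball 0 1 - E k) x" for k x
  have [measurable]: "ball (0::real^'n) 1 \<in> sets borel" by auto
  have g [measurable]: "g k \<in> borel_measurable borel" for k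
    unfolding g_def by (intro borel_measurable_times_ennreal h borel_measurable_indicator) auto
  \<comment> \<open>Covers both cases of one step: \<open>A\<close> alone inside, and
    \<open>A + Q * A\<close> when \<open>y\<close> lies in the shell
    \<open>1 \<le> norm y < 1 / \<tau>\<close>, where \<open>h y \<le> A\<close>.\<close>
  define M where "M = A + Q * A"
  have M0: "M \<ge> 0" using A Q by (simp add: M_def)
  define vB where "vB = measure lborel (ball (0::real^'n) 1)"
  have vB: "emeasure lborel (ball (0::real^'n) 1) = ennreal vB"
    unfolding vB_def using emeasure_bounded_finite[of "ball (0::real^'n) 1"]
    by (intro emeasure_eq_ennreal_measure) auto
  have vB0: "vB \<ge> 0" by (simp add: vB_def)
  define t where "t = Q * \<tau> ^ CARD('n)"
  have t: "0 \<le> t" "t < 1" using Q \<tau>_pos by (auto simp: t_def)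
  \<comment> \<open>The fixed point of \<open>L = M * vB + t * L\<close>, which the induction
    therefore preserves.\<close>
  define L where "L = M * vB / (1 - t)"
  have L0: "L \<ge> 0" using M0 vB0 t by (simp add: L_def)
  have L: "M * vB + t * L = L" using t by (simp add: L_def field_simps)
  have bound: "(\<integral>\<^sup>+x. g k x \<partial>lborel) \<le> ennreal L" for k
  proof (induction k)
    case 0
    then show ?case by (simp add: g_def)
  next
    case (Suc k)
    have "AE x in lborel. g (Suc k) x \<le> ennreal M * indicator (ball 0 1) x + ennreal Q * (\<Sum>i. g k (zoom (c i) (\<kappa> i) x))"
      using AE_packed
    proof eventually_elim
      case (elim x)
      show ?case
      proof (cases "x \<in> ball 0 1 - E (Suc k)")
        case True
        then obtain i y where y: "x = c i + \<kappa> i *\<^sub>R y" "norm y < 1 / \<tau>" using elim by auto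
        have z: "zoom (c i) (\<kappa> i) x = y" using \<kappa>_pos[of i] by (simp add: y)
        have yE: "y \<notin> E k" using True z by auto
        have hx: "h x \<le> ennreal A + ennreal Q * h y" using step[OF y(2) yE] y(1) by simp
        show ?thesis
        proof (cases "norm y < 1")
          case False
          have "h x \<le> ennreal A + ennreal Q * ennreal A"
            using hx out[of y] False by (meson add_left_mono mult_left_mono not_le order_trans zero_le)
          also have "\<dots> = ennreal M" using A Q by (simp add: M_def ennreal_mult)
          finally show ?thesis using True by (simp add: g_def add_increasing2)
        next
          case ny: True
          have "h y = g k (zoom (c i) (\<kappa> i) x)" using ny yE z by (simp add: g_def)
          also have "\<dots> = (\<Sum>j\<in>{i}. g k (zoom (c j) (\<kappa> j) x))" by simp
          also have "\<dots> \<le> (\<Sum>i. g k (zoom (c i) (\<kappa> i) x))"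
            by (intro sum_le_suminf) auto
          finally have hy: "h y \<le> (\<Sum>i. g k (zoom (c i) (\<kappa> i) x))" .
          have "ennreal A \<le> ennreal M" using A Q by (intro ennreal_leI) (simp add: M_def)
          then have "h x \<le> ennreal M + ennreal Q * (\<Sum>i. g k (zoom (c i) (\<kappa> i) x))"
            using hy by (intro order_trans[OF hx] add_mono mult_left_mono) auto
          then show ?thesis using True by (simp add: g_def)
        qed
      qed (auto simp: g_def)
    qed
    then have "(\<integral>\<^sup>+x. g (Suc k) x \<partial>lborel) \<le> (\<integral>\<^sup>+x. ennreal M * indicator (ball 0 1) x + ennreal Q * (\<Sum>i. g k (zoom (c i) (\<kappa> i) x)) \<partial>lborel)"
      by (rule nn_integral_mono_AE)
    also have "\<dots> = ennreal M * ennreal vB + ennreal Q * (\<Sum>i. \<integral>\<^sup>+x. g k (zoom (c i) (\<kappa> i) x) \<partial>lborel)"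
      by (subst nn_integral_add) (simp_all add: nn_integral_cmult nn_integral_suminf nn_integral_cmult_indicator vB)
    also have "(\<Sum>i. \<integral>\<^sup>+x. g k (zoom (c i) (\<kappa> i) x) \<partial>lborel) = (\<Sum>i. ennreal (s i ^ CARD('n)) * (ennreal (\<tau> ^ CARD('n)) * (\<integral>\<^sup>+x. g k x \<partial>lborel)))"
    proof (intro suminf_cong)
      fix i
      show "(\<integral>\<^sup>+x. g k (zoom (c i) (\<kappa> i) x) \<partial>lborel) = ennreal (s i ^ CARD('n)) * (ennreal (\<tau> ^ CARD('n)) * (\<integral>\<^sup>+x. g k x \<partial>lborel))"
        using \<tau>_pos s_pos[of i] by (subst nn_integral_zoom[OF \<kappa>_pos]) (auto simp: \<kappa>_def power_mult_distrib ennreal_mult mult_ac)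
    qed
    also have "\<dots> = (\<Sum>i. ennreal (s i ^ CARD('n))) * (ennreal (\<tau> ^ CARD('n)) * (\<integral>\<^sup>+x. g k x \<partial>lborel))" by simp
    also have "ennreal M * ennreal vB + ennreal Q * \<dots> \<le> ennreal M * ennreal vB + ennreal Q * (1 * (ennreal (\<tau> ^ CARD('n)) * ennreal L))"
      using suminf_s_le Suc by (intro add_left_mono mult_left_mono mult_mono) auto
    also have "\<dots> = ennreal (M * vB + t * L)"
      using M0 vB0 Q \<tau>_pos L0 t by (simp add: t_def ennreal_mult mult.assoc)
    finally show ?case unfolding L .
  qed
  have "incseq g"
    unfolding incseq_Suc_iff le_fun_def
  proof (intro allI)
    fix k x show "g k x \<le> g (Suc k) x" using E_decseq[of k] by (auto simp: g_def indicator_def)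
  qed
  then have "(\<integral>\<^sup>+x. (SUP k. g k x) \<partial>lborel) = (SUP k. \<integral>\<^sup>+x. g k x \<partial>lborel)"
    by (intro nn_integral_monotone_convergence_SUP) auto
  also have "\<dots> \<le> ennreal L" by (intro SUP_least bound)
  finally have fin: "(\<integral>\<^sup>+x. (SUP k. g k x) \<partial>lborel) < \<infinity>"
    by (simp add: order_le_less_trans)
  have "(\<integral>\<^sup>+x. h x * indicator (ball 0 1) x \<partial>lborel) \<le> (\<integral>\<^sup>+x. (SUP k. g k x) \<partial>lborel)"
  proof (rule nn_integral_mono_AE)
    show "AE x in lborel. h x * indicator (ball 0 1) x \<le> (SUP k. g k x)"
      using AE_not_E
    proof eventually_elim
      case (elim x)
      then obtain k where "x \<notin> E k" by blast
      then have "h x * indicator (ball 0 1) x = g k x" by (auto simp: g_def indicator_def)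
      then show ?case using SUP_upper[of k UNIV "\<lambda>k. g k x"] by simp
    qed
  qed
  then show ?thesis using fin by (rule order_le_less_trans)
qed

end

text \<open>Smoothness is consulted only for the derivative lists \<open>[]\<close> and
  \<open>[j]\<close>; boundedness comes from compact support, and the partial derivatives vanish off
  \<open>C\<close> because its complement is open.\<close>

lemma test_fun_C1_along:
  fixes \<phi> :: "real^'n::finite \<Rightarrow> real"
  assumes "test_fun \<Omega> \<phi>"
  obtains C where "compact C" "C \<subseteq> \<Omega>" "\<And>x. x \<notin> C \<Longrightarrow> \<phi> x = 0"
    "\<And>x j. x \<notin> C \<Longrightarrow> partial_deriv j \<phi> x = 0"
    "\<And>j. C1_along (axis j 1) \<phi> (partial_deriv j \<phi>)"
proof -
  obtain C where C: "compact C" "C \<subseteq> \<Omega>" "\<And>x. x \<notin> C \<Longrightarrow> \<phi> x = 0" and sm: "smooth_fun \<phi>"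
    using assms by (auto simp: test_fun_def)
  have der: "((\<lambda>t. \<phi> (x + t *\<^sub>R axis j 1)) has_real_derivative partial_deriv j \<phi> x) (at 0)" for x j
    using sm[unfolded smooth_fun_def, rule_format, of "[]"]
    unfolding partial_deriv_def DERIV_deriv_iff_real_differentiable by simp
  have cont: "continuous_on UNIV \<phi>" "continuous_on UNIV (partial_deriv j \<phi>)" for j
    using sm[unfolded smooth_fun_def, rule_format, of "[]"] sm[unfolded smooth_fun_def, rule_format, of "[j]"] by auto
  have z: "partial_deriv j \<phi> x = 0" if "x \<notin> C" for x j
  proof -
    have op: "open (- C)" using C(1) by (simp add: compact_imp_closed open_Compl)
    have "open ((\<lambda>t::real. x + t *\<^sub>R axis j 1) -` (- C))"
      by (intro open_vimage op continuous_intros)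
    moreover have "0 \<in> (\<lambda>t::real. x + t *\<^sub>R axis j 1) -` (- C)" using that by simp
    ultimately have "((\<lambda>t. \<phi> (x + t *\<^sub>R axis j 1)) has_real_derivative 0) (at 0)"
      by (intro has_field_derivative_transform_within_open[OF DERIV_const[of 0]]) (auto simp: C(3))
    then show ?thesis using der DERIV_unique by blast
  qed
  have bd: "bounded (range f)" if "continuous_on UNIV f" "\<And>x. x \<notin> C \<Longrightarrow> f x = 0" for f :: "real^'n \<Rightarrow> real"
  proof -
    have "bounded (f ` C)"
      using C(1) that(1) by (intro compact_imp_bounded compact_continuous_image) (auto intro: continuous_on_subset)
    then have "bounded (insert 0 (f ` C))" by simp
    then show ?thesis by (rule bounded_subset) (use that(2) in auto)
  qed
  have "C1_along (axis j 1) \<phi> (partial_deriv j \<phi>)" for j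
    unfolding C1_along_def using cont der bd[OF cont(1) C(3)] bd[OF cont(2) z] by blast
  then show ?thesis using that C z by blast
qed

lemma powr_add_le:
  fixes x y :: real
  assumes "0 \<le> x" "0 \<le> y" "0 \<le> p"
  shows "(x + y) powr p \<le> 2 powr p * (x powr p + y powr p)"
proof -
  have "(x + y) powr p \<le> (2 * max x y) powr p" using assms by (intro powr_mono2) auto
  also have "\<dots> = 2 powr p * max x y powr p" using assms by (simp add: powr_mult)
  also have "\<dots> \<le> 2 powr p * (x powr p + y powr p)" by (intro mult_left_mono) (auto simp: max_def)
  finally show ?thesis .
qed

text \<open>Reduces local integrability on any open set to one integral over the unit ball, the
  function being bounded outside.\<close>

lemma Lp_loc_zoom:
  fixes g :: "real^'n::finite \<Rightarrow> 'b::euclidean_space"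
  assumes g [measurable]: "g \<in> borel_measurable borel" and R: "R > 0" and A: "0 \<le> A"
    and fin: "(\<integral>\<^sup>+x. ennreal (norm (g x) powr p) * indicator (ball 0 1) x \<partial>lborel) < \<infinity>"
    and out: "\<And>x. 1 \<le> norm x \<Longrightarrow> norm (g x) powr p \<le> A"
    and \<Omega>: "open \<Omega>"
  shows "Lp_loc p \<Omega> (\<lambda>x. g (zoom z R x))"
  unfolding Lp_loc_def
proof (intro conjI allI impI)
  have m: "(\<lambda>x. g (zoom z R x)) \<in> borel_measurable borel" by measurable
  have [measurable]: "ball (0::real^'n) 1 \<in> sets borel" by auto
  have "(\<lambda>x. g (zoom z R x)) \<in> borel_measurable lebesgue" using m by (intro measurable_completion) simp
  then show "(\<lambda>x. g (zoom z R x)) \<in> borel_measurable (lebesgue_on \<Omega>)" by (rule measurable_restrict_space1)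
  fix C assume C: "compact C \<and> C \<subseteq> \<Omega>"
  then have [measurable]: "C \<in> sets borel" by (simp add: borel_compact)
  have "(\<integral>\<^sup>+x. ennreal (norm (g (zoom z R x)) powr p) * indicator C x \<partial>lebesgue)
      = (\<integral>\<^sup>+x. ennreal (norm (g (zoom z R x)) powr p) * indicator C x \<partial>lborel)"
    by (rule nn_integral_completion)
  also have "\<dots> \<le> (\<integral>\<^sup>+x. (\<lambda>y. ennreal (norm (g y) powr p) * indicator (ball 0 1) y) (zoom z R x) + ennreal A * indicator C x \<partial>lborel)"
  proof (intro nn_integral_mono)
    fix x
    show "ennreal (norm (g (zoom z R x)) powr p) * indicator C x
        \<le> (\<lambda>y. ennreal (norm (g y) powr p) * indicator (ball 0 1) y) (zoom z R x) + ennreal A * indicator C x"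
      using out[of "zoom z R x"] by (cases "norm (zoom z R x) < 1") (auto simp: indicator_def ennreal_leI)
  qed
  also have "\<dots> = (\<integral>\<^sup>+x. (\<lambda>y. ennreal (norm (g y) powr p) * indicator (ball 0 1) y) (zoom z R x) \<partial>lborel) + (\<integral>\<^sup>+x. ennreal A * indicator C x \<partial>lborel)"
    by (rule nn_integral_add) measurable
  also have "\<dots> = ennreal (R ^ CARD('n)) * (\<integral>\<^sup>+x. ennreal (norm (g x) powr p) * indicator (ball 0 1) x \<partial>lborel) + ennreal A * emeasure lborel C"
    by (subst nn_integral_zoom[OF R]) (simp_all add: nn_integral_cmult_indicator)
  also have "\<dots> < \<infinity>"
    using fin emeasure_bounded_finite[OF compact_imp_bounded[OF conjunct1[OF C]]] by (simp add: ennreal_mult_less_top)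
  finally show "(\<integral>\<^sup>+x. ennreal (norm (g (zoom z R x)) powr p) * indicator C x \<partial>lebesgue) < \<infinity>" .
qed

section \<open>Integrability, weak gradient and distortion of the rescaled limit\<close>

context packing begin

lemma powr_norm_D\<Phi>_outside:
  assumes "1 \<le> norm y" "0 \<le> p"
  shows "norm (D\<Phi> y) powr p \<le> (real CARD('n) * real CARD('n) * (2 + a)) powr p"
  using assms norm_inversion_grad_le[of a y] a_pos by (intro powr_mono2) (auto simp: D\<Phi>_def DW_eq_0)

lemma powr_norm_\<Phi>_outside:
  assumes "1 \<le> norm y" "0 \<le> p"
  shows "norm (\<Phi> y) powr p \<le> 1"
  using assms norm_inversion_le[of a y] a_pos by (intro powr_le1) (auto simp: \<Phi>_def W_eq_0)

text \<open>Each step multiplies the gradient exactly by \<open>q\<close>, and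
  \<open>q powr p * \<tau> ^ n\<close> is the power of \<open>\<tau>\<close> with exponent
  \<open>n - p * (1 + a)\<close>, positive by hypothesis.\<close>

lemma Lp_D\<Phi>:
  assumes p: "0 < p" "p * (1 + a) < real CARD('n)"
  shows "(\<integral>\<^sup>+x. ennreal (norm (D\<Phi> x) powr p) * indicator (ball 0 1) x \<partial>lborel) < \<infinity>"
proof (rule nn_integral_ball_finite[where A="(real CARD('n) * real CARD('n) * (2 + a)) powr p" and Q="q powr p"])
  have "q powr p * \<tau> ^ CARD('n) = \<tau> powr ((- 1 - a) * p) * \<tau> powr real CARD('n)"
    using \<tau>_pos by (simp add: q_def powr_powr powr_realpow)
  also have "\<dots> = \<tau> powr ((- 1 - a) * p + real CARD('n))" by (rule powr_add[symmetric])
  also have "\<dots> < \<tau> powr 0"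
    using \<tau>_pos \<tau>_less p by (intro powr_less_mono') (auto simp: algebra_simps)
  finally show "q powr p * \<tau> ^ CARD('n) < 1" using \<tau>_pos by simp
  fix i m y assume y: "norm y < 1 / \<tau>" "y \<notin> E m"
  have "norm (D\<Phi> (c i + \<kappa> i *\<^sub>R y)) powr p = q powr p * norm (D\<Phi> y) powr p"
    using q_pos by (simp add: D\<Phi>_affine[OF y] powr_mult)
  then show "ennreal (norm (D\<Phi> (c i + \<kappa> i *\<^sub>R y)) powr p)
      \<le> ennreal ((real CARD('n) * real CARD('n) * (2 + a)) powr p) + ennreal (q powr p) * ennreal (norm (D\<Phi> y) powr p)"
    by (simp add: ennreal_mult add_increasing)
qed (use p powr_norm_D\<Phi>_outside in \<open>auto intro!: ennreal_leI\<close>)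

text \<open>For values, the added centre \<open>c i\<close> costs a factor \<open>2 powr p\<close>.
  The bound \<open>\<tau> \<le> 1 / 2\<close> pays for it: the contraction factor is
  \<open>(2 * \<tau>) powr p\<close> times the one of the gradient.\<close>

lemma Lp_\<Phi>:
  assumes p: "0 < p" "p * (1 + a) < real CARD('n)" and \<tau>2: "\<tau> \<le> 1 / 2"
  shows "(\<integral>\<^sup>+x. ennreal (norm (\<Phi> x) powr p) * indicator (ball 0 1) x \<partial>lborel) < \<infinity>"
proof (rule nn_integral_ball_finite[where A="2 powr p" and Q="2 powr p * (\<tau> powr (- a)) powr p"])
  have "2 powr p * (\<tau> powr (- a)) powr p * \<tau> ^ CARD('n) = 2 powr p * (\<tau> powr (- a * p) * \<tau> powr real CARD('n))"
    using \<tau>_pos by (simp add: powr_powr powr_realpow)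
  also have "\<tau> powr (- a * p) * \<tau> powr real CARD('n) = \<tau> powr (p + (real CARD('n) - p * (1 + a)))"
    unfolding powr_add[symmetric] by (simp add: algebra_simps)
  also have "2 powr p * \<dots> = (2 * \<tau>) powr p * \<tau> powr (real CARD('n) - p * (1 + a))"
    using \<tau>_pos by (simp add: powr_add powr_mult)
  also have "\<dots> \<le> 1 * \<tau> powr (real CARD('n) - p * (1 + a))"
    using \<tau>_pos \<tau>2 p by (intro mult_right_mono powr_le1) auto
  also have "\<dots> < \<tau> powr 0"
    unfolding mult_1 using \<tau>_pos \<tau>_less p by (intro powr_less_mono') auto
  finally show "2 powr p * (\<tau> powr (- a)) powr p * \<tau> ^ CARD('n) < 1" using \<tau>_pos by simp
  fix i m y assume y: "norm y < 1 / \<tau>" "y \<notin> E m"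
  have "norm (\<Phi> (c i + \<kappa> i *\<^sub>R y)) \<le> norm (c i) + b i * norm (\<Phi> y)"
    unfolding \<Phi>_affine[OF y] using b_pos[of i] by (intro order_trans[OF norm_triangle_ineq]) simp
  also have "\<dots> \<le> 1 + \<tau> powr (- a) * norm (\<Phi> y)"
    using norm_c_less[of i] s_le_1[of i] s_pos[of i]
    by (intro add_mono mult_right_mono) (auto simp: b_def mult_left_le_one_le)
  finally have "norm (\<Phi> (c i + \<kappa> i *\<^sub>R y)) powr p \<le> (1 + \<tau> powr (- a) * norm (\<Phi> y)) powr p"
    using p by (intro powr_mono2) auto
  also have "\<dots> \<le> 2 powr p * (1 powr p + (\<tau> powr (- a) * norm (\<Phi> y)) powr p)"
    using p by (intro powr_add_le) auto
  also have "\<dots> = 2 powr p + 2 powr p * (\<tau> powr (- a)) powr p * norm (\<Phi> y) powr p"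
    by (simp add: powr_mult algebra_simps)
  finally have "ennreal (norm (\<Phi> (c i + \<kappa> i *\<^sub>R y)) powr p) \<le> ennreal (2 powr p + 2 powr p * (\<tau> powr (- a)) powr p * norm (\<Phi> y) powr p)"
    by (rule ennreal_leI)
  also have "\<dots> = ennreal (2 powr p) + ennreal (2 powr p * (\<tau> powr (- a)) powr p) * ennreal (norm (\<Phi> y) powr p)"
    by (simp add: ennreal_mult)
  finally show "ennreal (norm (\<Phi> (c i + \<kappa> i *\<^sub>R y)) powr p) \<le> \<dots>" .
next
  fix y :: "real^'n" assume "1 \<le> norm y"
  then have "norm (\<Phi> y) powr p \<le> 1" using powr_norm_\<Phi>_outside p by simp
  also have "1 \<le> 2 powr p" using p by (simp add: ge_one_powr_ge_zero)
  finally show "ennreal (norm (\<Phi> y) powr p) \<le> ennreal (2 powr p)" by (rule ennreal_leI)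
qed auto

text \<open>Defined on the whole space, with \<open>ball z R\<close> in the role of the unit ball,
  so that one map serves every domain containing that ball.\<close>

definition "F z R x = \<Phi> (zoom z R x)"

definition "DF z R x = (1 / R) *\<^sub>R D\<Phi> (zoom z R x)"

lemma Lp_loc_F:
  assumes p: "0 < p" "p * (1 + a) < real CARD('n)" and \<tau>2: "\<tau> \<le> 1 / 2" and R: "0 < R" and "open \<Omega>"
  shows "Lp_loc p \<Omega> (F z R)" and "Lp_loc p \<Omega> (DF z R)"
proof -
  show "Lp_loc p \<Omega> (F z R)" unfolding F_def[abs_def]
    using p powr_norm_\<Phi>_outside by (intro Lp_loc_zoom[where A=1] R assms Lp_\<Phi>) auto
  show "Lp_loc p \<Omega> (DF z R)" unfolding DF_def[abs_def]
  proof (rule Lp_loc_zoom[where g="\<lambda>y. (1 / R) *\<^sub>R D\<Phi> y" and A="(1 / R) powr p * (real CARD('n) * real CARD('n) * (2 + a)) powr p"])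
    have eq: "norm ((1 / R) *\<^sub>R D\<Phi> y) powr p = (1 / R) powr p * norm (D\<Phi> y) powr p" for y
      using R by (simp add: powr_divide)
    have "(\<integral>\<^sup>+x. ennreal (norm ((1 / R) *\<^sub>R D\<Phi> x) powr p) * indicator (ball 0 1) x \<partial>lborel)
        = (\<integral>\<^sup>+x. ennreal ((1 / R) powr p) * (ennreal (norm (D\<Phi> x) powr p) * indicator (ball 0 1) x) \<partial>lborel)"
      unfolding eq by (intro nn_integral_cong) (simp add: ennreal_mult mult.assoc)
    also have "\<dots> = ennreal ((1 / R) powr p) * (\<integral>\<^sup>+x. ennreal (norm (D\<Phi> x) powr p) * indicator (ball 0 1) x \<partial>lborel)"
    proof (rule nn_integral_cmult)
      have [measurable]: "ball (0::real^'n) 1 \<in> sets borel" by auto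
      show "(\<lambda>x. ennreal (norm (D\<Phi> x) powr p) * indicator (ball 0 1) x) \<in> borel_measurable lborel" by measurable
    qed
    also have "\<dots> < \<infinity>" using Lp_D\<Phi>[OF p] by (simp add: ennreal_mult_less_top)
    finally show "(\<integral>\<^sup>+x. ennreal (norm ((1 / R) *\<^sub>R D\<Phi> x) powr p) * indicator (ball 0 1) x \<partial>lborel) < \<infinity>" .
    show "norm ((1 / R) *\<^sub>R D\<Phi> x) powr p \<le> (1 / R) powr p * (real CARD('n) * real CARD('n) * (2 + a)) powr p" if "1 \<le> norm x" for x
      unfolding eq using powr_norm_D\<Phi>_outside[OF that, of p] p by (intro mult_left_mono) auto
  qed (use R assms in auto)
qed

text \<open>Splits \<open>F\<close> into the rescaled \<open>W\<close>, which has a global weak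
  gradient, and the rescaled radial map, which is Lipschitz and gets its compact support from the
  test function.\<close>

lemma
  assumes C: "C1_along e \<phi> \<phi>'" and R: "0 < R"
    and S: "bounded S" "\<And>x. x \<notin> S \<Longrightarrow> \<phi> x = 0" "\<And>x. x \<notin> S \<Longrightarrow> \<phi>' x = 0"
  shows integrable_F: "integrable lborel (\<lambda>x. \<phi>' x *\<^sub>R F z R x)"
    and integrable_DF: "integrable lborel (\<lambda>x. \<phi> x *\<^sub>R (DF z R x *v e))"
    and by_parts_F: "(\<integral>x. \<phi>' x *\<^sub>R F z R x \<partial>lborel) = - (\<integral>x. \<phi> x *\<^sub>R (DF z R x *v e) \<partial>lborel)"
proof -
  define g where "g x = inversion a (zoom z R x)" for x :: "real^'n"
  define G where "G x = (1 / R) *\<^sub>R inversion_grad a (zoom z R x)" for x :: "real^'n"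
  define w where "w x = W (zoom z R x)" for x
  define Y where "Y x = (1 / R) *\<^sub>R DW (zoom z R x)" for x
  have [measurable]: "g \<in> borel_measurable borel" "G \<in> borel_measurable borel"
    unfolding g_def[abs_def] G_def[abs_def] by measurable
  have a0: "0 \<le> a" using a_pos by simp
  note mC [measurable] = C1_along_measurable[OF C]
  obtain B where B: "0 \<le> B" "\<And>x. \<bar>\<phi> x\<bar> \<le> B" "\<And>x. \<bar>\<phi>' x\<bar> \<le> B"
    using C1_along_bounds[OF C] by blast
  have wY: "wgrad w Y" using wgrad_zoom[OF wgrad_W R, of 1 z] by (simp add: w_def[abs_def] Y_def[abs_def])
  have bg: "norm (g x) \<le> 1" for x unfolding g_def by (rule norm_inversion_le[OF a0])
  have lip: "norm (g x - g y) \<le> (2 + a) / R * norm (x - y)" for x y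
  proof -
    have "norm (g x - g y) \<le> (2 + a) * norm (zoom z R x - zoom z R y)"
      unfolding g_def by (rule inversion_lipschitz[OF a0])
    also have "zoom z R x - zoom z R y = (1 / R) *\<^sub>R (x - y)" by (simp add: zoom_def algebra_simps)
    finally show ?thesis using R by simp
  qed
  have der: "AE x in lborel. ((\<lambda>t. g (x + t *\<^sub>R e)) has_vector_derivative (G x *v e)) (at 0)"
    using AE_dist_neq[OF R, of z]
  proof eventually_elim
    case (elim x)
    then have "norm (zoom z R x) \<noteq> 1" using R by (simp add: norm_zoom)
    then have 2: "(inversion a has_derivative (\<lambda>h. inversion_grad a (zoom z R x) *v h)) (at (zoom z R x))"
      by (rule inversion_has_derivative)
    have 3: "(zoom z R has_derivative (\<lambda>h. (1 / R) *\<^sub>R h)) (at x)"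
      unfolding zoom_def[abs_def] by (auto intro!: derivative_eq_intros)
    have "(g has_derivative (\<lambda>h. G x *v h)) (at x)"
      using has_derivative_compose[OF 3 2] unfolding g_def[abs_def] G_def
      by (simp add: matrix_vector_mult_scaleR scaleR_matrix_vector_assoc[symmetric])
    then show ?case by (rule has_vector_derivative_line)
  qed
  have parts: "(\<integral>x. \<phi>' x *\<^sub>R g x \<partial>lborel) = - (\<integral>x. \<phi> x *\<^sub>R (G x *v e) \<partial>lborel)"
    by (rule integration_by_parts_lipschitz[OF lip bg _ _ der C S(1)]) (auto simp: S)
  have i1: "integrable lborel (\<lambda>x. \<phi>' x *\<^sub>R g x)"
  proof (rule integrable_bounded_support[OF _ S(1), where B="B * 1"])
    show "norm (\<phi>' x *\<^sub>R g x) \<le> B * 1" for x unfolding norm_scaleR using B bg by (intro mult_mono) auto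
  qed (auto simp: S)
  have i2: "integrable lborel (\<lambda>x. \<phi> x *\<^sub>R G x)"
  proof (rule integrable_bounded_support[OF _ S(1), where B="B * (1 / R * (real CARD('n) * real CARD('n) * (2 + a)))"])
    show "norm (\<phi> x *\<^sub>R G x) \<le> B * (1 / R * (real CARD('n) * real CARD('n) * (2 + a)))" for x
    proof -
      have "norm (G x) \<le> 1 / R * (real CARD('n) * real CARD('n) * (2 + a))"
        unfolding G_def norm_scaleR using R norm_inversion_grad_le[OF a0] by (intro mult_mono) auto
      then show ?thesis unfolding norm_scaleR using B by (intro mult_mono) auto
    qed
  qed (auto simp: S)
  have i2': "integrable lborel (\<lambda>x. \<phi> x *\<^sub>R (G x *v e))"
    using integrable_matrix_vector[OF i2, of e] by (simp add: scaleR_matrix_vector_assoc)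
  have i3: "integrable lborel (\<lambda>x. \<phi>' x *\<^sub>R w x)" "integrable lborel (\<lambda>x. \<phi> x *\<^sub>R (Y x *v e))"
    using wY unfolding wgrad_def
    by (auto intro!: integrable_scaleR_bounded[OF mC(2) B(3)] integrable_scaleR_bounded[OF mC(1) B(2)] integrable_matrix_vector)
  have F: "\<phi>' x *\<^sub>R F z R x = \<phi>' x *\<^sub>R w x + \<phi>' x *\<^sub>R g x" for x
    by (simp add: F_def \<Phi>_def w_def g_def scaleR_add_right)
  have D: "\<phi> x *\<^sub>R (DF z R x *v e) = \<phi> x *\<^sub>R (Y x *v e) + \<phi> x *\<^sub>R (G x *v e)" for x
    by (simp add: DF_def D\<Phi>_def Y_def G_def scaleR_add_right matrix_vector_mult_add_rdistrib)
  show "integrable lborel (\<lambda>x. \<phi>' x *\<^sub>R F z R x)" unfolding F using i1 i3 by simp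
  show "integrable lborel (\<lambda>x. \<phi> x *\<^sub>R (DF z R x *v e))" unfolding D using i2' i3 by simp
  show "(\<integral>x. \<phi>' x *\<^sub>R F z R x \<partial>lborel) = - (\<integral>x. \<phi> x *\<^sub>R (DF z R x *v e) \<partial>lborel)"
    unfolding F D using i1 i2' i3 parts wY C by (simp add: wgrad_def)
qed

lemma F_measurable [measurable]: "F z R \<in> borel_measurable borel"
  and DF_measurable [measurable]: "DF z R \<in> borel_measurable borel"
  unfolding F_def[abs_def] DF_def[abs_def] by measurable

lemma weak_gradient_F:
  assumes \<tau>2: "\<tau> \<le> 1 / 2" and R: "0 < R" and \<Omega>: "open \<Omega>"
  shows "weak_gradient \<Omega> (F z R) (DF z R)"
  unfolding weak_gradient_def
proof (intro conjI allI impI)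
  show "Lp_loc 1 \<Omega> (F z R)" "Lp_loc 1 \<Omega> (DF z R)"
    using exponent by (intro Lp_loc_F \<tau>2 R \<Omega>; simp)+
  fix \<phi> :: "real^'n \<Rightarrow> real" and i j assume t: "test_fun \<Omega> \<phi>"
  obtain C where C: "compact C" "C \<subseteq> \<Omega>" "\<And>x. x \<notin> C \<Longrightarrow> \<phi> x = 0"
    "\<And>x j. x \<notin> C \<Longrightarrow> partial_deriv j \<phi> x = 0" "\<And>j. C1_along (axis j 1) \<phi> (partial_deriv j \<phi>)"
    using test_fun_C1_along[OF t] by blast
  note m [measurable] = C1_along_measurable[OF C(5)[of j]]
  note bp = integrable_F[OF C(5)[of j] R compact_imp_bounded[OF C(1)] C(3,4), of z]
    integrable_DF[OF C(5)[of j] R compact_imp_bounded[OF C(1)] C(3,4), of z]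
    by_parts_F[OF C(5)[of j] R compact_imp_bounded[OF C(1)] C(3,4), of z]
  \<comment> \<open>Testing in the direction of the j-th axis and taking the i-th component isolates
    a single entry of the gradient.\<close>
  have col: "(M *v axis j 1) $ i = M $ i $ j" for M :: "real^'n^'n"
    by (simp add: matrix_vector_mult_basis column_def)
  have "(LINT x:\<Omega>|lebesgue. F z R x $ i * partial_deriv j \<phi> x) = (\<integral>x. F z R x $ i * partial_deriv j \<phi> x \<partial>lebesgue)"
    unfolding set_lebesgue_integral_def using C(2,4)
    by (intro Bochner_Integration.integral_cong) (auto simp: indicator_def)
  also have "\<dots> = (\<integral>x. F z R x $ i * partial_deriv j \<phi> x \<partial>lborel)"
    by (rule integral_completion) measurable
  also have "\<dots> = (\<integral>x. (partial_deriv j \<phi> x *\<^sub>R F z R x) $ i \<partial>lborel)" by (simp add: mult.commute)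
  also have "\<dots> = (\<integral>x. partial_deriv j \<phi> x *\<^sub>R F z R x \<partial>lborel) $ i"
    by (rule integral_bounded_linear[OF bounded_linear_vec_nth bp(1)])
  also have "\<dots> = - ((\<integral>x. \<phi> x *\<^sub>R (DF z R x *v axis j 1) \<partial>lborel) $ i)"
    using arg_cong[OF bp(3), of "\<lambda>v. v $ i"] by simp
  also have "(\<integral>x. \<phi> x *\<^sub>R (DF z R x *v axis j 1) \<partial>lborel) $ i = (\<integral>x. (\<phi> x *\<^sub>R (DF z R x *v axis j 1)) $ i \<partial>lborel)"
    by (rule integral_bounded_linear[OF bounded_linear_vec_nth bp(2), symmetric])
  also have "\<dots> = (\<integral>x. DF z R x $ i $ j * \<phi> x \<partial>lborel)" by (simp add: col mult.commute)
  also have "\<dots> = (\<integral>x. DF z R x $ i $ j * \<phi> x \<partial>lebesgue)"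
  proof (rule integral_completion[symmetric])
    have "(\<lambda>M. M $ i $ j) \<in> borel_measurable (borel :: (real^'n^'n) measure)"
      by (intro borel_measurable_continuous_onI continuous_intros)
    from measurable_compose[OF DF_measurable this] have "(\<lambda>x. DF z R x $ i $ j) \<in> borel_measurable borel" .
    then show "(\<lambda>x. DF z R x $ i $ j * \<phi> x) \<in> borel_measurable lborel" by measurable
  qed
  also have "\<dots> = (LINT x:\<Omega>|lebesgue. DF z R x $ i $ j * \<phi> x)"
    unfolding set_lebesgue_integral_def using C(2,3)
    by (intro Bochner_Integration.integral_cong) (auto simp: indicator_def)
  finally show "(LINT x:\<Omega>|lebesgue. F z R x $ i * partial_deriv j \<phi> x) = - (LINT x:\<Omega>|lebesgue. DF z R x $ i $ j * \<phi> x)" .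
qed

text \<open>The radial map reverses orientation, so the alternative with nonpositive Jacobian is the
  one that holds.\<close>

lemma weakly_qr_F:
  assumes \<tau>2: "\<tau> \<le> 1 / 2" and R: "0 < R" and \<Omega>: "open \<Omega>" and K: "a \<le> K" "1 \<le> K" "1 \<le> K * a"
  shows "weakly_qr K \<Omega> (F z R)"
proof -
  have "AE x in lborel. qr_matrix a (DF z R x)"
    using AE_zoom[OF R AE_qr_matrix_D\<Phi>, of z]
    by eventually_elim (use R in \<open>simp add: DF_def qr_matrix_scaleR\<close>)
  then have ae: "AE x in lebesgue. qr_matrix a (DF z R x)" by (rule AE_completion)
  have "AE x in lebesgue. x \<in> \<Omega> \<longrightarrow> det (DF z R x) \<le> 0"
    using ae by eventually_elim (use det_qr_matrix a_pos in auto)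
  moreover have "AE x in lebesgue. x \<in> \<Omega> \<longrightarrow>
        (SUP \<xi>\<in>sphere 0 1. norm (DF z R x *v \<xi>)) \<le> K * (INF \<xi>\<in>sphere 0 1. norm (DF z R x *v \<xi>))"
    using ae by eventually_elim (use distortion_qr_matrix a_pos K in auto)
  ultimately show ?thesis
    unfolding weakly_qr_def using weak_gradient_F[OF \<tau>2 R \<Omega>] K(2) by blast
qed

lemma sobolev_loc_F:
  assumes \<tau>2: "\<tau> \<le> 1 / 2" and R: "0 < R" and \<Omega>: "open \<Omega>" and p: "0 < p" "p * (1 + a) < real CARD('n)"
  shows "sobolev_loc p \<Omega> (F z R)"
  unfolding sobolev_loc_def using weak_gradient_F[OF \<tau>2 R \<Omega>] Lp_loc_F[OF p \<tau>2 R \<Omega>] by blast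

text \<open>Following the address of \<open>x\<close> for k generations composes k affine
  identities: lengths shrink by \<open>\<tau> * r\<close> and values grow by
  \<open>r * \<tau> powr (- a)\<close> each time. Points \<open>y\<close> with
  \<open>norm y > 1\<close> lie off \<open>E 0\<close>, hence their images lie off
  \<open>E k\<close>; the bound \<open>1 / \<tau>\<close> on the images keeps the next identity
  applicable.\<close>

lemma self_similar_point:
  assumes X: "\<And>x. x \<in> X \<Longrightarrow> \<exists>i x'. x' \<in> X \<and> s i = r \<and> x = c i + (\<tau> * r) *\<^sub>R x'"
    and B: "1 < r * \<tau> powr (- a)" and "x \<in> X"
  shows "\<exists>d e x'. x' \<in> X \<and> x = d + (\<tau> * r) ^ k *\<^sub>R x' \<and>
      norm e \<le> ((r * \<tau> powr (- a)) ^ k - 1) / (r * \<tau> powr (- a) - 1) \<and>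
      (\<forall>y. 1 < norm y \<and> norm y < 1 / \<tau> \<longrightarrow> d + (\<tau> * r) ^ k *\<^sub>R y \<notin> E k \<and> norm (d + (\<tau> * r) ^ k *\<^sub>R y) < 1 / \<tau> \<and>
         \<Phi> (d + (\<tau> * r) ^ k *\<^sub>R y) = e + (r * \<tau> powr (- a)) ^ k *\<^sub>R \<Phi> y)"
  using \<open>x \<in> X\<close>
proof (induction k arbitrary: x)
  case 0
  show ?case by (rule exI[of _ 0], rule exI[of _ 0], rule exI[of _ x]) (use 0 in auto)
next
  case (Suc k)
  define B0 where "B0 = r * \<tau> powr (- a)"
  have B0: "1 < B0" using B by (simp add: B0_def)
  obtain i x1 where x1: "x1 \<in> X" "s i = r" "x = c i + (\<tau> * r) *\<^sub>R x1" using X[OF Suc.prems] by blast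
  have k: "\<kappa> i = \<tau> * r" "b i = B0" using x1(2) by (simp_all add: \<kappa>_def b_def B0_def)
  obtain d e x' where d: "x' \<in> X" "x1 = d + (\<tau> * r) ^ k *\<^sub>R x'" "norm e \<le> (B0 ^ k - 1) / (B0 - 1)"
    and y: "\<And>y. 1 < norm y \<Longrightarrow> norm y < 1 / \<tau> \<Longrightarrow> d + (\<tau> * r) ^ k *\<^sub>R y \<notin> E k \<and> norm (d + (\<tau> * r) ^ k *\<^sub>R y) < 1 / \<tau> \<and>
         \<Phi> (d + (\<tau> * r) ^ k *\<^sub>R y) = e + B0 ^ k *\<^sub>R \<Phi> y"
    using Suc.IH[OF x1(1)] unfolding B0_def by blast
  define d' where "d' = c i + (\<tau> * r) *\<^sub>R d"
  have d': "d' + (\<tau> * r) ^ Suc k *\<^sub>R y = c i + \<kappa> i *\<^sub>R (d + (\<tau> * r) ^ k *\<^sub>R y)" for y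
    by (simp add: d'_def k algebra_simps)
  show ?case unfolding B0_def[symmetric]
  proof (rule exI[of _ d'], rule exI[of _ "c i + B0 *\<^sub>R e"], rule exI[of _ x'], intro conjI allI impI)
    show "x' \<in> X" by fact
    show "x = d' + (\<tau> * r) ^ Suc k *\<^sub>R x'" unfolding d' using x1(3) d(2) k by simp
    \<comment> \<open>Geometric sum: the translation gains a centre of norm below 1 and is
      multiplied by \<open>B0\<close> in each generation.\<close>
    have "norm (c i + B0 *\<^sub>R e) \<le> 1 + B0 * ((B0 ^ k - 1) / (B0 - 1))"
    proof (rule order_trans[OF norm_triangle_ineq], rule add_mono)
      show "norm (B0 *\<^sub>R e) \<le> B0 * ((B0 ^ k - 1) / (B0 - 1))"
        unfolding norm_scaleR using d(3) B0 by (intro mult_mono) auto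
    qed (use norm_c_less[of i] in simp)
    also have "\<dots> = (B0 ^ Suc k - 1) / (B0 - 1)" using B0 by (simp add: field_simps)
    finally show "norm (c i + B0 *\<^sub>R e) \<le> (B0 ^ Suc k - 1) / (B0 - 1)" .
    fix w :: "real^'n" assume w: "1 < norm w \<and> norm w < 1 / \<tau>"
    let ?z = "d + (\<tau> * r) ^ k *\<^sub>R w"
    have z: "?z \<notin> E k" "norm ?z < 1 / \<tau>" "\<Phi> ?z = e + B0 ^ k *\<^sub>R \<Phi> w" using y w by auto
    have "1 < 1 / \<tau>" using \<tau>_pos \<tau>_less by simp
    then show "norm (d' + (\<tau> * r) ^ Suc k *\<^sub>R w) < 1 / \<tau>"
      unfolding d' using affine_in_ball[OF z(2), of i] by linarith
    have "zoom (c i) (\<kappa> i) (c i + \<kappa> i *\<^sub>R ?z) = ?z" using \<kappa>_pos[of i] by simp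
    then show "d' + (\<tau> * r) ^ Suc k *\<^sub>R w \<notin> E (Suc k)"
      unfolding d' using affine_dist[OF z(2), of i] z(1) by (intro not_in_E_Suc[of _ i]) auto
    show "\<Phi> (d' + (\<tau> * r) ^ Suc k *\<^sub>R w) = c i + B0 *\<^sub>R e + B0 ^ Suc k *\<^sub>R \<Phi> w"
      using \<Phi>_affine[OF z(2,1), of i] unfolding d' z(3) k(2) by (simp add: scaleR_add_right)
  qed
qed

text \<open>At generation k the map is a translation by \<open>e\<close> plus \<open>B0 ^ k\<close>
  times the radial map on a shell filling at least half of the ball. The shell lies within radius 3,
  at most \<open>1 / \<tau>\<close>, so the radial part has norm at least
  \<open>3 powr (- a)\<close>.\<close>

lemma average_F_ge:
  assumes X: "\<And>x. x \<in> X \<Longrightarrow> \<exists>i x'. x' \<in> X \<and> s i = r \<and> x = c i + (\<tau> * r) *\<^sub>R x'" "X \<subseteq> ball 0 1"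
    and B: "1 + 2 * 3 powr a \<le> r * \<tau> powr (- a)" and \<tau>3: "\<tau> \<le> 1 / 3" and x: "x \<in> X" and R: "0 < R" and r: "0 < r"
  shows "ennreal ((r * \<tau> powr (- a)) ^ k * (3 powr (- a) / 4))
    \<le> (\<integral>\<^sup>+ y. ennreal (norm (F z R y)) * indicator (ball (z + R *\<^sub>R x) (2 * R * (\<tau> * r) ^ k)) y \<partial>lebesgue)
      / emeasure lebesgue (ball (z + R *\<^sub>R x) (2 * R * (\<tau> * r) ^ k))"
proof -
  define B0 where "B0 = r * \<tau> powr (- a)"
  define \<beta> where "\<beta> = 3 powr (- a) / (2::real)"
  have p3: "3 powr (- a) = 1 / (3::real) powr a" by (simp add: powr_minus divide_inverse)
  have B1: "B0 - 1 \<ge> 2 * 3 powr a" "B0 > 1"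
  proof -
    have "0 < (3::real) powr a" by simp
    then show "B0 - 1 \<ge> 2 * 3 powr a" "B0 > 1" using B unfolding B0_def by linarith+
  qed
  obtain d e x' where d: "x' \<in> X" "x = d + (\<tau> * r) ^ k *\<^sub>R x'" "norm e \<le> (B0 ^ k - 1) / (B0 - 1)"
    and y: "\<And>y. 1 < norm y \<Longrightarrow> norm y < 1 / \<tau> \<Longrightarrow> \<Phi> (d + (\<tau> * r) ^ k *\<^sub>R y) = e + B0 ^ k *\<^sub>R \<Phi> y"
    using self_similar_point[OF X(1) _ x, where k=k] B1(2) unfolding B0_def by blast
  define t where "t = R * (\<tau> * r) ^ k"
  define z' where "z' = z + R *\<^sub>R d"
  have t0: "t > 0" using R r \<tau>_pos by (simp add: t_def)
  \<comment> \<open>Removing the unit ball stays clear of the next generations; what remains is the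
    explicit region of \<open>\<Phi>\<close>. As \<open>norm x' < 1\<close>, the removed ball is
    contained in \<open>ball x' 2\<close>.\<close>
  define Q where "Q = ball x' 2 - cball 0 1"
  have [measurable]: "Q \<in> sets borel" by (simp add: Q_def)
  have x'1: "norm x' < 1" using d(1) X(2) by auto
  \<comment> \<open>The threshold \<open>1 + 2 * 3 powr a\<close> on \<open>B0\<close> is made for
    this: the translation eats at most half of the radial part.\<close>
  have e: "norm e \<le> B0 ^ k * \<beta>"
  proof -
    have "norm e \<le> B0 ^ k / (B0 - 1)"
      using d(3) B1 by (smt (verit) divide_right_mono)
    also have "\<dots> \<le> B0 ^ k / (2 * 3 powr a)"
      using B1 by (intro divide_left_mono) auto
    also have "\<dots> = B0 ^ k * \<beta>" by (simp add: \<beta>_def p3)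
    finally show ?thesis .
  qed
  have big: "B0 ^ k * \<beta> \<le> norm (F z R w)" if "zoom z' t w \<in> Q" for w
  proof -
    define yy where "yy = zoom z' t w"
    have n1: "1 < norm yy" using that by (simp add: yy_def[symmetric] Q_def)
    have "norm yy \<le> norm (yy - x') + norm x'" using norm_triangle_sub by (metis add.commute)
    also have "\<dots> < 2 + 1"
      using that x'1 by (intro add_strict_mono) (auto simp: yy_def[symmetric] Q_def dist_norm norm_minus_commute)
    finally have n3: "norm yy < 3" by simp
    have "3 \<le> 1 / \<tau>" using \<tau>3 \<tau>_pos by (simp add: field_simps)
    then have n4: "norm yy < 1 / \<tau>" using n3 by linarith
    have "w = z' + t *\<^sub>R yy" using t0 by (simp add: yy_def)
    then have "zoom z R w = d + (\<tau> * r) ^ k *\<^sub>R yy"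
      using R by (simp add: zoom_def z'_def t_def algebra_simps)
    then have Fw: "F z R w = e + B0 ^ k *\<^sub>R \<Phi> yy" unfolding F_def using y[OF n1 n4] by simp
    have "norm (\<Phi> yy) = norm yy powr (- 1 - a) * norm yy powr 1"
      using n1 by (simp add: \<Phi>_def W_eq_0 inversion_eq_outside)
    also have "\<dots> = norm yy powr (- a)" by (subst powr_add[symmetric]) simp
    also have "\<dots> \<ge> 3 powr (- a)" using n1 n3 a_pos by (intro powr_mono2') auto
    finally have "2 * \<beta> \<le> norm (\<Phi> yy)" by (simp add: \<beta>_def)
    then have "B0 ^ k * (2 * \<beta>) \<le> B0 ^ k * norm (\<Phi> yy)" using B1 by (intro mult_left_mono) auto
    also have "\<dots> = norm (B0 ^ k *\<^sub>R \<Phi> yy)" using B1 by simp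
    also have "\<dots> \<le> norm (F z R w) + norm e" unfolding Fw
      by (metis add.commute add_diff_cancel_left' norm_triangle_sub norm_triangle_ineq4)
    finally show ?thesis using e by simp
  qed
  let ?B = "ball (z + R *\<^sub>R x) (2 * R * (\<tau> * r) ^ k)"
  have inB: "w \<in> ?B" if "zoom z' t w \<in> Q" for w
  proof -
    have w: "w = z' + t *\<^sub>R zoom z' t w" using t0 by simp
    have c: "z + R *\<^sub>R x = z' + t *\<^sub>R x'" by (simp add: d(2) z'_def t_def algebra_simps)
    have "dist (z' + t *\<^sub>R x') (z' + t *\<^sub>R y) = t * dist x' y" for y
      using t0 by (simp add: dist_norm flip: scaleR_diff_right)
    then have "dist (z' + t *\<^sub>R x') (z' + t *\<^sub>R zoom z' t w) = t * dist x' (zoom z' t w)" .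
    also have "\<dots> < t * 2" using that t0 by (intro mult_strict_left_mono) (auto simp: Q_def)
    finally have "dist (z + R *\<^sub>R x) w < t * 2" unfolding c w[symmetric] .
    then show ?thesis by (simp add: t_def mult_ac)
  qed
  define V1 where "V1 = unit_ball_vol (real CARD('n))"
  have V1: "V1 > 0" by (simp add: V1_def)
  have emQ: "emeasure lborel Q = ennreal (V1 * 2 ^ CARD('n) - V1)"
  proof -
    have "cball 0 1 \<subseteq> ball x' 2"
    proof
      fix y :: "real^'n" assume "y \<in> cball 0 1"
      then show "y \<in> ball x' 2" using x'1 norm_triangle_ineq4[of x' y] by (simp add: dist_norm)
    qed
    then have "emeasure lborel Q = emeasure lborel (ball x' 2) - emeasure lborel (cball (0::real^'n) 1)"
      unfolding Q_def by (intro emeasure_Diff) (auto simp: emeasure_cball)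
    also have "\<dots> = ennreal (V1 * 2 ^ CARD('n) - V1)"
      using V1 by (simp add: emeasure_cball emeasure_ball V1_def ennreal_minus)
    finally show ?thesis .
  qed
  \<comment> \<open>The removed unit ball is at most half of the ball of radius 2. With the half
    lost to \<open>e\<close> this explains the factor 1/4.\<close>
  have "2 * 1 \<le> (2::real) ^ CARD('n)" using self_le_power[of "2::real" "CARD('n)"] by simp
  then have half: "V1 * 2 ^ CARD('n) / 2 \<le> V1 * 2 ^ CARD('n) - V1" using V1 by (simp add: field_simps)
  have emB: "emeasure lebesgue ?B = ennreal (V1 * (2 * t) ^ CARD('n))"
    using t0 R r \<tau>_pos by (simp add: emeasure_ball V1_def t_def mult.assoc)
  have \<beta>0: "0 \<le> \<beta>" "0 \<le> B0 ^ k" using B1 by (auto simp: \<beta>_def)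
  have [measurable]: "?B \<in> sets borel" by auto
  have "ennreal (B0 ^ k * (3 powr (- a) / 4)) * emeasure lebesgue ?B
      = ennreal (B0 ^ k * \<beta> * (t ^ CARD('n) * (V1 * 2 ^ CARD('n) / 2)))"
    unfolding emB using \<beta>0 V1 t0
    by (subst ennreal_mult[symmetric]) (auto simp: \<beta>_def power_mult_distrib mult_ac)
  also have "\<dots> \<le> ennreal (B0 ^ k * \<beta> * (t ^ CARD('n) * (V1 * 2 ^ CARD('n) - V1)))"
    using half \<beta>0 t0 by (intro ennreal_leI mult_left_mono) auto
  also have "\<dots> = ennreal (B0 ^ k * \<beta>) * (ennreal (t ^ CARD('n)) * emeasure lborel Q)"
    unfolding emQ using \<beta>0 t0 half V1 by (simp add: ennreal_mult)
  also have "\<dots> = (\<integral>\<^sup>+w. ennreal (B0 ^ k * \<beta>) * indicator Q (zoom z' t w) \<partial>lborel)"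
  proof -
    have "(\<integral>\<^sup>+w. ennreal (B0 ^ k * \<beta>) * indicator Q w \<partial>lborel) = ennreal (B0 ^ k * \<beta>) * emeasure lborel Q"
      by (rule nn_integral_cmult_indicator) simp
    moreover have "(\<integral>\<^sup>+w. ennreal (B0 ^ k * \<beta>) * indicator Q (zoom z' t w) \<partial>lborel)
        = ennreal (t ^ CARD('n)) * (\<integral>\<^sup>+w. ennreal (B0 ^ k * \<beta>) * indicator Q w \<partial>lborel)"
      using nn_integral_zoom[OF t0, of "\<lambda>y. ennreal (B0 ^ k * \<beta>) * indicator Q y" z'] by simp
    ultimately show ?thesis by (simp only: mult.left_commute)
  qed
  also have "\<dots> \<le> (\<integral>\<^sup>+ y. ennreal (norm (F z R y)) * indicator ?B y \<partial>lborel)"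
  proof (rule nn_integral_mono)
    fix w show "ennreal (B0 ^ k * \<beta>) * indicator Q (zoom z' t w) \<le> ennreal (norm (F z R w)) * indicator ?B w"
      using big[of w] inB[of w] by (cases "zoom z' t w \<in> Q") (auto intro!: ennreal_leI)
  qed
  also have "\<dots> = (\<integral>\<^sup>+ y. ennreal (norm (F z R y)) * indicator ?B y \<partial>lebesgue)"
    by (rule nn_integral_completion[symmetric])
  finally have main: "ennreal (B0 ^ k * (3 powr (- a) / 4)) * emeasure lebesgue ?B
      \<le> (\<integral>\<^sup>+ y. ennreal (norm (F z R y)) * indicator ?B y \<partial>lebesgue)" .
  have "emeasure lebesgue ?B \<noteq> 0" "emeasure lebesgue ?B \<noteq> top" unfolding emB using V1 t0 by auto
  then have "ennreal (B0 ^ k * (3 powr (- a) / 4)) = ennreal (B0 ^ k * (3 powr (- a) / 4)) * emeasure lebesgue ?B / emeasure lebesgue ?B"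
    by (simp add: ennreal_mult_divide_eq)
  also have "\<dots> \<le> (\<integral>\<^sup>+ y. ennreal (norm (F z R y)) * indicator ?B y \<partial>lebesgue) / emeasure lebesgue ?B"
    by (rule divide_right_mono_ennreal[OF main])
  finally show ?thesis unfolding B0_def .
qed

text \<open>Along the radii \<open>2 * R * (\<tau> * r) ^ k\<close>, which tend to 0, the averages
  exceed a fixed multiple of \<open>B0 ^ k\<close>; this suffices because the singular set is
  defined by an upper limit.\<close>

lemma singular_set_F:
  assumes X: "\<And>x. x \<in> X \<Longrightarrow> \<exists>i x'. x' \<in> X \<and> s i = r \<and> x = c i + (\<tau> * r) *\<^sub>R x'" "X \<subseteq> ball 0 1"
    and B: "1 + 2 * 3 powr a \<le> r * \<tau> powr (- a)" and \<tau>3: "\<tau> \<le> 1 / 3" and R: "0 < R" and r: "0 < r" "r < 1"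
    and \<Omega>: "ball z R \<subseteq> \<Omega>" and x: "x \<in> X"
  shows "z + R *\<^sub>R x \<in> singular_set \<Omega> (F z R)"
proof -
  define g where "g \<delta> = (\<integral>\<^sup>+ y. ennreal (norm (F z R y)) * indicator (ball (z + R *\<^sub>R x) \<delta>) y \<partial>lebesgue)
      / emeasure lebesgue (ball (z + R *\<^sub>R x) \<delta>)" for \<delta>
  define B0 where "B0 = r * \<tau> powr (- a)"
  have "0 < (3::real) powr a" by simp
  then have B1: "B0 > 1" using B unfolding B0_def by linarith
  have "norm x < 1" using x X(2) by auto
  then have in\<Omega>: "z + R *\<^sub>R x \<in> \<Omega>" using \<Omega> R by (intro subsetD[OF \<Omega>]) (simp add: dist_norm)
  have "\<not> Limsup (at_right 0) g < ennreal C" for C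
  proof
    assume "Limsup (at_right 0) g < ennreal C"
    then have "eventually (\<lambda>\<delta>. g \<delta> < ennreal C) (at_right 0)" by (rule Limsup_lessD)
    then obtain \<eta> where \<eta>: "\<eta> > 0" "\<And>\<delta>. 0 < \<delta> \<Longrightarrow> \<delta> < \<eta> \<Longrightarrow> g \<delta> < ennreal C"
      unfolding eventually_at_right_field by blast
    have k1: "0 < \<tau> * r" "\<tau> * r < 1" using r \<tau>_pos \<tau>_less by (auto intro: mult_strict_mono[of \<tau> 1 r 1, simplified])
    have "(\<lambda>k. 2 * R * (\<tau> * r) ^ k) \<longlonglongrightarrow> 2 * R * 0"
      using k1 by (intro tendsto_mult_left LIMSEQ_power_zero) auto
    then have e1: "eventually (\<lambda>k. 2 * R * (\<tau> * r) ^ k < \<eta>) sequentially"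
      using \<eta>(1) by (intro order_tendstoD(2)) auto
    obtain k0 where k0: "C / (3 powr (- a) / 4) < B0 ^ k0" using real_arch_pow[OF B1] by blast
    have e2: "eventually (\<lambda>k. C / (3 powr (- a) / 4) \<le> B0 ^ k) sequentially"
    proof (rule eventually_sequentiallyI[of k0])
      fix k assume "k0 \<le> k"
      then have "B0 ^ k0 \<le> B0 ^ k" using B1 by (intro power_increasing) auto
      then show "C / (3 powr (- a) / 4) \<le> B0 ^ k" using k0 by linarith
    qed
    obtain k where k: "2 * R * (\<tau> * r) ^ k < \<eta>" "C / (3 powr (- a) / 4) \<le> B0 ^ k"
      using eventually_happens[OF eventually_conj[OF e1 e2]] by auto
    have "C \<le> B0 ^ k * (3 powr (- a) / 4)" using k(2) by (simp add: field_simps)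
    then have "ennreal C \<le> ennreal (B0 ^ k * (3 powr (- a) / 4))" by (rule ennreal_leI)
    also have "\<dots> \<le> g (2 * R * (\<tau> * r) ^ k)"
      unfolding g_def B0_def using average_F_ge[OF X B \<tau>3 x R r(1)] .
    also have "\<dots> < ennreal C" using k(1) k1 R by (intro \<eta>(2)) auto
    finally show False by simp
  qed
  then have "ennreal C \<le> Limsup (at_right 0) g" for C by (simp add: not_less)
  then have "Limsup (at_right 0) g = \<infinity>"
    by (cases "Limsup (at_right 0) g") (auto simp: ennreal_le_iff2, metis less_add_one not_le add_increasing2 zero_le_one)
  then show ?thesis using in\<Omega> unfolding singular_set_def g_def[abs_def] by simp
qed

end

section \<open>Grid packings and Cantor sets\<close>

text \<open>Vitali's covering theorem fills the open set left by the finitely many prescribed balls.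
  The sequence indexing needs infinitely many balls, which must be shown.\<close>

lemma finite_packing_extends:
  fixes P :: "((real^'n::finite) \<times> real) set"
  assumes P: "finite P" "\<And>x \<rho>. (x, \<rho>) \<in> P \<Longrightarrow> 0 < \<rho> \<and> cball x \<rho> \<subseteq> ball 0 1"
    and disj: "pairwise (\<lambda>i j. disjnt (cball (fst i) (snd i)) (cball (fst j) (snd j))) P"
  obtains c :: "nat \<Rightarrow> real^'n" and s :: "nat \<Rightarrow> real"
  where "\<And>i. 0 < s i" "\<And>i. cball (c i) (s i) \<subseteq> ball 0 1"
    "\<And>i j. i \<noteq> j \<Longrightarrow> cball (c i) (s i) \<inter> cball (c j) (s j) = {}"
    "negligible (ball 0 1 - (\<Union>i. cball (c i) (s i)))"
    "\<And>x \<rho>. (x, \<rho>) \<in> P \<Longrightarrow> \<exists>i. c i = x \<and> s i = \<rho>"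
proof -
  define b where "b = (\<lambda>i::(real^'n) \<times> real. cball (fst i) (snd i))"
  define U where "U = ball 0 1 - (\<Union>i\<in>P. b i)"
  have "closed (\<Union>i\<in>P. b i)" using P(1) by (intro closed_UN) (auto simp: b_def)
  then have U: "open U" unfolding U_def by (intro open_Diff) auto
  define K where "K = {i. 0 < snd i \<and> b i \<subseteq> U}"
  obtain C where C: "countable C" "C \<subseteq> K" "pairwise (\<lambda>i j. disjnt (b i) (b j)) C"
    "negligible (U - (\<Union>i\<in>C. b i))"
    unfolding b_def
  proof (rule Vitali_covering_theorem_cballs[of K snd U fst])
    show "0 < snd i" if "i \<in> K" for i using that by (simp add: K_def)
    fix x d assume x: "x \<in> U" and d: "(0::real) < d"
    obtain e where e: "e > 0" "cball x e \<subseteq> U" using U x open_contains_cball by blast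
    have "cball x (min e (d / 2)) \<subseteq> U" using e(2) by auto
    then show "\<exists>i. i \<in> K \<and> x \<in> cball (fst i) (snd i) \<and> snd i < d"
      using e(1) d by (intro exI[of _ "(x, min e (d / 2))"]) (auto simp: K_def b_def)
  qed (use that in auto)
  define D where "D = P \<union> C"
  have cD: "countable D" using P(1) C(1) by (simp add: D_def countable_finite)
  have PU: "b i \<inter> U = {}" if "i \<in> P" for i using that by (auto simp: U_def)
  have pos: "0 < snd i" "b i \<subseteq> ball 0 1" if "i \<in> D" for i
    using that P(2)[of "fst i" "snd i"] C(2) by (auto simp: D_def K_def U_def b_def)
  have dD: "b i \<inter> b j = {}" if ij: "i \<in> D" "j \<in> D" "i \<noteq> j" for i j
  proof -
    consider "i \<in> P" "j \<in> P" | "i \<in> C" "j \<in> C" | "i \<in> P" "j \<in> C" | "i \<in> C" "j \<in> P"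
      using ij by (auto simp: D_def)
    then show ?thesis
    proof cases
      case 1
      then show ?thesis using disj ij(3) by (auto simp: pairwise_def disjnt_def b_def)
    next
      case 2
      then show ?thesis using C(3) ij(3) by (auto simp: pairwise_def disjnt_def)
    next
      case 3
      then show ?thesis using PU[of i] C(2) by (auto simp: K_def)
    next
      case 4
      then show ?thesis using PU[of j] C(2) by (auto simp: K_def)
    qed
  qed
  have neg: "negligible (ball 0 1 - (\<Union>i\<in>D. b i))"
    by (rule negligible_subset[OF C(4)]) (auto simp: U_def D_def)
  \<comment> \<open>Finitely many closed balls leave an open remainder; being negligible it is
    empty, which would make the open unit ball closed.\<close>
  have "infinite D"
  proof
    assume fin: "finite D"
    have cl: "closed (\<Union>i\<in>D. b i)" using fin by (intro closed_UN) (auto simp: b_def)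
    then have "open (ball 0 1 - (\<Union>i\<in>D. b i))" by (intro open_Diff) auto
    then have "ball 0 1 - (\<Union>i\<in>D. b i) = {}" using neg open_not_negligible by blast
    then have "(\<Union>i\<in>D. b i) = ball 0 1" using pos(2) by blast
    then have "closed (ball (0::real^'n) 1)" using cl by simp
    then have "ball (0::real^'n) 1 = {} \<or> ball (0::real^'n) 1 = UNIV" using clopen[of "ball (0::real^'n) 1"] by simp
    moreover have "bounded (ball (0::real^'n) 1)" by simp
    ultimately show False using not_bounded_UNIV by fastforce
  qed
  then have bij: "bij_betw (from_nat_into D) UNIV D" using cD by (intro bij_betw_from_nat_into)
  define g where "g = from_nat_into D"
  have gD: "g i \<in> D" for i using bij by (auto simp: g_def bij_betw_def)
  have inj: "g i \<noteq> g j" if "i \<noteq> j" for i j using bij that by (auto simp: g_def bij_betw_def inj_on_def)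
  have img: "range g = D" using bij by (auto simp: g_def bij_betw_def)
  show ?thesis
  proof (rule that[of "\<lambda>i. snd (g i)" "\<lambda>i. fst (g i)"])
    show "0 < snd (g i)" for i using pos(1)[OF gD] .
    show "cball (fst (g i)) (snd (g i)) \<subseteq> ball 0 1" for i using pos(2)[OF gD] by (simp add: b_def)
    show "cball (fst (g i)) (snd (g i)) \<inter> cball (fst (g j)) (snd (g j)) = {}" if "i \<noteq> j" for i j
      using dD[OF gD gD inj[OF that]] by (simp add: b_def)
    have "(\<Union>i. cball (fst (g i)) (snd (g i))) = (\<Union>i\<in>D. b i)" unfolding img[symmetric] b_def by auto
    then show "negligible (ball 0 1 - (\<Union>i. cball (fst (g i)) (snd (g i))))" using neg by simp
    fix x \<rho> assume "(x, \<rho>) \<in> P"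
    then have "(x, \<rho>) \<in> range g" unfolding img by (simp add: D_def)
    then show "\<exists>i. fst (g i) = x \<and> snd (g i) = \<rho>" by (metis fst_conv imageE snd_conv)
  qed
qed

text \<open>The spacing \<open>\<delta>\<close> keeps the l1 norm of grid points at most
  \<open>n * \<delta> * m = 1 / 2\<close>, so balls of radius \<open>\<delta> / 4\<close> fit into
  the unit ball; two of them reach only half of the spacing and stay disjoint.\<close>

lemma grid_packing:
  fixes m :: nat
  assumes m: "0 < m"
  defines "\<delta> \<equiv> 1 / (2 * real CARD('n::finite) * real m)"
  obtains c :: "nat \<Rightarrow> real^'n" and s :: "nat \<Rightarrow> real"
  where "\<And>i. 0 < s i" "\<And>i. cball (c i) (s i) \<subseteq> ball 0 1"
    "\<And>i j. i \<noteq> j \<Longrightarrow> cball (c i) (s i) \<inter> cball (c j) (s j) = {}"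
    "negligible (ball 0 1 - (\<Union>i. cball (c i) (s i)))"
    "\<And>d :: 'n \<Rightarrow> int. (\<And>l. 0 \<le> d l \<and> d l < int m) \<Longrightarrow> \<exists>i. c i = (\<chi> l. \<delta> * of_int (d l)) \<and> s i = \<delta> / 4"
proof -
  have \<delta>: "\<delta> > 0" using m by (simp add: \<delta>_def)
  have \<delta>m: "real CARD('n) * (\<delta> * real m) = 1 / 2" using m by (simp add: \<delta>_def)
  have \<delta>1: "\<delta> \<le> 1 / 2"
  proof -
    have "1 \<le> real CARD('n) * real m" using m by (simp add: Suc_leI flip: of_nat_mult)
    then show ?thesis by (simp add: \<delta>_def field_simps)
  qed
  define g where "g d = (\<chi> l. \<delta> * of_int (d l)) " for d :: "'n \<Rightarrow> int"
  define Q where "Q = PiE (UNIV::'n set) (\<lambda>_. {0..<int m})"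
  define P where "P = (\<lambda>d. (g d, \<delta> / 4)) ` Q"
  have fP: "finite P" unfolding P_def Q_def by (intro finite_imageI finite_PiE) auto
  have in_ball: "cball (g d) (\<delta> / 4) \<subseteq> ball 0 1" if "d \<in> Q" for d
  proof
    fix x assume x: "x \<in> cball (g d) (\<delta> / 4)"
    have "norm (g d) \<le> (\<Sum>l\<in>UNIV. \<bar>g d $ l\<bar>)" by (rule norm_le_l1_cart)
    also have "\<dots> \<le> (\<Sum>l\<in>(UNIV::'n set). \<delta> * real m)"
    proof (rule sum_mono)
      fix l
      have "0 \<le> d l" "d l < int m" using that by (auto simp: Q_def PiE_iff)
      then have "0 \<le> real_of_int (d l)" "real_of_int (d l) \<le> real m" by linarith+
      then show "\<bar>g d $ l\<bar> \<le> \<delta> * real m" using \<delta> by (simp add: g_def abs_mult)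
    qed
    also have "\<dots> = 1 / 2" using \<delta>m by simp
    finally have "norm (g d) \<le> 1 / 2" .
    moreover have "norm x \<le> norm (g d) + dist (g d) x"
      by (metis add.commute dist_commute dist_norm norm_triangle_sub)
    ultimately show "x \<in> ball 0 1" using x \<delta>1 by simp
  qed
  have disj: "pairwise (\<lambda>i j. disjnt (cball (fst i) (snd i)) (cball (fst j) (snd j))) P"
    unfolding pairwise_def
  proof (intro ballI impI)
    fix u w assume "u \<in> P" "w \<in> P" and ne: "u \<noteq> w"
    then obtain d d' where d: "u = (g d, \<delta> / 4)" "w = (g d', \<delta> / 4)" by (auto simp: P_def)
    then have "d \<noteq> d'" using ne by auto
    then obtain l where "d l \<noteq> d' l" by blast
    then have "1 \<le> \<bar>d l - d' l\<bar>" by linarith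
    then have "1 \<le> \<bar>real_of_int (d l) - real_of_int (d' l)\<bar>" by linarith
    then have "\<delta> * 1 \<le> \<delta> * \<bar>real_of_int (d l) - real_of_int (d' l)\<bar>" using \<delta> by (intro mult_left_mono) auto
    also have "\<dots> = \<bar>(g d - g d') $ l\<bar>" using \<delta> by (simp add: g_def abs_mult flip: right_diff_distrib)
    also have "\<dots> \<le> dist (g d) (g d')" unfolding dist_norm by (rule component_le_norm_cart)
    finally have far: "\<delta> \<le> dist (g d) (g d')" by simp
    have False if "x \<in> cball (g d) (\<delta> / 4)" "x \<in> cball (g d') (\<delta> / 4)" for x
      using that far \<delta> dist_triangle2[of "g d" "g d'" x] by simp
    then show "disjnt (cball (fst u) (snd u)) (cball (fst w) (snd w))"
      unfolding d disjnt_def by auto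
  qed
  have PP: "0 < \<rho> \<and> cball x \<rho> \<subseteq> ball 0 1" if "(x, \<rho>) \<in> P" for x \<rho>
    using that in_ball \<delta> by (auto simp: P_def)
  show ?thesis
  proof (rule finite_packing_extends[OF fP PP disj])
    fix c :: "nat \<Rightarrow> real^'n" and s :: "nat \<Rightarrow> real"
    assume *: "\<And>i. 0 < s i" "\<And>i. cball (c i) (s i) \<subseteq> ball 0 1"
      "\<And>i j. i \<noteq> j \<Longrightarrow> cball (c i) (s i) \<inter> cball (c j) (s j) = {}"
      "negligible (ball 0 1 - (\<Union>i. cball (c i) (s i)))"
      "\<And>x \<rho>. (x, \<rho>) \<in> P \<Longrightarrow> \<exists>i. c i = x \<and> s i = \<rho>"
    show thesis
    proof (rule that[OF *(1-4)])
      fix d :: "'n \<Rightarrow> int" assume "\<And>l. 0 \<le> d l \<and> d l < int m"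
      then have "d \<in> Q" by (auto simp: Q_def)
      then have "(g d, \<delta> / 4) \<in> P" by (auto simp: P_def)
      then show "\<exists>i. c i = (\<chi> l. \<delta> * of_int (d l)) \<and> s i = \<delta> / 4" using *(5) unfolding g_def by blast
    qed
  qed
qed

section \<open>Cantor sets parametrised by base m digits\<close>

definition cantor_shift :: "nat \<Rightarrow> real \<Rightarrow> real" where
  "cantor_shift m t = frac (real m * t)"

text \<open>The floor is the k-th base m digit of \<open>t\<close>; it selects a grid coordinate at
  scale \<open>\<kappa> ^ k\<close>. The range for \<open>t\<close> in [0,1) is the one-dimensional
  factor of the Cantor set, and \<open>t\<close> is recovered from its digits.\<close>

definition cantor_fun :: "real \<Rightarrow> real \<Rightarrow> nat \<Rightarrow> real \<Rightarrow> real" where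
  "cantor_fun \<delta> \<kappa> m t = (\<Sum>k. \<kappa> ^ k * (\<delta> * of_int \<lfloor>real m * (cantor_shift m ^^ k) t\<rfloor>))"

text \<open>\<open>\<kappa> \<le> 1 / 4\<close> gives the factor 4/3 in the range, and
  \<open>\<kappa> * m \<le> 3 / 8\<close> then limits the variation of all later digits to
  \<open>4/3 * 3/8 * \<delta>\<close>, half of the grid spacing.\<close>

locale cantor =
  fixes \<delta> \<kappa> :: real and m :: nat
  assumes \<delta>: "0 < \<delta>" and \<kappa>: "0 < \<kappa>" "\<kappa> \<le> 1 / 4" and m: "0 < m" and \<kappa>m: "\<kappa> * real m \<le> 3 / 8"
begin

lemma shift_range: "0 \<le> cantor_shift m t" "cantor_shift m t < 1"
  by (simp_all add: cantor_shift_def frac_lt_1)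

lemma iter_shift_range:
  assumes "0 \<le> t" "t < 1"
  shows "0 \<le> (cantor_shift m ^^ k) t \<and> (cantor_shift m ^^ k) t < 1"
  using assms shift_range by (cases k) auto

lemma digit_range:
  assumes "0 \<le> t" "t < 1"
  shows "0 \<le> \<lfloor>real m * t\<rfloor>" "\<lfloor>real m * t\<rfloor> < int m"
  using assms m by (auto simp: floor_less_iff)

lemma term_bound:
  assumes t: "0 \<le> t" "t < 1"
  shows "0 \<le> \<kappa> ^ k * (\<delta> * of_int \<lfloor>real m * (cantor_shift m ^^ k) t\<rfloor>)"
    "\<kappa> ^ k * (\<delta> * of_int \<lfloor>real m * (cantor_shift m ^^ k) t\<rfloor>) \<le> \<kappa> ^ k * (\<delta> * real m)"
proof -
  note d = digit_range[of "(cantor_shift m ^^ k) t"] iter_shift_range[OF t, of k]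
  have "0 \<le> real_of_int \<lfloor>real m * (cantor_shift m ^^ k) t\<rfloor>" "real_of_int \<lfloor>real m * (cantor_shift m ^^ k) t\<rfloor> \<le> real m"
    using d by linarith+
  then show "0 \<le> \<kappa> ^ k * (\<delta> * of_int \<lfloor>real m * (cantor_shift m ^^ k) t\<rfloor>)"
    "\<kappa> ^ k * (\<delta> * of_int \<lfloor>real m * (cantor_shift m ^^ k) t\<rfloor>) \<le> \<kappa> ^ k * (\<delta> * real m)"
    using \<delta> \<kappa> by (auto intro!: mult_left_mono)
qed

lemma cantor_summable:
  assumes t: "0 \<le> t" "t < 1"
  shows "summable (\<lambda>k. \<kappa> ^ k * (\<delta> * of_int \<lfloor>real m * (cantor_shift m ^^ k) t\<rfloor>))"
proof (rule summable_comparison_test')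
  show "summable (\<lambda>k. \<kappa> ^ k * (\<delta> * real m))" using \<kappa> by (intro summable_mult2 summable_geometric) auto
  show "norm (\<kappa> ^ k * (\<delta> * of_int \<lfloor>real m * (cantor_shift m ^^ k) t\<rfloor>)) \<le> \<kappa> ^ k * (\<delta> * real m)" if "0 \<le> k" for k
    using term_bound[OF t, of k] unfolding real_norm_def by (subst abs_of_nonneg) auto
qed

lemma cantor_fun_unfold:
  assumes t: "0 \<le> t" "t < 1"
  shows "cantor_fun \<delta> \<kappa> m t = \<delta> * of_int \<lfloor>real m * t\<rfloor> + \<kappa> * cantor_fun \<delta> \<kappa> m (cantor_shift m t)"
proof -
  have "cantor_fun \<delta> \<kappa> m t = (\<Sum>k. \<kappa> ^ Suc k * (\<delta> * of_int \<lfloor>real m * (cantor_shift m ^^ Suc k) t\<rfloor>)) + \<delta> * of_int \<lfloor>real m * t\<rfloor>"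
    unfolding cantor_fun_def by (subst suminf_split_head[OF cantor_summable[OF t]]) simp
  also have "(\<Sum>k. \<kappa> ^ Suc k * (\<delta> * of_int \<lfloor>real m * (cantor_shift m ^^ Suc k) t\<rfloor>))
      = (\<Sum>k. \<kappa> * (\<kappa> ^ k * (\<delta> * of_int \<lfloor>real m * (cantor_shift m ^^ k) (cantor_shift m t)\<rfloor>)))"
    unfolding funpow_Suc_right by (simp add: mult.assoc)
  also have "\<dots> = \<kappa> * cantor_fun \<delta> \<kappa> m (cantor_shift m t)"
    unfolding cantor_fun_def by (rule suminf_mult[OF cantor_summable[OF shift_range]])
  finally show ?thesis by simp
qed

lemma cantor_fun_range:
  assumes t: "0 \<le> t" "t < 1"
  shows "0 \<le> cantor_fun \<delta> \<kappa> m t" "cantor_fun \<delta> \<kappa> m t \<le> 4 / 3 * (\<delta> * real m)"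
proof -
  show "0 \<le> cantor_fun \<delta> \<kappa> m t" unfolding cantor_fun_def
    by (intro suminf_nonneg cantor_summable t term_bound)
  have "cantor_fun \<delta> \<kappa> m t \<le> (\<Sum>k. \<kappa> ^ k * (\<delta> * real m))" unfolding cantor_fun_def
    using \<kappa> by (intro suminf_le term_bound t cantor_summable summable_mult2 summable_geometric) auto
  also have "\<dots> = 1 / (1 - \<kappa>) * (\<delta> * real m)"
    using \<kappa> by (subst suminf_mult2[symmetric]) (auto simp: suminf_geometric)
  also have "\<dots> \<le> 4 / 3 * (\<delta> * real m)"
    using \<kappa> \<delta> by (intro mult_right_mono) (auto simp: field_simps)
  finally show "cantor_fun \<delta> \<kappa> m t \<le> 4 / 3 * (\<delta> * real m)" .
qed

text \<open>If the first digits differ, the spacing \<open>\<delta>\<close> beats the tail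
  \<open>\<delta> / 2\<close>. If they agree, the shift enlarges the distance of the parameters by
  \<open>m\<close> and that of the images by \<open>1 / \<kappa>\<close>, and induction
  applies.\<close>

lemma cantor_fun_separated:
  assumes "0 \<le> t" "t < 1" "0 \<le> t'" "t' < 1" "1 / real m ^ k < \<bar>t - t'\<bar>"
  shows "\<kappa> ^ k * (\<delta> / 2) \<le> \<bar>cantor_fun \<delta> \<kappa> m t - cantor_fun \<delta> \<kappa> m t'\<bar>"
  using assms
proof (induction k arbitrary: t t')
  \<comment> \<open>Vacuous: two points of [0,1) are less than 1 apart.\<close>
  case 0
  then show ?case by auto
next
  case (Suc k)
  define j j' where "j = \<lfloor>real m * t\<rfloor>" and "j' = \<lfloor>real m * t'\<rfloor>"
  define y y' where "y = cantor_fun \<delta> \<kappa> m (cantor_shift m t)" and "y' = cantor_fun \<delta> \<kappa> m (cantor_shift m t')"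
  have x: "cantor_fun \<delta> \<kappa> m t = \<delta> * of_int j + \<kappa> * y" "cantor_fun \<delta> \<kappa> m t' = \<delta> * of_int j' + \<kappa> * y'"
    using cantor_fun_unfold Suc.prems by (auto simp: j_def j'_def y_def y'_def)
  show ?case
  proof (cases "j = j'")
    case True
    have fr: "cantor_shift m t - cantor_shift m t' = real m * (t - t')"
      using True by (simp add: cantor_shift_def frac_def j_def j'_def algebra_simps)
    have "1 / real m ^ k = real m * (1 / real m ^ Suc k)" using m by simp
    also have "\<dots> < real m * \<bar>t - t'\<bar>" using Suc.prems(5) m by (intro mult_strict_left_mono) auto
    also have "\<dots> = \<bar>cantor_shift m t - cantor_shift m t'\<bar>" unfolding fr by (simp add: abs_mult)
    finally have "\<kappa> ^ k * (\<delta> / 2) \<le> \<bar>y - y'\<bar>"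
      unfolding y_def y'_def by (intro Suc.IH shift_range)
    then have "\<kappa> * (\<kappa> ^ k * (\<delta> / 2)) \<le> \<kappa> * \<bar>y - y'\<bar>" using \<kappa> by (intro mult_left_mono) auto
    also have "\<dots> = \<bar>\<kappa> * (y - y')\<bar>" using \<kappa> by (simp add: abs_mult)
    finally show ?thesis using True by (simp add: x mult.assoc flip: right_diff_distrib)
  next
    case False
    then have "1 \<le> \<bar>j - j'\<bar>" by linarith
    then have "1 \<le> \<bar>real_of_int j - real_of_int j'\<bar>" by linarith
    then have "\<delta> * 1 \<le> \<delta> * \<bar>real_of_int j - real_of_int j'\<bar>" using \<delta> by (intro mult_left_mono) auto
    then have far: "\<delta> \<le> \<bar>\<delta> * real_of_int j - \<delta> * real_of_int j'\<bar>" using \<delta> by (simp add: abs_mult flip: right_diff_distrib)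
    have "\<bar>y - y'\<bar> \<le> 4 / 3 * (\<delta> * real m)"
      using cantor_fun_range[OF shift_range, of t] cantor_fun_range[OF shift_range, of t']
      unfolding y_def y'_def by linarith
    then have "\<kappa> * \<bar>y - y'\<bar> \<le> \<kappa> * (4 / 3 * (\<delta> * real m))" using \<kappa> by (intro mult_left_mono) auto
    also have "\<dots> = 4 / 3 * \<delta> * (\<kappa> * real m)" by simp
    also have "\<dots> \<le> 4 / 3 * \<delta> * (3 / 8)" using \<kappa>m \<delta> by (intro mult_left_mono) auto
    finally have "\<bar>\<kappa> * y - \<kappa> * y'\<bar> \<le> \<delta> / 2" using \<kappa> by (simp add: abs_mult flip: right_diff_distrib)
    then have "\<delta> / 2 \<le> \<bar>cantor_fun \<delta> \<kappa> m t - cantor_fun \<delta> \<kappa> m t'\<bar>" using far unfolding x by linarith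
    moreover have "\<kappa> ^ Suc k * (\<delta> / 2) \<le> 1 * (\<delta> / 2)"
      using \<kappa> \<delta> by (intro mult_right_mono power_le_one) auto
    ultimately show ?thesis by linarith
  qed
qed

text \<open>Take the least k with \<open>1 / m ^ k < \<bar>t - t'\<bar>\<close>. Minimality bounds
  the distance of the parameters by \<open>m\<close> times \<open>1 / m ^ k\<close>, hence by
  \<open>m * (\<kappa> ^ k) powr \<beta>\<close>, and separation bounds \<open>\<kappa> ^ k\<close>
  by the distance of the images.\<close>

lemma cantor_fun_Hoelder:
  assumes t: "0 \<le> t" "t < 1" "0 \<le> t'" "t' < 1"
    and \<beta>: "0 \<le> \<beta>" and m\<kappa>: "1 \<le> real m * \<kappa> powr \<beta>" and m2: "2 \<le> m"
  shows "\<bar>t - t'\<bar> \<le> real m * (2 / \<delta>) powr \<beta> * \<bar>cantor_fun \<delta> \<kappa> m t - cantor_fun \<delta> \<kappa> m t'\<bar> powr \<beta>"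
proof (cases "t = t'")
  case False
  define D where "D = \<bar>cantor_fun \<delta> \<kappa> m t - cantor_fun \<delta> \<kappa> m t'\<bar>"
  have "\<exists>k. 1 / real m ^ k < \<bar>t - t'\<bar>"
  proof -
    obtain k where "(1 / real m) ^ k < \<bar>t - t'\<bar>"
      using real_arch_pow_inv[of "\<bar>t - t'\<bar>" "1 / real m"] False m2 by auto
    then show ?thesis by (auto simp: power_one_over)
  qed
  then obtain k where k: "1 / real m ^ k < \<bar>t - t'\<bar>" and least: "\<And>j. j < k \<Longrightarrow> \<not> 1 / real m ^ j < \<bar>t - t'\<bar>"
    using exists_least_iff[of "\<lambda>k. 1 / real m ^ k < \<bar>t - t'\<bar>"] by blast
  have "\<bar>t - t'\<bar> < 1" using t by linarith
  then have "k \<noteq> 0" using k by (intro notI) simp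
  then obtain j where j: "k = Suc j" by (cases k) auto
  have "\<bar>t - t'\<bar> \<le> 1 / real m ^ j" using least[of j] by (simp add: j)
  also have "\<dots> = real m * (1 / real m) ^ k" using m by (simp add: j power_one_over)
  also have "\<dots> \<le> real m * (\<kappa> powr \<beta>) ^ k"
    using m\<kappa> m by (intro mult_left_mono power_mono) (auto simp: field_simps)
  also have "(\<kappa> powr \<beta>) ^ k = (\<kappa> ^ k) powr \<beta>"
    using \<kappa> by (simp add: powr_realpow[symmetric] powr_powr mult.commute)
  also have "\<dots> \<le> (2 / \<delta> * D) powr \<beta>"
  proof (rule powr_mono2)
    have "\<kappa> ^ k * (\<delta> / 2) \<le> D" unfolding D_def by (rule cantor_fun_separated[OF t k])
    then show "\<kappa> ^ k \<le> 2 / \<delta> * D" using \<delta> by (simp add: field_simps)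
  qed (use \<beta> \<kappa> in auto)
  also have "\<dots> = (2 / \<delta>) powr \<beta> * D powr \<beta>" using \<delta> by (subst powr_mult) (auto simp: D_def)
  finally show ?thesis using m by (simp add: D_def mult.assoc)
qed (use m in simp)

end

text \<open>Prescribing \<open>r * \<tau> powr (- a) = B0\<close> determines \<open>\<tau>\<close>.
  Then \<open>(\<tau> * r) powr \<beta>\<close> is a constant times
  \<open>m powr (- \<gamma>)\<close>, and \<open>\<gamma> < 1\<close> is the hypothesis
  \<open>\<beta> < a / (1 + a)\<close>, so a large \<open>m\<close> wins.\<close>

lemma cantor_parameters:
  fixes a \<beta> B0 :: real and n :: nat
  assumes a: "0 < a" and \<beta>: "0 < \<beta>" "\<beta> < a / (1 + a)" and B0: "1 \<le> B0" and n: "0 < n"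
  obtains m :: nat and \<tau> where "2 \<le> m" "0 < \<tau>" "\<tau> \<le> 1 / 3"
    "1 / (8 * real n * real m) * \<tau> powr (- a) = B0"
    "1 \<le> real m * (\<tau> * (1 / (8 * real n * real m))) powr \<beta>"
proof -
  define \<gamma> where "\<gamma> = \<beta> + \<beta> / a"
  have \<gamma>: "0 < \<gamma>" "\<gamma> < 1" using a \<beta> by (auto simp: \<gamma>_def field_simps add_pos_pos)
  define L where "L = (8 * real n) powr \<gamma> * B0 powr (\<beta> / a)"
  have L0: "L > 0" using n B0 by (simp add: L_def)
  \<comment> \<open>The entry \<open>3 powr a\<close> forces \<open>\<tau> \<le> 1 / 3\<close>; the
    last one gives \<open>L * m powr \<gamma> \<le> m\<close>, the final inequality.\<close>
  obtain m :: nat where m: "max 2 (max (3 powr a) (L powr (1 / (1 - \<gamma>)))) \<le> real m" using real_arch_simple by blast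
  define r where "r = 1 / (8 * real n * real m)"
  define \<tau> where "\<tau> = (r / B0) powr (1 / a)"
  have m2: "2 \<le> real m" "3 powr a \<le> real m" "L powr (1 / (1 - \<gamma>)) \<le> real m" using m by auto
  have r: "0 < r" "r \<le> 1 / real m" using m2 n by (auto simp: r_def field_simps)
  have \<tau>0: "0 < \<tau>" using r B0 by (simp add: \<tau>_def)
  have "\<tau> powr a = r / B0" using a r B0 by (simp add: \<tau>_def powr_powr)
  then have B: "r * \<tau> powr (- a) = B0" using r B0 by (simp add: powr_minus divide_inverse)
  have "r / B0 \<le> 1 / real m" using r B0 by (smt (verit) divide_le_eq_1 frac_le div_by_1)
  also have "\<dots> \<le> 1 / 3 powr a" using m2 by (intro divide_left_mono) auto
  also have "\<dots> = (1 / 3) powr a" by (simp add: powr_divide)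
  finally have "\<tau> \<le> ((1 / 3) powr a) powr (1 / a)" unfolding \<tau>_def using r B0 a by (intro powr_mono2) auto
  also have "\<dots> = 1 / 3" using a by (simp add: powr_powr)
  finally have \<tau>3: "\<tau> \<le> 1 / 3" .
  have "(\<tau> * r) powr \<beta> = (r powr (1 / a) / B0 powr (1 / a)) powr \<beta> * r powr \<beta>"
    using r B0 by (simp add: \<tau>_def powr_mult powr_divide)
  also have "\<dots> = r powr \<gamma> / B0 powr (\<beta> / a)"
    using r B0 by (simp add: \<gamma>_def powr_divide powr_powr powr_add mult.commute)
  also have "r powr \<gamma> = 1 / ((8 * real n) powr \<gamma> * real m powr \<gamma>)"
    unfolding r_def using n by (simp add: powr_divide powr_mult)
  finally have eq: "(\<tau> * r) powr \<beta> = 1 / (L * real m powr \<gamma>)" by (simp add: L_def)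
  have "L = (L powr (1 / (1 - \<gamma>))) powr (1 - \<gamma>)" using \<gamma> L0 by (simp add: powr_powr)
  also have "\<dots> \<le> real m powr (1 - \<gamma>)" using m2 \<gamma> by (intro powr_mono2) auto
  finally have "L * real m powr \<gamma> \<le> real m powr (1 - \<gamma>) * real m powr \<gamma>" by (intro mult_right_mono) auto
  also have "\<dots> = real m" using m2 by (simp flip: powr_add)
  finally have "1 \<le> real m * (\<tau> * r) powr \<beta>" unfolding eq using L0 m2 by (simp add: field_simps)
  then show ?thesis using that[of m \<tau>] m2 \<tau>0 \<tau>3 B unfolding r_def by simp
qed

text \<open>Everything in terms of the free exponent \<open>a\<close>: integrability needs
  \<open>p * (1 + a) < n\<close>, distortion needs \<open>K\<close> to dominate \<open>a\<close> and
  \<open>1 / a\<close>, and the Cantor set supplies the dimension.\<close>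

lemma singular_quasiregular_exists:
  fixes \<Omega> :: "(real^'n::finite) set"
  assumes \<Omega>: "open \<Omega>" "\<Omega> \<noteq> {}" "bounded \<Omega>"
    and a: "0 < a" and p: "1 \<le> p" "p * (1 + a) < real CARD('n)"
    and K: "a \<le> K" "1 \<le> K" "1 \<le> K * a"
    and \<epsilon>: "0 < \<epsilon>"
  shows "\<exists>f. sobolev_loc p \<Omega> f \<and> weakly_qr K \<Omega> f \<and>
    real CARD('n) * a / (1 + a) - \<epsilon> \<le> hausdorff_dim (singular_set \<Omega> f)"
proof -
  define n where "n = real CARD('n)"
  have n: "1 \<le> n" by (simp add: n_def Suc_leI)
  \<comment> \<open>The Hoelder exponent, dimension divided by n. The second entry only keeps it
    positive when \<open>\<epsilon>\<close> is large.\<close>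
  define \<beta> where "\<beta> = max (a / (1 + a) - \<epsilon> / n) (a / (1 + a) / 2)"
  have q: "0 < a / (1 + a)" using a by simp
  have \<beta>: "0 < \<beta>" "\<beta> < a / (1 + a)" 
  proof -
    have "0 < \<epsilon> / n" using n \<epsilon> by simp
    moreover have "0 < max (x - y) (x / 2) \<and> max (x - y) (x / 2) < x" if "0 < x" "0 < y" for x y :: real
      using that by auto
    ultimately show "0 < \<beta>" "\<beta> < a / (1 + a)" using q unfolding \<beta>_def by blast+
  qed
  \<comment> \<open>The growth factor required by \<open>average_F_ge\<close>.\<close>
  define B0 where "B0 = 1 + 2 * 3 powr a"
  have B0: "1 \<le> B0" by (simp add: B0_def)
  obtain m :: nat and \<tau> where m: "2 \<le> m" and \<tau>: "0 < \<tau>" "\<tau> \<le> 1 / 3"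
    and B: "1 / (8 * real CARD('n) * real m) * \<tau> powr (- a) = B0"
    and m\<kappa>: "1 \<le> real m * (\<tau> * (1 / (8 * real CARD('n) * real m))) powr \<beta>"
    using cantor_parameters[OF a \<beta> B0, of "CARD('n)"] by auto
  define \<delta> where "\<delta> = 1 / (2 * real CARD('n) * real m)"
  define r where "r = \<delta> / 4"
  define \<kappa> where "\<kappa> = \<tau> * r"
  have r_eq: "r = 1 / (8 * real CARD('n) * real m)" by (simp add: r_def \<delta>_def)
  have m0: "0 < m" using m by simp
  have nm: "1 \<le> real CARD('n) * real m" using m0 by (simp add: Suc_leI flip: of_nat_mult)
  have \<delta>: "0 < \<delta>" "\<delta> \<le> 1 / 2" using m0 nm by (auto simp: \<delta>_def field_simps)
  have \<delta>m: "n * (\<delta> * real m) = 1 / 2" using m0 by (simp add: \<delta>_def n_def)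
  obtain c :: "nat \<Rightarrow> real^'n" and s :: "nat \<Rightarrow> real"
    where cs: "\<And>i. 0 < s i" "\<And>i. cball (c i) (s i) \<subseteq> ball 0 1"
    "\<And>i j. i \<noteq> j \<Longrightarrow> cball (c i) (s i) \<inter> cball (c j) (s j) = {}"
    "negligible (ball 0 1 - (\<Union>i. cball (c i) (s i)))"
    and grid: "\<And>d :: 'n \<Rightarrow> int. (\<And>l. 0 \<le> d l \<and> d l < int m) \<Longrightarrow> \<exists>i. c i = (\<chi> l. \<delta> * of_int (d l)) \<and> s i = \<delta> / 4"
  proof (rule grid_packing[OF m0, where 'n='n, folded \<delta>_def])
    fix c :: "nat \<Rightarrow> real^'n" and s :: "nat \<Rightarrow> real"
    assume *: "\<And>i. 0 < s i" "\<And>i. cball (c i) (s i) \<subseteq> ball 0 1"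
      "\<And>i j. i \<noteq> j \<Longrightarrow> cball (c i) (s i) \<inter> cball (c j) (s j) = {}"
      "negligible (ball 0 1 - (\<Union>i. cball (c i) (s i)))"
      "\<And>d :: 'n \<Rightarrow> int. (\<And>l. 0 \<le> d l \<and> d l < int m) \<Longrightarrow> \<exists>i. c i = (\<chi> l. \<delta> * of_int (d l)) \<and> s i = \<delta> / 4"
    show thesis by (rule that[OF *])
  qed
  have "1 * (1 + a) \<le> p * (1 + a)" using p a by (intro mult_right_mono) auto
  then have ex: "1 + a < real CARD('n)" using p by simp
  interpret P: packing c s a \<tau>
    using cs a \<tau> ex by unfold_locales auto
  have \<kappa>0: "0 < \<kappa>" using \<tau> \<delta> by (simp add: \<kappa>_def r_def)
  have \<kappa>r: "\<kappa> \<le> 1 / 3 * (\<delta> / 4)" unfolding \<kappa>_def r_def using \<tau> \<delta> by (intro mult_right_mono) auto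
  have \<delta>m1: "\<delta> * real m \<le> 1 / 2"
  proof -
    have "1 * (\<delta> * real m) \<le> n * (\<delta> * real m)" using n \<delta> by (intro mult_right_mono) auto
    then show ?thesis using \<delta>m by simp
  qed
  interpret C: cantor \<delta> \<kappa> m
  proof
    have "\<kappa> * real m \<le> 1 / 3 * (\<delta> / 4) * real m" using \<kappa>r by (intro mult_right_mono) auto
    then show "\<kappa> * real m \<le> 3 / 8" using \<delta>m1 by simp
  qed (use \<delta> \<kappa>0 \<kappa>r m0 in auto)
  let ?h = "cantor_fun \<delta> \<kappa> m"
  define H where "H t = (\<chi> l. ?h (t $ l))" for t :: "real^'n"
  define X where "X = {H t | t. \<forall>l. 0 \<le> t $ l \<and> t $ l < 1}"
  have X1: "X \<subseteq> ball 0 1"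
  proof
    fix x assume "x \<in> X"
    then obtain t where t: "x = H t" "\<And>l. 0 \<le> t $ l" "\<And>l. t $ l < 1" by (auto simp: X_def)
    have "norm x \<le> (\<Sum>l\<in>UNIV. \<bar>x $ l\<bar>)" by (rule norm_le_l1_cart)
    also have "\<dots> \<le> (\<Sum>l\<in>(UNIV::'n set). 4 / 3 * (\<delta> * real m))"
    proof (rule sum_mono)
      fix l show "\<bar>x $ l\<bar> \<le> 4 / 3 * (\<delta> * real m)"
        using C.cantor_fun_range[OF t(2,3), of l] by (simp add: t(1) H_def)
    qed
    also have "\<dots> = 4 / 3 * (n * (\<delta> * real m))" by (simp add: n_def)
    also have "\<dots> < 1" unfolding \<delta>m by simp
    finally show "x \<in> ball 0 1" by simp
  qed
  have X2: "\<exists>i x'. x' \<in> X \<and> s i = r \<and> x = c i + (\<tau> * r) *\<^sub>R x'" if x: "x \<in> X" for x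
  proof -
    obtain t where t: "x = H t" "\<And>l. 0 \<le> t $ l" "\<And>l. t $ l < 1" using x by (auto simp: X_def)
    define t' :: "real^'n" where "t' = (\<chi> l. cantor_shift m (t $ l))"
    obtain i where i: "c i = (\<chi> l. \<delta> * of_int \<lfloor>real m * t $ l\<rfloor>)" "s i = \<delta> / 4"
      using grid[of "\<lambda>l. \<lfloor>real m * t $ l\<rfloor>", OF conjI[OF C.digit_range[OF t(2,3)]]] by blast
    have "H t' \<in> X" using C.shift_range by (auto simp: X_def t'_def)
    moreover have "x = c i + \<kappa> *\<^sub>R H t'"
      using C.cantor_fun_unfold[OF t(2,3)] by (simp add: t(1) H_def t'_def i vec_eq_iff)
    ultimately show ?thesis using i(2) unfolding \<kappa>_def r_def by blast
  qed
  obtain z where "z \<in> \<Omega>" using \<Omega> by blast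
  then obtain R where R: "0 < R" "ball z R \<subseteq> \<Omega>" using \<Omega>(1) open_contains_ball by blast
  have B': "1 + 2 * 3 powr a \<le> r * \<tau> powr (- a)" using B unfolding r_eq B0_def by simp
  have r01: "0 < r" "r < 1" using \<delta> by (auto simp: r_def)
  have sing: "z + R *\<^sub>R x \<in> singular_set \<Omega> (P.F z R)" if "x \<in> X" for x
    by (rule P.singular_set_F[OF X2 X1 B' \<tau>(2) R(1) r01 R(2) that])
  have \<tau>2: "\<tau> \<le> 1 / 2" using \<tau> by simp
  have n\<beta>: "0 < n * \<beta>" using n \<beta> by simp
  have dim: "n * \<beta> \<le> hausdorff_dim (singular_set \<Omega> (P.F z R))"
  proof (rule hausdorff_dim_ge_if_inverse_Hoelder)
    show "bounded (singular_set \<Omega> (P.F z R))"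
      using \<Omega>(3) by (rule bounded_subset) (auto simp: singular_set_def)
    show "0 < n * \<beta>" by (rule n\<beta>)
    have box: "0 \<le> t $ l \<and> t $ l < 1" if "t \<in> box 0 One" for t :: "real^'n" and l
    proof -
      have b: "axis l (1::real) \<in> Basis" by (simp add: axis_in_Basis_iff)
      have "t \<bullet> axis l 1 < One \<bullet> (axis l 1 :: real^'n)" "0 < t \<bullet> axis l 1"
        using that b by (auto simp: mem_box)
      moreover have "One \<bullet> (axis l 1 :: real^'n) = 1" using b by (rule inner_sum_Basis)
      ultimately show ?thesis by (simp add: inner_axis)
    qed
    show "(\<lambda>t. z + R *\<^sub>R H t) ` box 0 One \<subseteq> singular_set \<Omega> (P.F z R)"
      using sing box by (force simp: X_def)
    define A where "A = real m * (2 / \<delta>) powr \<beta>"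
    have A0: "0 \<le> A" by (simp add: A_def)
    then show "0 \<le> n * (A * (1 / R) powr \<beta>)" using n by simp
    fix t t' :: "real^'n" assume t: "t \<in> box 0 One" "t' \<in> box 0 One"
    define D where "D = dist (z + R *\<^sub>R H t) (z + R *\<^sub>R H t')"
    have D: "D = R * norm (H t - H t')" using R by (simp add: D_def dist_norm flip: scaleR_diff_right)
    \<comment> \<open>The one-dimensional Hoelder bound is applied in each coordinate; passing to
      the l1 norm costs the factor n.\<close>
    have "dist t t' \<le> (\<Sum>l\<in>UNIV. \<bar>(t - t') $ l\<bar>)" unfolding dist_norm by (rule norm_le_l1_cart)
    also have "\<dots> \<le> (\<Sum>l\<in>(UNIV::'n set). A * (1 / R * D) powr \<beta>)"
    proof (rule sum_mono)
      fix l
      have "\<bar>(t - t') $ l\<bar> \<le> A * \<bar>?h (t $ l) - ?h (t' $ l)\<bar> powr \<beta>"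
        unfolding A_def vector_minus_component
        using box[OF t(1)] box[OF t(2)] \<beta> m m\<kappa>[folded r_eq, folded \<kappa>_def]
        by (intro C.cantor_fun_Hoelder) auto
      also have "\<dots> \<le> A * (1 / R * D) powr \<beta>"
      proof (intro mult_left_mono powr_mono2)
        have "?h (t $ l) - ?h (t' $ l) = (H t - H t') $ l" by (simp add: H_def)
        then show "\<bar>?h (t $ l) - ?h (t' $ l)\<bar> \<le> 1 / R * D"
          unfolding D using R component_le_norm_cart[of "H t - H t'" l] by simp
      qed (use A0 \<beta> in auto)
      finally show "\<bar>(t - t') $ l\<bar> \<le> A * (1 / R * D) powr \<beta>" .
    qed
    also have "\<dots> = n * (A * (1 / R * D) powr \<beta>)" by (simp add: n_def)
    also have "(1 / R * D) powr \<beta> = (1 / R) powr \<beta> * D powr \<beta>"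
      using R by (subst powr_mult) (auto simp: D)
    finally show "dist t t' \<le> n * (A * (1 / R) powr \<beta>) * dist (z + R *\<^sub>R H t) (z + R *\<^sub>R H t') powr (n * \<beta> / real CARD('n))"
      unfolding D_def n_def by (simp add: mult.assoc)
  qed
  have "n * (a / (1 + a) - \<epsilon> / n) \<le> n * \<beta>" using n by (intro mult_left_mono) (auto simp: \<beta>_def)
  then have "real CARD('n) * a / (1 + a) - \<epsilon> \<le> hausdorff_dim (singular_set \<Omega> (P.F z R))"
    using dim n by (simp add: right_diff_distrib n_def)
  then show ?thesis
    using P.sobolev_loc_F[OF \<tau>2 R(1) \<Omega>(1) _ p(2), of z] P.weakly_qr_F[OF \<tau>2 R(1) \<Omega>(1) K, of z] p(1)
    by (intro exI[of _ "P.F z R"]) auto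
qed

text \<open>Both parts choose the exponent in \<open>singular_quasiregular_exists\<close>:
  \<open>a\<close> is the smaller of \<open>K\<close> and nearly n - 1 for the first, slightly below
  n/p - 1 for the second. One half of \<open>\<epsilon>\<close> goes to the Cantor set, the other to
  the choice of \<open>a\<close>.\<close>

theorem theorem1p2:
  fixes dummy :: "real^'n::finite"
  assumes "CARD('n) \<ge> 3"
  shows "(\<forall>(K::real) (\<epsilon>::real) (\<Omega>::(real^'n) set).
            K \<ge> 1 \<and> \<epsilon> > 0 \<and> open \<Omega> \<and> connected \<Omega> \<and> \<Omega> \<noteq> {} \<and> bounded \<Omega> \<longrightarrow>
            (\<exists>f. sobolev_loc 1 \<Omega> f \<and> weakly_qr K \<Omega> f \<and>
                 hausdorff_dim (singular_set \<Omega> f)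
                   \<ge> min (real CARD('n) * K / (K + 1)) (real CARD('n) - 1) - \<epsilon>))
       \<and> (\<forall>p::real. 1 < p \<and> p < real CARD('n) \<longrightarrow>
            (\<exists>Kp\<ge>1. \<forall>(\<epsilon>::real) (\<Omega>::(real^'n) set).
                \<epsilon> > 0 \<and> open \<Omega> \<and> connected \<Omega> \<and> \<Omega> \<noteq> {} \<and> bounded \<Omega> \<longrightarrow>
                (\<exists>f. sobolev_loc p \<Omega> f \<and> weakly_qr Kp \<Omega> f \<and>
                     hausdorff_dim (singular_set \<Omega> f) \<ge> real CARD('n) - p - \<epsilon>)))"
proof (intro conjI allI impI)
  define n where "n = real CARD('n)"
  have n: "3 \<le> n" using assms by (simp add: n_def)
  fix K \<epsilon> :: real and \<Omega> :: "(real^'n) set"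
  assume A: "K \<ge> 1 \<and> \<epsilon> > 0 \<and> open \<Omega> \<and> connected \<Omega> \<and> \<Omega> \<noteq> {} \<and> bounded \<Omega>"
  \<comment> \<open>Room for the strict inequality \<open>1 + a < n\<close> when \<open>K\<close> is
    large; \<open>\<eta> \<le> 1\<close> together with \<open>n \<ge> 3\<close> keeps
    \<open>a\<close> at least 1.\<close>
  define \<eta> where "\<eta> = min 1 (\<epsilon> / 2)"
  define a where "a = min K (n - 1 - \<eta>)"
  have \<eta>: "0 < \<eta>" "\<eta> \<le> 1" "\<eta> \<le> \<epsilon> / 2" using A by (auto simp: \<eta>_def)
  have a: "1 \<le> a" "a \<le> K" "a \<le> n - 1 - \<eta>" using A n \<eta> by (auto simp: a_def)
  have "\<exists>f. sobolev_loc 1 \<Omega> f \<and> weakly_qr K \<Omega> f \<and>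
      real CARD('n) * a / (1 + a) - \<epsilon> / 2 \<le> hausdorff_dim (singular_set \<Omega> f)"
  proof (rule singular_quasiregular_exists)
    show "1 * (1 + a) < real CARD('n)" using a \<eta> by (simp add: n_def)
    have "1 * 1 \<le> K * a" using a A by (intro mult_mono) auto
    then show "1 \<le> K * a" by simp
  qed (use A a in auto)
  moreover have "min (n * K / (K + 1)) (n - 1) - \<epsilon> \<le> n * a / (1 + a) - \<epsilon> / 2"
  proof (cases "K \<le> n - 1 - \<eta>")
    case True
    then have "a = K" by (simp add: a_def)
    then have "n * a / (1 + a) = n * K / (K + 1)" by (simp add: add.commute)
    then show ?thesis using A by linarith
  next
    case False
    then have a_eq: "a = n - 1 - \<eta>" by (simp add: a_def)
    have "n - 1 - \<eta> \<le> n * a / (1 + a)"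
    proof -
      have "\<eta> * (1 + \<eta>) \<le> \<eta> * n" using \<eta> n by (intro mult_left_mono) auto
      then have "(n - 1 - \<eta>) * (1 + a) \<le> n * a" by (simp add: a_eq algebra_simps)
      then show ?thesis using a by (simp add: field_simps)
    qed
    then show ?thesis using \<eta> by linarith
  qed
  ultimately show "\<exists>f. sobolev_loc 1 \<Omega> f \<and> weakly_qr K \<Omega> f \<and>
      hausdorff_dim (singular_set \<Omega> f) \<ge> min (real CARD('n) * K / (K + 1)) (real CARD('n) - 1) - \<epsilon>"
    unfolding n_def by (meson order_trans)
next
  fix p :: real assume p: "1 < p \<and> p < real CARD('n)"
  define n where "n = real CARD('n)"
  have pn: "1 < p" "p < n" using p by (auto simp: n_def)
  define a0 where "a0 = n / p - 1"
  have a0: "0 < a0" using pn by (simp add: a0_def)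
  have a0p: "p * (1 + a0) = n" using pn by (simp add: a0_def)
  \<comment> \<open>Fixed before \<open>\<epsilon>\<close>: it dominates \<open>a\<close> and
    \<open>1 / a\<close> for every \<open>a\<close> between \<open>a0 / 2\<close> and
    \<open>a0\<close>.\<close>
  define Kp where "Kp = max 1 (max a0 (2 / a0))"
  show "\<exists>Kp\<ge>1. \<forall>(\<epsilon>::real) (\<Omega>::(real^'n) set).
      \<epsilon> > 0 \<and> open \<Omega> \<and> connected \<Omega> \<and> \<Omega> \<noteq> {} \<and> bounded \<Omega> \<longrightarrow>
      (\<exists>f. sobolev_loc p \<Omega> f \<and> weakly_qr Kp \<Omega> f \<and> hausdorff_dim (singular_set \<Omega> f) \<ge> real CARD('n) - p - \<epsilon>)"
  proof (intro exI[of _ Kp] conjI allI impI)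
    show "1 \<le> Kp" by (simp add: Kp_def)
    fix \<epsilon> :: real and \<Omega> :: "(real^'n) set"
    assume A: "\<epsilon> > 0 \<and> open \<Omega> \<and> connected \<Omega> \<and> \<Omega> \<noteq> {} \<and> bounded \<Omega>"
    \<comment> \<open>With \<open>1 + a = \<theta> * (1 + a0)\<close> the dimension is
      \<open>n - p / \<theta>\<close>. The first entry makes the loss at most
      \<open>\<epsilon> / 2\<close>, the second keeps \<open>a \<ge> a0 / 2\<close>, and
      \<open>\<theta> < 1\<close> gives the strict inequality
      \<open>p * (1 + a) < n\<close>.\<close>
    define \<theta> where "\<theta> = max (p / (p + \<epsilon> / 2)) ((1 + a0 / 2) / (1 + a0))"
    define a where "a = \<theta> * (1 + a0) - 1"
    have \<theta>: "p / (p + \<epsilon> / 2) \<le> \<theta>" "(1 + a0 / 2) / (1 + a0) \<le> \<theta>" "\<theta> < 1" "0 < \<theta>"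
      using pn A a0 by (auto simp: \<theta>_def field_simps less_max_iff_disj)
    have ah: "a0 / 2 \<le> a" using \<theta>(2) a0 by (simp add: a_def field_simps)
    have al: "a < a0"
    proof -
      have "\<theta> * (1 + a0) < 1 * (1 + a0)" using \<theta> a0 by (intro mult_strict_right_mono) auto
      then show ?thesis by (simp add: a_def)
    qed
    have a_pos: "0 < a" using ah a0 by linarith
    have "\<exists>f. sobolev_loc p \<Omega> f \<and> weakly_qr Kp \<Omega> f \<and>
        real CARD('n) * a / (1 + a) - \<epsilon> / 2 \<le> hausdorff_dim (singular_set \<Omega> f)"
    proof (rule singular_quasiregular_exists)
      have "p * (1 + a) < p * (1 + a0)" using al pn by (intro mult_strict_left_mono) auto
      then show "p * (1 + a) < real CARD('n)" unfolding a0p n_def .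
      show "a \<le> Kp" using al by (simp add: Kp_def)
      have "1 = 2 / a0 * (a0 / 2)" using a0 by simp
      also have "\<dots> \<le> Kp * a" using ah a0 by (intro mult_mono) (auto simp: Kp_def)
      finally show "1 \<le> Kp * a" .
    qed (use A a_pos pn in \<open>auto simp: Kp_def\<close>)
    moreover have "n - p - \<epsilon> \<le> n * a / (1 + a) - \<epsilon> / 2"
    proof -
      have 1: "1 + a = \<theta> * (1 + a0)" by (simp add: a_def)
      have "n * a / (1 + a) = n - n / (1 + a)" using a_pos by (simp add: field_simps)
      moreover have "n / (1 + a) = p / \<theta>" unfolding 1 a0p[symmetric] using a0 by simp
      moreover have "p / \<theta> \<le> p + \<epsilon> / 2" using \<theta>(1,4) pn A by (simp add: field_simps)
      ultimately show ?thesis by linarith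
    qed
    ultimately show "\<exists>f. sobolev_loc p \<Omega> f \<and> weakly_qr Kp \<Omega> f \<and> hausdorff_dim (singular_set \<Omega> f) \<ge> real CARD('n) - p - \<epsilon>"
      unfolding n_def by (meson order_trans)
  qed
qed

end
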